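(* Let $\mathfrak g$ be the simple complex Lie algebra of type $D_4$, with the numbering of positive roots fixed in the context. Write elements of $(\mathfrak t_{\mathbb Z}^*\otimes\mathbb Q)\oplus\mathbb Q^{12}$ as $(\lambda,p_1,\dots,p_{12})$ with $\lambda=k_1\omega_1+k_2\omega_2+k_3\omega_3+k_4\omega_4$. The cone $\Sigma^f_{\mathbb Q}$ is given by the inequalities $p_i\ge 0$ $(i=1,\dots,12)$ together with: 1. $p_{12}\leq k_1$ 2. $p_{11}\leq k_2$ 3. $p_9\leq k_3$ 4. $p_4\leq k_4$ 5. $p_7+p_{11}+p_{12}\leq k_1+k_2$ 6. $p_7+p_8+p_9+p_{10}+p_{12}\leq k_1+k_2+k_3$ 7. $p_7+p_9+p_{10}+p_{11}+p_{12}\leq k_1+k_2+k_3$ 8. $p_9+p_{10}+p_{11}\leq k_2+k_3$ 9. $p_4+p_5+p_6+p_7+p_{12}\leq k_1+k_2+k_4$ 10. $p_4+p_5+p_7+p_{11}+p_{12}\leq k_1+k_2+k_4$ 11. $p_4+p_5+p_{11}\leq k_2+k_4$ 12. $p_2+p_4+p_5+p_9+p_{10}\leq k_2+k_3+k_4$ 13. $p_4+p_5+p_9+p_{10}+p_{11}\leq k_2+k_3+k_4$ 14. $p_3+p_4+p_5+p_6+p_7+p_9+p_{12}\leq k_1+k_2+k_3+k_4$ 15. $p_2+p_3+p_4+p_5+p_7+p_9+p_{12}\leq k_1+k_2+k_3+k_4$ 16. $p_2+p_3+p_4+p_7+p_8+p_9+p_{12}\leq k_1+k_2+k_3+k_4$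 17. $p_2+p_4+p_7+p_8+p_9+p_{10}+p_{12}\leq k_1+k_2+k_3+k_4$ 18. $p_4+p_5+p_7+p_9+p_{10}+p_{11}+p_{12}\leq k_1+k_2+k_3+k_4$ 19. $p_2+p_4+p_5+p_7+p_9+p_{10}+p_{12}\leq k_1+k_2+k_3+k_4$ 20. $p_1+p_3+p_4+p_5+p_6+p_7+p_8+p_9+p_{11}\leq k_1+2k_2+k_3+k_4$ 21. $p_1+p_2+p_3+p_4+p_5+p_7+p_8+p_9+p_{11}\leq k_1+2k_2+k_3+k_4$ 22. $p_3+p_4+p_5+p_6+p_7+p_8+p_9+p_{11}+p_{12}\leq k_1+2k_2+k_3+k_4$ 23. $p_2+p_3+p_4+p_5+p_7+p_8+p_9+p_{11}+p_{12}\leq k_1+2k_2+k_3+k_4$ 24. $p_1+p_2+p_4+p_5+p_7+p_8+p_9+p_{10}+p_{11}\leq k_1+2k_2+k_3+k_4$ 25. $p_2+p_4+p_5+p_7+p_8+p_9+p_{10}+p_{11}+p_{12}\leq k_1+2k_2+k_3+k_4$ 26. $p_1+p_4+p_5+p_6+p_7+p_8+p_9+p_{10}+p_{11}\leq k_1+2k_2+k_3+k_4$ 27. $p_4+p_5+p_6+p_7+p_8+p_9+p_{10}+p_{11}+p_{12}\leq k_1+2k_2+k_3+k_4$ 28. $p_2+p_3+p_4+p_5+p_7+p_8+2p_9+p_{10}+p_{11}+p_{12}\leq k_1+2k_2+2k_3+k_4$ 29. $p_3+p_4+p_5+p_6+p_7+p_8+2p_9+p_{10}+p_{11}+p_{12}\leq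 k_1+2k_2+2k_3+k_4$ 30. $p_1+p_2+p_3+p_4+p_5+p_7+p_8+2p_9+p_{10}+p_{11}\leq k_1+2k_2+2k_3+k_4$ 31. $p_1+p_3+p_4+p_5+p_6+p_7+p_8+2p_9+p_{10}+p_{11}\leq k_1+2k_2+2k_3+k_4$ 32. $p_2+p_4+p_5+p_7+p_8+2p_9+2p_{10}+p_{11}+p_{12}\leq k_1+2k_2+2k_3+k_4$ 33. $p_2+p_3+2p_4+p_5+p_6+p_7+p_8+p_9+p_{11}+p_{12}\leq k_1+2k_2+k_3+2k_4$ 34. $p_2+2p_4+p_5+p_6+p_7+p_8+p_9+p_{10}+p_{11}+p_{12}\leq k_1+2k_2+k_3+2k_4$ 35. $p_1+p_2+p_3+2p_4+p_5+p_6+p_7+p_8+p_9+p_{11}\leq k_1+2k_2+k_3+2k_4$ 36. $p_1+p_2+2p_4+p_5+p_6+p_7+p_8+p_9+p_{10}+p_{11}\leq k_1+2k_2+k_3+2k_4$ 37. $p_2+p_3+2p_4+2p_5+p_6+p_7+p_9+p_{11}+p_{12}\leq k_1+2k_2+k_3+2k_4$ 38. $p_2+2p_4+2p_5+p_6+p_7+p_9+p_{10}+p_{11}+p_{12}\leq k_1+2k_2+k_3+2k_4$ 39. $p_3+p_4+p_5+p_6+2p_7+p_8+p_9+p_{11}+2p_{12}\leq 2k_1+2k_2+k_3+k_4$ 40. $p_4+p_5+p_6+2p_7+p_8+p_9+p_{10}+p_{11}+2p_{12}\leq 2k_1+2k_2+k_3+k_4$ 41. $p_2+p_3+p_4+p_5+2p_7+p_8+p_9+p_{11}+2p_{12}\leq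 2k_1+2k_2+k_3+k_4$ 42. $p_2+p_4+p_5+2p_7+p_8+p_9+p_{10}+p_{11}+2p_{12}\leq 2k_1+2k_2+k_3+k_4$ 43. $p_1+p_2+p_3+2p_4+p_5+p_6+p_7+p_8+2p_9+p_{10}+p_{11}\leq k_1+2k_2+2k_3+2k_4$ 44. $p_2+p_3+2p_4+p_5+p_6+p_7+p_8+2p_9+p_{10}+p_{11}+p_{12}\leq k_1+2k_2+2k_3+2k_4$ 45. $p_2+p_3+2p_4+2p_5+p_6+p_7+2p_9+p_{10}+p_{11}+p_{12}\leq k_1+2k_2+2k_3+2k_4$ 46. $p_2+p_3+2p_4+p_5+p_6+2p_7+p_8+p_9+p_{11}+2p_{12}\leq 2k_1+2k_2+k_3+2k_4$ 47. $p_2+2p_4+p_5+p_6+2p_7+p_8+p_9+p_{10}+p_{11}+2p_{12}\leq 2k_1+2k_2+k_3+2k_4$ 48. $p_2+p_3+2p_4+2p_5+p_6+2p_7+p_9+p_{11}+2p_{12}\leq 2k_1+2k_2+k_3+2k_4$ 49. $p_2+2p_4+2p_5+p_6+2p_7+p_9+p_{10}+p_{11}+2p_{12}\leq 2k_1+2k_2+k_3+2k_4$ 50. $p_2+p_3+p_4+p_5+2p_7+p_8+2p_9+p_{10}+p_{11}+2p_{12}\leq 2k_1+2k_2+2k_3+k_4$ 51. $p_3+p_4+p_5+p_6+2p_7+p_8+2p_9+p_{10}+p_{11}+2p_{12}\leq 2k_1+2k_2+2k_3+k_4$ 52. $p_2+p_4+p_5+2p_7+p_8+2p_9+2p_{10}+p_{11}+2p_{12}\leq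 2k_1+2k_2+2k_3+k_4$ 53. $p_2+p_3+2p_4+p_5+p_6+2p_7+p_8+2p_9+p_{10}+p_{11}+2p_{12}\leq 2k_1+2k_2+2k_3+2k_4$ 54. $p_2+p_3+2p_4+2p_5+p_6+2p_7+2p_9+p_{10}+p_{11}+2p_{12}\leq 2k_1+2k_2+2k_3+2k_4$ 55. $p_2+p_3+2p_4+2p_5+p_6+p_7+p_8+p_9+2p_{11}+p_{12}\leq k_1+3k_2+k_3+2k_4$ 56. $p_2+2p_4+2p_5+p_6+p_7+p_8+p_9+p_{10}+2p_{11}+p_{12}\leq k_1+3k_2+k_3+2k_4$ 57. $p_1+p_2+p_3+2p_4+2p_5+p_6+p_7+p_8+p_9+2p_{11}\leq k_1+3k_2+k_3+2k_4$ 58. $p_1+p_2+2p_4+2p_5+p_6+p_7+p_8+p_9+p_{10}+2p_{11}\leq k_1+3k_2+k_3+2k_4$ 59. $p_1+p_2+2p_4+2p_5+p_6+p_7+p_8+2p_9+2p_{10}+2p_{11}\leq k_1+3k_2+2k_3+2k_4$ 60. $p_2+2p_4+2p_5+p_6+p_7+p_8+2p_9+2p_{10}+2p_{11}+p_{12}\leq k_1+3k_2+2k_3+2k_4$ 61. $p_1+p_2+2p_4+2p_5+p_6+2p_7+p_8+p_9+p_{10}+2p_{11}+p_{12}\leq 2k_1+3k_2+k_3+2k_4$ 62. $p_1+p_2+p_3+2p_4+2p_5+p_6+2p_7+p_8+p_9+2p_{11}+p_{12}\leq 2k_1+3k_2+k_3+2k_4$ 63. $p_1+p_2+2p_4+2p_5+p_6+2p_7+p_8+2p_9+2p_{10}+2p_{11}+p_{12}\leq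 2k_1+3k_2+2k_3+2k_4$ 64. $p_2+p_3+2p_4+2p_5+p_6+p_7+p_8+3p_9+2p_{10}+2p_{11}+p_{12}\leq k_1+3k_2+3k_3+2k_4$ 65. $p_1+p_2+p_3+2p_4+2p_5+p_6+p_7+p_8+3p_9+2p_{10}+2p_{11}\leq k_1+3k_2+3k_3+2k_4$ 66. $p_2+p_3+2p_4+2p_5+p_6+3p_7+p_8+p_9+2p_{11}+3p_{12}\leq 3k_1+3k_2+k_3+2k_4$ 67. $p_2+2p_4+2p_5+p_6+3p_7+p_8+p_9+p_{10}+2p_{11}+3p_{12}\leq 3k_1+3k_2+k_3+2k_4$ 68. $p_2+p_3+2p_4+2p_5+p_6+3p_7+p_8+3p_9+2p_{10}+2p_{11}+3p_{12}\leq 3k_1+3k_2+3k_3+2k_4$ 69. $p_1+p_2+p_3+2p_4+2p_5+p_6+2p_7+p_8+3p_9+2p_{10}+2p_{11}+p_{12}\leq 2k_1+3k_2+3k_3+2k_4$ 70. $p_2+2p_4+2p_5+p_6+3p_7+p_8+2p_9+2p_{10}+2p_{11}+3p_{12}\leq 3k_1+3k_2+2k_3+2k_4$.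
   Context: Let $\mathfrak g=\mathfrak u^-\oplus\mathfrak t\oplus\mathfrak u$ be the triangular decomposition, with $\mathfrak t$ a Cartan subalgebra, $\mathfrak u=\langle e_\alpha\mid\alpha\in\Delta_+\rangle$, $\mathfrak u^-=\langle e_{-\alpha}\mid\alpha\in\Delta_+\rangle$, where $\Delta_+$ is the set of positive roots and $e_{\pm\alpha}$ are root vectors. $\mathfrak t_{\mathbb Z}^*$ denotes the weight lattice. $V(\lambda)$ is the irreducible finite-dimensional $\mathfrak g$-module with dominant (integral) highest weight $\lambda$ and $v_\lambda$ is a highest weight vector. Roots of $D_4$: the weights of $V(\omega_1)$ are $\pm\varepsilon_1,\dots,\pm\varepsilon_4$; the simple roots are $\beta_1=\varepsilon_1-\varepsilon_2$, $\beta_2=\varepsilon_2-\varepsilon_3$, $\beta_3=\varepsilon_3-\varepsilon_4$, $\beta_4=\varepsilon_3+\varepsilon_4$, and $\omega_1,\dots,\omega_4$ are the corresponding fundamental weights. The positive roots are numbered $\alpha_1=\varepsilon_1+\varepsilon_2$, $\alpha_2=\varepsilon_2+\varepsilon_3$, $\alpha_3=\varepsilon_1+\varepsilon_3$, $\alpha_4=\varepsilon_3+\varepsilon_4$, $\alpha_5=\varepsilon_2+\varepsilon_4$, $\alpha_6=\varepsilon_1+\varepsilon_4$, $\alpha_7=\varepsilon_1-\varepsilon_3$, $\alpha_8=\varepsilon_1-\varepsilon_4$, $\alpha_9=\varepsilon_3-\varepsilon_4$, $\alpha_{10}=\varepsilon_2-\varepsilon_4$, $\alpha_{11}=\varepsilon_2-\varepsilon_3$,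 $\alpha_{12}=\varepsilon_1-\varepsilon_2$. A signature (with $N=12$) is a tuple $\sigma=(\lambda,p_1,\dots,p_N)$ with $\lambda$ a dominant weight and $p_i\in\mathbb Z_{\ge0}$; $\lambda$ is called the highest weight of $\sigma$. Put $v(\sigma)=e_{-\alpha_1}^{p_1}\cdots e_{-\alpha_N}^{p_N}\cdot v_\lambda\in V(\lambda)$. Signatures with the same highest weight $\lambda$ are ordered as follows: for $\sigma=(\lambda,p_1,\dots,p_N)$ and $\sigma'=(\lambda,p_1',\dots,p_N')$ set $q_i=\sum_{j=1}^{N-i+1}p_j$, $q_i'=\sum_{j=1}^{N-i+1}p_j'$; then $\sigma<\sigma'$ iff $(q_1,\dots,q_N)<(q_1',\dots,q_N')$ lexicographically. A signature $\sigma$ is essential if $v(\sigma)\notin\langle v(\tau)\mid\tau<\sigma\rangle$, where $\langle\cdots\rangle$ denotes linear span and $\tau$ runs over signatures with the same highest weight as $\sigma$. $\Sigma^f\subset\mathfrak t_{\mathbb Z}^*\oplus\mathbb Z^{12}$ is the semigroup generated by the essential signatures of fundamental highest weights $\omega_1,\dots,\omega_4$; $\Sigma^f_{\mathbb Q}$ is the rational cone spanned by $\Sigma^f$ (all finite linear combinations of elements of $\Sigma^f$ with nonnegative rational coefficients). *)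

theory Defs
  imports
    Complex_Main
    "HOL-Library.Function_Algebras"
    "HOL-Library.Product_Plus"
begin

section \<open>Complex Lie algebras\<close>

locale lie_algebra = vector_space scale
  for scale :: "complex \<Rightarrow> 'g::ab_group_add \<Rightarrow> 'g" +
  fixes bracket :: "'g \<Rightarrow> 'g \<Rightarrow> 'g"
  assumes linear_bracket_left: "Vector_Spaces.linear scale scale (\<lambda>x. bracket x y)"
    and linear_bracket_right: "Vector_Spaces.linear scale scale (bracket x)"
    and bracket_self: "bracket x x = 0"
    and jacobi: "bracket x (bracket y z) + bracket y (bracket z x) + bracket z (bracket x y) = 0"
begin

definition lie_ideal :: "'g set \<Rightarrow> bool" where
  "lie_ideal I \<longleftrightarrow> subspace I \<and> (\<forall>x. \<forall>y\<in>I. bracket x y \<in> I)"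

definition simple_lie :: bool where
  "simple_lie \<longleftrightarrow>
     (\<exists>x y. bracket x y \<noteq> 0) \<and> (\<forall>I. lie_ideal I \<longrightarrow> I = {0} \<or> I = UNIV)"

text \<open>
  The usual definition for semisimple complex Lie algebras: a maximal abelian subalgebra
  all of whose elements are ad-diagonalizable.
\<close>

definition cartan_subalgebra :: "'g set \<Rightarrow> bool" where
  "cartan_subalgebra T \<longleftrightarrow>
     subspace T \<and>
     (\<forall>x\<in>T. \<forall>y\<in>T. bracket x y = 0) \<and>
     (\<forall>x. (\<forall>h\<in>T. bracket h x = 0) \<longrightarrow> x \<in> T) \<and>
     (\<forall>h\<in>T. span {x. \<exists>c. bracket h x = scale c x} = UNIV)"

text \<open>
  Linear functionals on a Cartan subalgebra \<open>T\<close> are represented by functions on the whole type,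
  of which only the values on \<open>T\<close> matter.
\<close>

definition root_space :: "'g set \<Rightarrow> ('g \<Rightarrow> complex) \<Rightarrow> 'g set" where
  "root_space T \<alpha> = {x. \<forall>h\<in>T. bracket h x = scale (\<alpha> h) x}"

definition is_root :: "'g set \<Rightarrow> ('g \<Rightarrow> complex) \<Rightarrow> bool" where
  "is_root T \<alpha> \<longleftrightarrow> (\<exists>h\<in>T. \<alpha> h \<noteq> 0) \<and> root_space T \<alpha> \<noteq> {0}"

end


section \<open>Type \<open>D\<^sub>4\<close>\<close>

text \<open>
  Here \<open>\<epsilon> 1, \<dots>, \<epsilon> 4\<close> are functionals on the Cartan subalgebra, and \<open>pos_root \<epsilon> i\<close> is the
  \<open>i\<close>-th positive root, \<open>i = 1, \<dots>, 12\<close>. The simple roots are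
  \<open>\<beta>\<^sub>1 = pos_root \<epsilon> 12\<close>, \<open>\<beta>\<^sub>2 = pos_root \<epsilon> 11\<close>, \<open>\<beta>\<^sub>3 = pos_root \<epsilon> 9\<close>, \<open>\<beta>\<^sub>4 = pos_root \<epsilon> 4\<close>.
\<close>

definition pos_root :: "(nat \<Rightarrow> 'g \<Rightarrow> complex) \<Rightarrow> nat \<Rightarrow> 'g \<Rightarrow> complex" where
  "pos_root \<epsilon> i h =
     [\<epsilon> 1 h + \<epsilon> 2 h, \<epsilon> 2 h + \<epsilon> 3 h, \<epsilon> 1 h + \<epsilon> 3 h, \<epsilon> 3 h + \<epsilon> 4 h,
      \<epsilon> 2 h + \<epsilon> 4 h, \<epsilon> 1 h + \<epsilon> 4 h, \<epsilon> 1 h - \<epsilon> 3 h, \<epsilon> 1 h - \<epsilon> 4 h,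
      \<epsilon> 3 h - \<epsilon> 4 h, \<epsilon> 2 h - \<epsilon> 4 h, \<epsilon> 2 h - \<epsilon> 3 h, \<epsilon> 1 h - \<epsilon> 2 h] ! (i - 1)"

definition fund_weight :: "(nat \<Rightarrow> 'g \<Rightarrow> complex) \<Rightarrow> nat \<Rightarrow> 'g \<Rightarrow> complex" where
  "fund_weight \<epsilon> i h =
     [\<epsilon> 1 h, \<epsilon> 1 h + \<epsilon> 2 h,
      (\<epsilon> 1 h + \<epsilon> 2 h + \<epsilon> 3 h - \<epsilon> 4 h) / 2, (\<epsilon> 1 h + \<epsilon> 2 h + \<epsilon> 3 h + \<epsilon> 4 h) / 2] ! (i - 1)"

text \<open>
  The roots all have length \<open>\<surd>2\<close> when the \<open>\<epsilon> i\<close> are taken to be orthonormal, so the coordinates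
  \<open>\<epsilon> m h\<close> of the coroot \<open>h\<close> of \<open>\<beta>\<^sub>j\<close> are the coefficients of \<open>\<beta>\<^sub>j\<close> itself. The weights above are
  dual to these coroots.
\<close>

lemma fund_weight_dual:
  fixes h :: "nat \<Rightarrow> 'g"
  assumes "\<And>m j. m \<in> {1..4} \<Longrightarrow> j \<in> {1..4} \<Longrightarrow>
    \<epsilon> m (h j) = [[1, -1, 0, 0], [0, 1, -1, 0], [0, 0, 1, -1], [0, 0, 1, 1]] ! (j - 1) ! (m - 1)"
    and "i \<in> {1..4}" "j \<in> {1..4}"
  shows "fund_weight \<epsilon> i (h j) = (if i = j then 1 else 0)"
proof -
  have "i = 1 \<or> i = 2 \<or> i = 3 \<or> i = 4" "j = 1 \<or> j = 2 \<or> j = 3 \<or> j = 4"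
    using assms(2,3) by auto
  then show ?thesis
    using assms(1)[of 1 j] assms(1)[of 2 j] assms(1)[of 3 j] assms(1)[of 4 j]
    by (elim disjE) (simp_all add: fund_weight_def)
qed

text \<open>
  The simple Lie algebra of type \<open>D\<^sub>4\<close> with a Cartan subalgebra \<open>T\<close>, the basis \<open>\<epsilon> 1, \<dots>, \<epsilon> 4\<close> of the
  dual of \<open>T\<close> in which the roots are \<open>\<plusminus>\<epsilon>\<^sub>i \<plusminus> \<epsilon>\<^sub>j\<close>, and root vectors \<open>e i\<close>, \<open>f i\<close> for the \<open>i\<close>-th positive
  root and its negative. That the sum in \<open>triangular\<close> is direct is automatic, since the summands
  consist of weight vectors of different weights.
\<close>

locale d4_lie_algebra = lie_algebra scale bracket
  for scale :: "complex \<Rightarrow> 'g::ab_group_add \<Rightarrow> 'g" and bracket :: "'g \<Rightarrow> 'g \<Rightarrow> 'g" +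
  fixes T :: "'g set"
    and \<epsilon> :: "nat \<Rightarrow> 'g \<Rightarrow> complex"
    and e f :: "nat \<Rightarrow> 'g"
  assumes finite_dim: "\<exists>B. finite B \<and> span B = UNIV"
    and simple: "simple_lie"
    and cartan: "cartan_subalgebra T"
    and eps_add: "i \<in> {1..4} \<Longrightarrow> x \<in> T \<Longrightarrow> y \<in> T \<Longrightarrow> \<epsilon> i (x + y) = \<epsilon> i x + \<epsilon> i y"
    and eps_scale: "i \<in> {1..4} \<Longrightarrow> x \<in> T \<Longrightarrow> \<epsilon> i (scale c x) = c * \<epsilon> i x"
    and eps_basis: "\<exists>!h. h \<in> T \<and> (\<forall>i\<in>{1..4}. \<epsilon> i h = a i)"
    and roots: "is_root T \<alpha> \<longleftrightarrow>
      (\<exists>i\<in>{1..4}. \<exists>j\<in>{1..4}. \<exists>s\<in>{1, -1}. \<exists>t\<in>{1, -1}.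
         i < j \<and> (\<forall>h\<in>T. \<alpha> h = s * \<epsilon> i h + t * \<epsilon> j h))"
    and e_root_vector: "i \<in> {1..12} \<Longrightarrow> e i \<in> root_space T (pos_root \<epsilon> i) - {0}"
    and f_root_vector: "i \<in> {1..12} \<Longrightarrow> f i \<in> root_space T (\<lambda>h. - pos_root \<epsilon> i h) - {0}"
    and triangular: "span (f ` {1..12} \<union> T \<union> e ` {1..12}) = UNIV"


section \<open>Irreducible modules with given highest weight\<close>

text \<open>
  The weight \<open>k\<^sub>1\<omega>\<^sub>1 + k\<^sub>2\<omega>\<^sub>2 + k\<^sub>3\<omega>\<^sub>3 + k\<^sub>4\<omega>\<^sub>4\<close> is represented by its coordinate function \<open>k\<close>, which
  vanishes outside \<open>{1..4}\<close>.
\<close>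

definition weight :: "(nat \<Rightarrow> 'g \<Rightarrow> complex) \<Rightarrow> (nat \<Rightarrow> int) \<Rightarrow> 'g \<Rightarrow> complex" where
  "weight \<epsilon> k h = (\<Sum>i=1..4. of_int (k i) * fund_weight \<epsilon> i h)"

definition fund_coords :: "nat \<Rightarrow> nat \<Rightarrow> int" where
  "fund_coords i = (\<lambda>j. if j = i then 1 else 0)"

locale d4_irrep =
  d4_lie_algebra scale bracket T \<epsilon> e f + V: vector_space scaleV
  for scale :: "complex \<Rightarrow> 'g::ab_group_add \<Rightarrow> 'g" and bracket :: "'g \<Rightarrow> 'g \<Rightarrow> 'g"
    and T :: "'g set" and \<epsilon> :: "nat \<Rightarrow> 'g \<Rightarrow> complex" and e f :: "nat \<Rightarrow> 'g"
    and scaleV :: "complex \<Rightarrow> 'v::ab_group_add \<Rightarrow> 'v" +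
  fixes act :: "'g \<Rightarrow> 'v \<Rightarrow> 'v"
    and k :: "nat \<Rightarrow> int"
    and v :: 'v
  assumes linear_act_left: "Vector_Spaces.linear scale scaleV (\<lambda>x. act x w)"
    and linear_act_right: "Vector_Spaces.linear scaleV scaleV (act x)"
    and act_bracket: "act (bracket x y) w = act x (act y w) - act y (act x w)"
    and finite_dim_V: "\<exists>B. finite B \<and> V.span B = UNIV"
    and irreducible: "V.subspace W \<Longrightarrow> (\<And>x w. w \<in> W \<Longrightarrow> act x w \<in> W) \<Longrightarrow> W = {0} \<or> W = UNIV"
    and dominant: "i \<in> {1..4} \<Longrightarrow> 0 \<le> k i"
    and weight_support: "i \<notin> {1..4} \<Longrightarrow> k i = 0"
    and hw_nonzero: "v \<noteq> 0"
    and hw_weight: "h \<in> T \<Longrightarrow> act h v = scaleV (weight \<epsilon> k h) v"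
    and hw_annihilated: "i \<in> {1..12} \<Longrightarrow> act (e i) v = 0"


section \<open>Essential signatures\<close>

definition exponents :: "(nat \<Rightarrow> nat) set" where
  "exponents = {p. \<forall>i. i \<notin> {1..12} \<longrightarrow> p i = 0}"

text \<open>\<open>f\<^sub>1\<^bsup>p\<^sub>1\<^esup> \<cdots> f\<^sub>1\<^sub>2\<^bsup>p\<^sub>1\<^sub>2\<^esup> v\<close>, so that \<open>f 12\<close> acts first.\<close>

definition monomial_vector ::
    "(nat \<Rightarrow> 'g) \<Rightarrow> ('g \<Rightarrow> 'v \<Rightarrow> 'v) \<Rightarrow> 'v \<Rightarrow> (nat \<Rightarrow> nat) \<Rightarrow> 'v" where
  "monomial_vector f act v p = foldr (\<lambda>i. act (f i) ^^ p i) [1..<13] v"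

definition partial_sum :: "(nat \<Rightarrow> nat) \<Rightarrow> nat \<Rightarrow> nat" where
  "partial_sum p i = (\<Sum>j=1..12 - i + 1. p j)"

definition exponent_less :: "(nat \<Rightarrow> nat) \<Rightarrow> (nat \<Rightarrow> nat) \<Rightarrow> bool" where
  "exponent_less p p' \<longleftrightarrow>
     (\<exists>i\<in>{1..12}. (\<forall>j\<in>{1..<i}. partial_sum p j = partial_sum p' j) \<and>
        partial_sum p i < partial_sum p' i)"

definition essential_signatures ::
    "(nat \<Rightarrow> 'g) \<Rightarrow> (complex \<Rightarrow> 'v::ab_group_add \<Rightarrow> 'v) \<Rightarrow> ('g \<Rightarrow> 'v \<Rightarrow> 'v) \<Rightarrow> (nat \<Rightarrow> int) \<Rightarrow> 'v
      \<Rightarrow> ((nat \<Rightarrow> int) \<times> (nat \<Rightarrow> int)) set" where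
  "essential_signatures f scaleV act k v =
     {(k, \<lambda>i. int (p i)) | p. p \<in> exponents \<and>
        monomial_vector f act v p \<notin>
          module.span scaleV {monomial_vector f act v p' | p'. p' \<in> exponents \<and> exponent_less p' p}}"


section \<open>Semigroups and rational cones\<close>

inductive_set semigroup_generated :: "'a::plus set \<Rightarrow> 'a set" for S where
  generator: "s \<in> S \<Longrightarrow> s \<in> semigroup_generated S"
| add: "s \<in> semigroup_generated S \<Longrightarrow> t \<in> semigroup_generated S \<Longrightarrow> s + t \<in> semigroup_generated S"

definition rational_cone ::
    "((nat \<Rightarrow> int) \<times> (nat \<Rightarrow> int)) set \<Rightarrow> ((nat \<Rightarrow> rat) \<times> (nat \<Rightarrow> rat)) set" where
  "rational_cone S =
     {(\<lambda>i. \<Sum>s\<in>F. c s * of_int (fst s i), \<lambda>i. \<Sum>s\<in>F. c s * of_int (snd s i)) | F c.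
        finite F \<and> F \<subseteq> S \<and> (\<forall>s\<in>F. 0 \<le> c s)}"

end

theory Submission
  imports Defs
begin

text \<open>
  The proof finds the essential signatures of the four fundamental modules and then passes from
  the resulting 52 generators of the cone to its inequalities.

  \<^bold>\<open>The Lie algebra.\<close> For root vectors \<open>X a\<close> one has \<open>[X a, X (-a)] = c a\<close> times the coroot of \<open>a\<close>, and
  \<open>[X a, X b] = N a b\<close> times \<open>X (a + b)\<close>. The Jacobi identity ties these scalars together so that the
  root vectors with \<open>c a = 0\<close> span an ideal. As the algebra is simple, no \<open>c a\<close> vanishes, and then
  no \<open>N a b\<close> with \<open>a + b\<close> a root does (\<open>c_nonzero\<close>, \<open>N_nonzero\<close>). From there on it suffices to know
  all vectors up to nonzero scalars, so signs of structure constants never matter.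

  \<^bold>\<open>Essential signatures.\<close> The vectors \<open>v(\<sigma>)\<close> are weight vectors, so whether a signature is essential
  is decided inside one weight space. In each fundamental module the essential signatures of a given
  weight turn out to be the first ones, in number equal to the multiplicity of the weight, among all
  signatures of this weight, up to some signatures whose vector vanishes for the trivial reason that
  \<open>f 12\<close> kills the highest weight vector of \<open>V(\<omega>\<^sub>2)\<close>. If some vectors form a basis of the module, then
  comparing them with the finitely many signatures of the same weights therefore proves that they
  are the essential ones (\<open>essential_signatures_eq\<close>). The module \<open>V(\<omega>\<^sub>2)\<close> is the adjoint
  one, because irreducible modules with the same highest weight yield the same signatures
  (\<open>essential_signatures_unique\<close>), and there all vectors are known from the bracket. The other three
  modules are minuscule: their weight spaces are lines, and a root vector maps such a line
  isomorphically onto the next one whenever the pairing of weight and coroot allows it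
  (\<open>essential_signatures_minuscule\<close>).

  \<^bold>\<open>The cone.\<close> The generators are inserted one after the other, beginning with a simplicial cone
  spanned by 16 of them. If a cone \<open>C\<close> is known by inequalities, then \<open>x\<close> lies in \<open>C\<close> plus the ray of
  \<open>g\<close> iff \<open>x - t g\<close> lies in \<open>C\<close> for some \<open>t \<ge> 0\<close>, and Fourier--Motzkin elimination of \<open>t\<close> gives the
  inequalities of the larger cone: those of \<open>C\<close> that are nonnegative on \<open>g\<close>, and for each pair of
  one positive and one negative on \<open>g\<close> the combination that vanishes on \<open>g\<close>. Most of these
  combinations are redundant, being nonnegative combinations of others, and recording this redundancy
  keeps the lists short. Every inequality left after the last generator is one of those in the
  theorem (\<open>insertions_ok_insertions\<close>), while conversely all generators satisfy the latter.
\<close>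

section \<open>Eigenvectors in a span of eigenvectors\<close>

text \<open>
  Applying \<open>D - b\<close> to a combination of eigenvectors removes those with eigenvalue \<open>b\<close> and rescales
  the others, and it multiplies \<open>x\<close> by the nonzero number \<open>d - b\<close>. So the eigenvalues other than \<open>d\<close>
  can be peeled off one at a time. The eigenvectors form an indexed family, since below they are
  monomials and distinct monomials may give the same vector.
\<close>

lemma (in vector_space) eigenvector_in_span_of_eigenvectors:
  assumes D: "Vector_Spaces.linear scale scale D"
    and eigen: "\<And>i. i \<in> I \<Longrightarrow> D (s i) = scale (c i) (s i)"
    and x: "x \<in> span (s ` I)" "D x = scale d x"
  shows "x \<in> span (s ` {i \<in> I. c i = d})"
proof -
  interpret D: Vector_Spaces.linear scale scale D by fact
  have remove: "D y - scale b y \<in> span (s ` {i \<in> J. c i \<noteq> b})"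
    if "y \<in> span (s ` J)" "J \<subseteq> I" for y b J
    using that(1)
  proof (induction rule: span_induct_alt)
    case base
    then show ?case by (simp add: span_zero)
  next
    case (step a z y)
    then obtain i where i: "i \<in> J" "z = s i" by blast
    have "D (scale a z + y) - scale b (scale a z + y)
        = scale (a * (c i - b)) z + (D y - scale b y)"
      using eigen[of i] i that(2)
      by (simp add: D.add D.scale algebra_simps subset_iff)
    moreover have "scale (a * (c i - b)) z \<in> span (s ` {i \<in> J. c i \<noteq> b})"
    proof (cases "c i = b")
      case False
      then show ?thesis using i by (intro span_scale span_base) auto
    qed (simp add: span_zero)
    ultimately show ?case
      using step(2) by (metis span_add)
  qed
  have peel: "y \<in> span (s ` {i \<in> I. c i = d})"
    if "finite C" "d \<notin> C" "y \<in> span (s ` {i \<in> I. c i = d \<or> c i \<in> C})" "D y = scale d y" for y C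
    using that
  proof (induction C)
    case empty
    then show ?case by simp
  next
    case (insert b C)
    have "D y - scale b y \<in> span (s ` {i \<in> {i \<in> I. c i = d \<or> c i \<in> insert b C}. c i \<noteq> b})"
      using insert.prems by (intro remove) auto
    moreover have "\<dots> \<subseteq> span (s ` {i \<in> I. c i = d \<or> c i \<in> C})"
      by (intro span_mono) auto
    moreover have "D y - scale b y = scale (d - b) y"
      using insert.prems(3) by (simp add: algebra_simps)
    ultimately have "scale (d - b) y \<in> span (s ` {i \<in> I. c i = d \<or> c i \<in> C})"
      by auto
    then have "scale (inverse (d - b)) (scale (d - b) y) \<in> span (s ` {i \<in> I. c i = d \<or> c i \<in> C})"
      by (rule span_scale)
    moreover have "d \<noteq> b" using insert.prems(1) by auto
    ultimately show ?case using insert by simp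
  qed
  obtain t r where t: "finite t" "t \<subseteq> s ` I" "x = (\<Sum>a\<in>t. scale (r a) a)"
    using x(1) by (auto simp: span_explicit)
  then obtain F where F: "finite F" "F \<subseteq> I" "t = s ` F"
    by (meson finite_subset_image)
  have "x \<in> span (s ` F)"
    using t F by (auto intro: span_sum span_scale span_base)
  moreover have "s ` F \<subseteq> s ` {i \<in> I. c i = d \<or> c i \<in> c ` F - {d}}"
    using F by auto
  ultimately have "x \<in> span (s ` {i \<in> I. c i = d \<or> c i \<in> c ` F - {d}})"
    using span_mono by blast
  then show ?thesis
    using peel[of "c ` F - {d}" x] F x(2) by auto
qed

section \<open>The root lattice\<close>

text \<open>
  Integral vectors in the basis \<open>\<epsilon>\<^sub>1, \<dots>, \<epsilon>\<^sub>4\<close>. With the standard inner product, the roots of \<open>D\<^sub>4\<close> are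
  the integral vectors of square length 2, so that sums of roots are governed by inner products
  alone. For roots \<open>a\<close> and \<open>b\<close>, the sum is a root, zero or neither according to whether the inner
  product is \<open>-1\<close>, \<open>-2\<close> or nonnegative.
\<close>

type_synonym vec4 = "int \<times> int \<times> int \<times> int"

fun ip :: "vec4 \<Rightarrow> vec4 \<Rightarrow> int" where
  "ip (a1, a2, a3, a4) (b1, b2, b3, b4) = a1 * b1 + a2 * b2 + a3 * b3 + a4 * b4"

definition is_rt :: "vec4 \<Rightarrow> bool" where
  "is_rt a \<longleftrightarrow> ip a a = 2"

definition rt :: "nat \<Rightarrow> vec4" where
  "rt i = [(1,1,0,0), (0,1,1,0), (1,0,1,0), (0,0,1,1), (0,1,0,1), (1,0,0,1),
     (1,0,-1,0), (1,0,0,-1), (0,0,1,-1), (0,1,0,-1), (0,1,-1,0), (1,-1,0,0)] ! (i - 1)"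

lemma ip_simps:
  "ip (a + b) c = ip a c + ip b c" "ip a (b + c) = ip a b + ip a c"
  "ip (a - b) c = ip a c - ip b c" "ip a (b - c) = ip a b - ip a c"
  "ip (- a) b = - ip a b" "ip a (- b) = - ip a b" "ip 0 a = 0" "ip a 0 = 0"
  by (cases a; cases b; cases c; simp add: algebra_simps zero_prod_def)+

lemma ip_commute: "ip a b = ip b a"
  by (cases a; cases b; simp add: algebra_simps)

lemma ip_self_nonneg: "0 \<le> ip a a"
  by (cases a) simp

lemma ip_self_eq_0: "ip a a = 0 \<longleftrightarrow> a = 0"
  by (cases a) (simp add: add_nonneg_eq_0_iff zero_prod_def)

lemma is_rt_uminus [simp]: "is_rt (- a) \<longleftrightarrow> is_rt a"
  by (simp add: is_rt_def ip_simps)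

lemma is_rt_nonzero: "is_rt a \<Longrightarrow> a \<noteq> 0"
  by (auto simp: is_rt_def ip_simps)

lemma is_rt_add_iff: "is_rt a \<Longrightarrow> is_rt b \<Longrightarrow> is_rt (a + b) \<longleftrightarrow> ip a b = -1"
  by (auto simp: is_rt_def ip_simps ip_commute[of b a])

lemma rt_add_eq_0_iff:
  assumes "is_rt a" "is_rt b" shows "a + b = 0 \<longleftrightarrow> ip a b = -2"
  using assms ip_self_eq_0[of "a + b"] by (auto simp: is_rt_def ip_simps ip_commute[of b a])

lemma ip_roots:
  assumes "is_rt a" "is_rt b"
  shows "ip a b \<in> {-2, -1, 0, 1, 2}"
proof -
  have "- 2 \<le> ip a b" "ip a b \<le> 2"
    using assms ip_self_nonneg[of "a + b"] ip_self_nonneg[of "a - b"]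
    by (auto simp: is_rt_def ip_simps ip_commute[of b a])
  then show ?thesis by auto
qed

lemma atLeast1_atMost12: "{1..12} = {1, 2, 3, 4, 5, 6, 7, 8, 9, 10, 11, 12::nat}"
  by code_simp

lemma is_rt_rt: "i \<in> {1..12} \<Longrightarrow> is_rt (rt i)"
  unfolding atLeast1_atMost12 by (elim insertE emptyE) (simp_all add: rt_def is_rt_def)

text \<open>
  The coordinates of a vector of square length 2 lie between \<open>-1\<close> and \<open>1\<close>, so the 81 candidates can
  be inspected.
\<close>

lemma is_rt_cases:
  assumes "is_rt a"
  obtains i where "i \<in> {1..12}" "a = rt i" | i where "i \<in> {1..12}" "a = - rt i"
proof -
  obtain a1 a2 a3 a4 where a: "a = (a1, a2, a3, a4)" by (cases a)
  have sq: "x * x \<le> 2 \<Longrightarrow> x \<in> {-1, 0, 1}" for x :: int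
  proof -
    assume "x * x \<le> 2"
    moreover have "\<bar>x\<bar> * \<bar>x\<bar> = x * x" by simp
    moreover have "2 * 2 \<le> \<bar>x\<bar> * \<bar>x\<bar>" if "2 \<le> \<bar>x\<bar>"
      using that by (intro mult_mono) auto
    ultimately have "\<bar>x\<bar> < 2" by linarith
    then show ?thesis by auto
  qed
  have "a1 * a1 + a2 * a2 + a3 * a3 + a4 * a4 = 2"
    using assms by (simp add: a is_rt_def)
  moreover have "0 \<le> a1 * a1" "0 \<le> a2 * a2" "0 \<le> a3 * a3" "0 \<le> a4 * a4" by simp_all
  ultimately have "a1 \<in> {-1, 0, 1}" "a2 \<in> {-1, 0, 1}" "a3 \<in> {-1, 0, 1}" "a4 \<in> {-1, 0, 1}"
    by (intro sq; linarith)+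
  moreover have "\<forall>a1\<in>{-1, 0, 1}. \<forall>a2\<in>{-1, 0, 1}. \<forall>a3\<in>{-1, 0, 1}. \<forall>a4\<in>{-1, 0, 1}.
      is_rt (a1, a2, a3, a4) \<longrightarrow>
      (\<exists>i\<in>{1..12}. (a1, a2, a3, a4) = rt i \<or> (a1, a2, a3, a4) = - rt i)"
    unfolding atLeast1_atMost12 by code_simp
  ultimately have "\<exists>i\<in>{1..12}. a = rt i \<or> a = - rt i"
    using assms unfolding a by blast
  then show thesis using that by blast
qed

lemma rt_inject: "i \<in> {1..12} \<Longrightarrow> j \<in> {1..12} \<Longrightarrow> rt i = rt j \<longleftrightarrow> i = j"
proof -
  have "\<forall>i\<in>{1..12}. \<forall>j\<in>{1..12}. rt i = rt j \<longleftrightarrow> i = j"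
    unfolding atLeast1_atMost12 by code_simp
  then show "i \<in> {1..12} \<Longrightarrow> j \<in> {1..12} \<Longrightarrow> rt i = rt j \<longleftrightarrow> i = j" by blast
qed

lemma rt_neq_uminus: "i \<in> {1..12} \<Longrightarrow> j \<in> {1..12} \<Longrightarrow> rt i \<noteq> - rt j"
proof -
  have "\<forall>i\<in>{1..12}. \<forall>j\<in>{1..12}. rt i \<noteq> - rt j"
    unfolding atLeast1_atMost12 by code_simp
  then show "i \<in> {1..12} \<Longrightarrow> j \<in> {1..12} \<Longrightarrow> rt i \<noteq> - rt j" by blast
qed

fun functional :: "(nat \<Rightarrow> 'g \<Rightarrow> complex) \<Rightarrow> vec4 \<Rightarrow> 'g \<Rightarrow> complex" where
  "functional \<epsilon> (a1, a2, a3, a4) h =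
     of_int a1 * \<epsilon> 1 h + of_int a2 * \<epsilon> 2 h + of_int a3 * \<epsilon> 3 h + of_int a4 * \<epsilon> 4 h"

lemma functional_simps:
  "functional \<epsilon> (a + b) h = functional \<epsilon> a h + functional \<epsilon> b h"
  "functional \<epsilon> (a - b) h = functional \<epsilon> a h - functional \<epsilon> b h"
  "functional \<epsilon> (- a) h = - functional \<epsilon> a h"
  "functional \<epsilon> 0 h = 0"
  by (cases a; cases b; simp add: algebra_simps zero_prod_def)+

lemma pos_root_eq_functional: "i \<in> {1..12} \<Longrightarrow> pos_root \<epsilon> i h = functional \<epsilon> (rt i) h"
  unfolding atLeast1_atMost12 by (elim insertE emptyE) (simp_all add: pos_root_def rt_def)

declare functional.simps [simp del]

section \<open>Modules, root vectors and weight spaces\<close>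

context lie_algebra begin

sublocale left: Vector_Spaces.linear scale scale "\<lambda>x. bracket x y" for y
  by (rule linear_bracket_left)

sublocale right: Vector_Spaces.linear scale scale "bracket x" for x
  by (rule linear_bracket_right)

lemma bracket_antisym: "bracket x y = - bracket y x"
proof -
  have "bracket (x + y) (x + y) = bracket x y + bracket y x"
    unfolding left.add right.add by (simp add: bracket_self)
  then show ?thesis by (simp add: bracket_self eq_neg_iff_add_eq_0)
qed

lemma bracket_bracket: "bracket (bracket x y) z = bracket x (bracket y z) - bracket y (bracket x z)"
  using jacobi[of x y z] bracket_antisym[of z "bracket x y"] bracket_antisym[of z x]
  by (simp add: right.neg algebra_simps add_eq_0_iff)

end

text \<open>
  Modules that need be neither irreducible nor of finite dimension, so that the adjoint module and
  products of two modules are covered.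
\<close>

locale d4_module = d4_lie_algebra scale bracket T \<epsilon> e f + V: vector_space scaleV
  for scale :: "complex \<Rightarrow> 'g::ab_group_add \<Rightarrow> 'g" and bracket :: "'g \<Rightarrow> 'g \<Rightarrow> 'g"
    and T :: "'g set" and \<epsilon> :: "nat \<Rightarrow> 'g \<Rightarrow> complex" and e f :: "nat \<Rightarrow> 'g"
    and scaleV :: "complex \<Rightarrow> 'v::ab_group_add \<Rightarrow> 'v" +
  fixes act :: "'g \<Rightarrow> 'v \<Rightarrow> 'v"
  assumes linear_act_left: "Vector_Spaces.linear scale scaleV (\<lambda>x. act x w)"
    and linear_act_right: "Vector_Spaces.linear scaleV scaleV (act x)"
    and act_bracket: "act (bracket x y) w = act x (act y w) - act y (act x w)"

lemma (in d4_lie_algebra) adjoint_module: "d4_module scale bracket T \<epsilon> e f scale bracket"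
  by unfold_locales
    (simp_all add: left.add left.scale right.add right.scale bracket_bracket)

context d4_lie_algebra begin

text \<open>
  One family of root vectors for positive and negative roots together makes the brackets uniform.
\<close>

definition X :: "vec4 \<Rightarrow> 'g" where
  "X a = (if a \<in> rt ` {1..12} then e (the_inv_into {1..12} rt a)
          else f (the_inv_into {1..12} rt (- a)))"

lemma inj_on_rt: "inj_on rt {1..12}"
  using rt_inject by (auto intro!: inj_onI)

lemma X_rt: "i \<in> {1..12} \<Longrightarrow> X (rt i) = e i"
  unfolding X_def by (simp add: the_inv_into_f_f[OF inj_on_rt] del: One_nat_def)

lemma X_uminus_rt: "i \<in> {1..12} \<Longrightarrow> X (- rt i) = f i"
  unfolding X_def using rt_neq_uminus[of _ i]
  by (auto simp: the_inv_into_f_f[OF inj_on_rt] simp del: One_nat_def dest: sym)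

lemma X_nonzero: "is_rt a \<Longrightarrow> X a \<noteq> 0"
  using e_root_vector f_root_vector by (elim is_rt_cases) (auto simp: X_rt X_uminus_rt)

lemma bracket_T_X: "is_rt a \<Longrightarrow> h \<in> T \<Longrightarrow> bracket h (X a) = scale (functional \<epsilon> a h) (X a)"
  using e_root_vector f_root_vector
  by (elim is_rt_cases)
    (auto simp: X_rt X_uminus_rt root_space_def pos_root_eq_functional functional_simps)

lemma span_T_X: "span (T \<union> X ` Collect is_rt) = UNIV"
proof -
  have "f ` {1..12} \<union> T \<union> e ` {1..12} \<subseteq> T \<union> X ` Collect is_rt"
    using is_rt_rt by (auto simp flip: X_rt X_uminus_rt)
  then show ?thesis
    using span_mono triangular by blast
qed

lemma subspace_T: "subspace T"
  using cartan by (simp add: cartan_subalgebra_def)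

lemma bracket_T_T: "h \<in> T \<Longrightarrow> h' \<in> T \<Longrightarrow> bracket h h' = 0"
  using cartan by (simp add: cartan_subalgebra_def)

lemma T_maximal: "(\<And>h. h \<in> T \<Longrightarrow> bracket h x = 0) \<Longrightarrow> x \<in> T"
  using cartan by (simp add: cartan_subalgebra_def)

text \<open>
  Since all roots have square length 2, the inner product identifies each root with its coroot.
\<close>

definition coroot :: "vec4 \<Rightarrow> 'g" where
  "coroot a = (THE h. h \<in> T \<and> (\<forall>i\<in>{1..4}. \<epsilon> i h =
     (case a of (a1, a2, a3, a4) \<Rightarrow> of_int ([a1, a2, a3, a4] ! (i - 1)))))"

lemma coroot:
  shows coroot_in_T: "coroot a \<in> T"
    and functional_coroot: "functional \<epsilon> b (coroot a) = of_int (ip b a)"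
proof -
  obtain a1 a2 a3 a4 where a: "a = (a1, a2, a3, a4)" by (cases a)
  have "coroot a \<in> T \<and> (\<forall>i\<in>{1..4}. \<epsilon> i (coroot a) = of_int ([a1, a2, a3, a4] ! (i - 1)))"
    unfolding coroot_def a prod.case by (rule theI'[OF eps_basis])
  then show "coroot a \<in> T" and "functional \<epsilon> b (coroot a) = of_int (ip b a)"
    by (cases b; simp add: a functional.simps)+
qed

lemma functional_add: "x \<in> T \<Longrightarrow> y \<in> T \<Longrightarrow> functional \<epsilon> a (x + y) = functional \<epsilon> a x + functional \<epsilon> a y"
  by (cases a) (simp add: functional.simps eps_add algebra_simps)

lemma functional_scale: "x \<in> T \<Longrightarrow> functional \<epsilon> a (scale b x) = b * functional \<epsilon> a x"
  by (cases a) (simp add: functional.simps eps_scale algebra_simps)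

lemma T_eqI:
  assumes "h \<in> T" "h' \<in> T" "\<And>a. is_rt a \<Longrightarrow> functional \<epsilon> a h = functional \<epsilon> a h'"
  shows "h = h'"
proof -
  have "is_rt (1, 1, 0, 0)" "is_rt (1, -1, 0, 0)" "is_rt (0, 0, 1, 1)" "is_rt (0, 0, 1, -1)"
    by (simp_all add: is_rt_def)
  note eqs = this[THEN assms(3), simplified functional.simps, simplified]
  have half: "u = u' \<and> w = w'" if "u + w = u' + w'" "u - w = u' - w'" for u w u' w' :: complex
  proof -
    have "(u + w) + (u - w) = (u' + w') + (u' - w')" by (simp only: that)
    then have "u = u'" by (simp flip: mult_2)
    then show ?thesis using that by simp
  qed
  have "\<epsilon> 1 h = \<epsilon> 1 h'" "\<epsilon> 2 h = \<epsilon> 2 h'" "\<epsilon> 3 h = \<epsilon> 3 h'" "\<epsilon> 4 h = \<epsilon> 4 h'"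
    using half[OF eqs(1,2)] half[OF eqs(3,4)] by simp_all
  moreover have "{1..4} = {1, 2, 3, 4::nat}" by auto
  ultimately show ?thesis
    using eps_basis[of "\<lambda>i. \<epsilon> i h"] assms(1,2) by auto
qed

lemma coroot_uminus: "coroot (- a) = - coroot a"
proof -
  have "coroot (- a) = scale (- 1) (coroot a)"
  proof (rule T_eqI)
    show "scale (- 1) (coroot a) \<in> T"
      by (intro subspace_scale[OF subspace_T] coroot_in_T)
    show "functional \<epsilon> b (coroot (- a)) = functional \<epsilon> b (scale (- 1) (coroot a))" for b
      using functional_scale[OF coroot_in_T, of b "- 1" a] by (simp add: functional_coroot ip_simps)
  qed (rule coroot_in_T)
  then show ?thesis by simp
qed

end

context d4_module begin

sublocale act_left: Vector_Spaces.linear scale scaleV "\<lambda>x. act x w" for w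
  by (rule linear_act_left)

sublocale act_right: Vector_Spaces.linear scaleV scaleV "act x" for x
  by (rule linear_act_right)

text \<open>
  Weights are indexed by twice their coordinates, which keeps the half-integral weights of the two
  spin modules integral. Accordingly a root vector for the root \<open>b\<close> shifts the index by \<open>b + b\<close>.
\<close>

definition weight_space :: "vec4 \<Rightarrow> 'v set" where
  "weight_space a = {w. \<forall>h\<in>T. act h w = scaleV (functional \<epsilon> a h / 2) w}"

lemma subspace_weight_space: "V.subspace (weight_space a)"
  by (auto simp: V.subspace_def weight_space_def act_right.add act_right.scale V.scale_right_distrib)

lemma act_X_weight_space:
  assumes "is_rt b" "w \<in> weight_space a"
  shows "act (X b) w \<in> weight_space (a + b + b)"
  unfolding weight_space_def
proof (intro CollectI ballI)
  fix h assume h: "h \<in> T"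
  have "act h (act (X b) w) = act (bracket h (X b)) w + act (X b) (act h w)"
    by (simp add: act_bracket)
  also have "\<dots> = scaleV (functional \<epsilon> (a + b + b) h / 2) (act (X b) w)"
    using assms h
    by (simp add: bracket_T_X weight_space_def act_left.scale act_right.scale functional_simps
        add_divide_distrib flip: V.scale_left_distrib)
  finally show "act h (act (X b) w) = scaleV (functional \<epsilon> (a + b + b) h / 2) (act (X b) w)" .
qed

lemma act_coroot: "w \<in> weight_space a \<Longrightarrow> act (coroot b) w = scaleV (of_int (ip a b) / 2) w"
  by (simp add: weight_space_def coroot_in_T functional_coroot)

text \<open>
  Four coroots separate the four coordinates of a weight, and each of them acts as an operator to
  which the lemma on eigenvectors applies.
\<close>

lemma weight_vector_in_span:
  assumes weight_space: "\<And>i. i \<in> I \<Longrightarrow> s i \<in> weight_space (w i)"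
    and x: "x \<in> V.span (s ` I)" "x \<in> weight_space a"
  shows "x \<in> V.span (s ` {i \<in> I. w i = a})"
proof -
  have sep: "x \<in> V.span (s ` {i \<in> J. ip (w i) b = ip a b})"
    if "J \<subseteq> I" "x \<in> V.span (s ` J)" for J b
  proof -
    have "x \<in> V.span (s ` {i \<in> J. complex_of_int (ip (w i) b) / 2 = of_int (ip a b) / 2})"
    proof (rule V.eigenvector_in_span_of_eigenvectors)
      show "act (coroot b) (s i) = scaleV (of_int (ip (w i) b) / 2) (s i)" if "i \<in> J" for i
        using \<open>J \<subseteq> I\<close> that by (intro act_coroot weight_space) auto
      show "act (coroot b) x = scaleV (of_int (ip a b) / 2) x"
        using x(2) by (rule act_coroot)
    qed (use that linear_act_right in auto)
    then show ?thesis by (simp only: divide_cancel_right of_int_eq_iff) simp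
  qed
  define b where "b j = [(1,0,0,0), (0,1,0,0), (0,0,1,0), (0,0,0,1::int)::vec4] ! j" for j
  define J where "J n = {i \<in> I. \<forall>j<n. ip (w i) (b j) = ip a (b j)}" for n :: nat
  have "x \<in> V.span (s ` J n)" for n
  proof (induction n)
    case 0
    then show ?case using x(1) by (simp add: J_def)
  next
    case (Suc n)
    have "{i \<in> J n. ip (w i) (b n) = ip a (b n)} = J (Suc n)"
      by (auto simp: J_def less_Suc_eq)
    then show ?case using sep[OF _ Suc, of "b n"] by (auto simp: J_def)
  qed
  from this[of 4] have "x \<in> V.span (s ` J 4)" .
  moreover have "J 4 = {i \<in> I. w i = a}"
  proof -
    have "(\<forall>j<4. ip u (b j) = ip a (b j)) \<longleftrightarrow> u = a" for u
      by (cases u; cases a) (auto simp: b_def numeral_eq_Suc All_less_Suc2)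
    then show ?thesis by (simp add: J_def)
  qed
  ultimately show ?thesis by simp
qed

end

section \<open>Structure constants\<close>

lemma vec4_double_inject: "b + b = a + a \<longleftrightarrow> b = (a :: vec4)"
  by (cases a; cases b) auto

context d4_lie_algebra begin

interpretation ad: d4_module scale bracket T \<epsilon> e f scale bracket
  by (rule adjoint_module)

lemma X_weight_space: "is_rt a \<Longrightarrow> X a \<in> ad.weight_space (a + a)"
  by (simp add: ad.weight_space_def bracket_T_X functional_simps)

lemma T_weight_space: "h \<in> T \<Longrightarrow> h \<in> ad.weight_space 0"
  by (simp add: ad.weight_space_def bracket_T_T functional_simps)

lemma adjoint_weight_space:
  assumes "x \<in> ad.weight_space (a + a)"
  shows "a \<noteq> 0 \<Longrightarrow> \<not> is_rt a \<Longrightarrow> x = 0"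
    and "is_rt a \<Longrightarrow> x \<in> span {X a}"
proof -
  define I where "I = Inl ` T \<union> Inr ` Collect is_rt"
  define w :: "'g + vec4 \<Rightarrow> vec4" where "w = case_sum (\<lambda>_. 0) (\<lambda>b. b + b)"
  have "case_sum id X ` I = T \<union> X ` Collect is_rt"
    by (auto simp: I_def image_Un image_image)
  then have "x \<in> span (case_sum id X ` I)"
    by (simp add: span_T_X)
  moreover have "case_sum id X i \<in> ad.weight_space (w i)" if "i \<in> I" for i
    using that unfolding I_def by (elim UnE imageE CollectE) (simp_all only: w_def sum.case id_apply X_weight_space T_weight_space)
  ultimately have x: "x \<in> span (case_sum id X ` {i \<in> I. w i = a + a})"
    using assms by (intro ad.weight_vector_in_span) auto
  have w_eq: "w i = a + a \<longleftrightarrow> (case i of Inl _ \<Rightarrow> a = 0 | Inr b \<Rightarrow> b = a)" for i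
    using vec4_double_inject[of 0 a] vec4_double_inject[of _ a]
    by (cases i) (auto simp only: w_def sum.case add_0)
  show "x = 0" if "a \<noteq> 0" "\<not> is_rt a"
  proof -
    have "{i \<in> I. w i = a + a} = {}"
      using that by (auto simp only: w_eq I_def sum.case)
    then show ?thesis using x by (simp only: image_empty span_empty) blast
  qed
  show "x \<in> span {X a}" if "is_rt a"
  proof -
    have "{i \<in> I. w i = a + a} \<subseteq> {Inr a}"
      using that is_rt_nonzero[OF that] by (auto simp only: w_eq I_def sum.case)
    then have "case_sum id X ` {i \<in> I. w i = a + a} \<subseteq> {X a}"
      by (auto simp only: sum.case)
    then show ?thesis using x span_mono by blast
  qed
qed

lemma bracket_X_X_weight_space:
  assumes "is_rt a" "is_rt b"
  shows "bracket (X a) (X b) \<in> ad.weight_space ((a + b) + (a + b))"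
  using ad.act_X_weight_space[OF assms(1) X_weight_space[OF assms(2)]] by (simp add: algebra_simps)

lemma bracket_X_X_eq_0:
  assumes "is_rt a" "is_rt b" "0 \<le> ip a b"
  shows "bracket (X a) (X b) = 0"
  using adjoint_weight_space(1)[OF bracket_X_X_weight_space[OF assms(1,2)]] assms
  by (simp add: is_rt_add_iff rt_add_eq_0_iff)

text \<open>
  The structure constants, meaningful when \<open>a + b\<close> is a root.
\<close>

definition N :: "vec4 \<Rightarrow> vec4 \<Rightarrow> complex" where
  "N a b = (SOME n. bracket (X a) (X b) = scale n (X (a + b)))"

lemma bracket_X_X:
  assumes "is_rt a" "is_rt b" "ip a b = -1"
  shows "bracket (X a) (X b) = scale (N a b) (X (a + b))"
proof -
  have "bracket (X a) (X b) \<in> span {X (a + b)}"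
    using assms by (intro adjoint_weight_space(2) bracket_X_X_weight_space) (simp_all add: is_rt_add_iff)
  then have "\<exists>n. bracket (X a) (X b) = scale n (X (a + b))"
    by (auto simp: span_singleton)
  then show ?thesis unfolding N_def by (rule someI_ex)
qed

text \<open>
  Normalised such that \<open>[X a, X (-a)]\<close> is \<open>c a\<close> times the coroot of \<open>a\<close>, see \<open>bracket_X_uminus\<close>.
\<close>

definition c :: "vec4 \<Rightarrow> complex" where
  "c a = functional \<epsilon> a (bracket (X a) (X (- a))) / 2"

lemma bracket_X_uminus_in_T:
  assumes "is_rt a"
  shows "bracket (X a) (X (- a)) \<in> T"
proof (rule T_maximal)
  have "bracket (X a) (X (- a)) \<in> ad.weight_space 0"
    using bracket_X_X_weight_space[of a "- a"] assms by (simp add: zero_prod_def[symmetric])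
  then show "bracket h (bracket (X a) (X (- a))) = 0" if "h \<in> T" for h
    using that by (simp add: ad.weight_space_def functional_simps)
qed

text \<open>
  The root string through \<open>b\<close> consists of \<open>b\<close> and \<open>a + b\<close> only. Evaluating \<open>[X a, X (-a)]\<close> on both
  root vectors gives opposite eigenvalues, since the trace of a commutator vanishes.
\<close>

lemma functional_bracket_X_uminus:
  assumes a: "is_rt a" and b: "is_rt b" and ab: "ip a b = -1"
  shows "functional \<epsilon> b (bracket (X a) (X (- a))) = - c a"
    and "N a b * N (- a) (a + b) = c a"
proof -
  let ?H = "bracket (X a) (X (- a))" and ?n = "N a b * N (- a) (a + b)"
  have rab: "is_rt (a + b)" using a b ab by (simp add: is_rt_add_iff)
  have ip: "ip (- a) b = 1" "ip a (a + b) = 1" "ip (- a) (a + b) = -1"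
    using a ab by (simp_all add: ip_simps is_rt_def)
  have up: "bracket (X a) (X b) = scale (N a b) (X (a + b))"
    using a b ab by (rule bracket_X_X)
  have down: "bracket (X (- a)) (X (a + b)) = scale (N (- a) (a + b)) (X b)"
    using bracket_X_X[of "- a" "a + b"] a rab ip by simp
  have "bracket ?H (X b) = scale (- ?n) (X b)"
    using bracket_X_X_eq_0[of "- a" b] a b ip
    by (simp add: bracket_bracket up down right.scale right.zero)
  then have 1: "functional \<epsilon> b ?H = - ?n"
    using bracket_T_X[OF b bracket_X_uminus_in_T[OF a]] X_nonzero[OF b]
    by (metis scale_right_imp_eq)
  have "bracket ?H (X (a + b)) = scale ?n (X (a + b))"
    using bracket_X_X_eq_0[of a "a + b"] a rab ip
    by (simp add: bracket_bracket up down right.scale right.zero mult.commute)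
  then have 2: "functional \<epsilon> (a + b) ?H = ?n"
    using bracket_T_X[OF rab bracket_X_uminus_in_T[OF a]] X_nonzero[OF rab]
    by (metis scale_right_imp_eq)
  show "?n = c a" "functional \<epsilon> b ?H = - c a"
    using 1 2 by (simp_all add: c_def functional_simps)
qed

text \<open>
  The value of every root on \<open>[X a, X (-a)]\<close> is determined by its value at \<open>a\<close>, because a root that
  is not a multiple of \<open>a\<close> is either orthogonal to \<open>a\<close> or, up to sign, starts a string of length 2.
\<close>

lemma bracket_X_uminus:
  assumes a: "is_rt a"
  shows "bracket (X a) (X (- a)) = scale (c a) (coroot a)"
proof (rule T_eqI)
  let ?H = "bracket (X a) (X (- a))"
  show "?H \<in> T" using a by (rule bracket_X_uminus_in_T)
  show "scale (c a) (coroot a) \<in> T"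
    by (intro subspace_scale[OF subspace_T] coroot_in_T)
  fix b assume b: "is_rt b"
  have self: "functional \<epsilon> a ?H = 2 * c a" by (simp add: c_def)
  consider "ip a b = -2" | "ip a b = -1" | "ip a b = 0" | "ip a b = 1" | "ip a b = 2"
    using ip_roots[OF a b] by auto
  then have "functional \<epsilon> b ?H = of_int (ip a b) * c a"
  proof cases
    case 1
    then have "b = - a"
      using rt_add_eq_0_iff[OF a b] by (simp add: add_eq_0_iff)
    then show ?thesis using self a by (simp add: functional_simps ip_simps is_rt_def)
  next
    case 2
    then show ?thesis using functional_bracket_X_uminus(1)[OF a b] by simp
  next
    case 3
    have "bracket ?H (X b) = 0"
      using bracket_X_X_eq_0[of a b] bracket_X_X_eq_0[of "- a" b] a b 3
      by (simp add: bracket_bracket ip_simps right.zero)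
    then show ?thesis
      using bracket_T_X[OF b bracket_X_uminus_in_T[OF a]] X_nonzero[OF b] 3 by simp
  next
    case 4
    then show ?thesis
      using functional_bracket_X_uminus(1)[OF a, of "- b"] b by (simp add: functional_simps ip_simps)
  next
    case 5
    then have "b = a"
      using rt_add_eq_0_iff[of a "- b"] a b by (simp add: ip_simps)
    then show ?thesis using self a by (simp add: is_rt_def)
  qed
  then show "functional \<epsilon> b ?H = functional \<epsilon> b (scale (c a) (coroot a))"
    by (simp add: functional_scale coroot_in_T functional_coroot ip_commute[of b a])
qed

lemma coroot_nonzero: "is_rt a \<Longrightarrow> coroot a \<noteq> 0"
  using functional_coroot[of a a] functional_scale[OF coroot_in_T, of a 0 a]
  by (auto simp: is_rt_def)

lemma c_uminus:
  assumes "is_rt a"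
  shows "c (- a) = c a"
proof -
  have "bracket (X (- a)) (X a) = - bracket (X a) (X (- a))" by (rule bracket_antisym)
  moreover have "bracket (X (- a)) (X a) = - scale (c (- a)) (coroot a)"
    using bracket_X_uminus[of "- a"] assms by (simp only: is_rt_uminus minus_minus coroot_uminus scale_minus_right)
  ultimately have "scale (c (- a)) (coroot a) = scale (c a) (coroot a)"
    by (simp only: bracket_X_uminus[OF assms] neg_equal_iff_equal)
  then show ?thesis using coroot_nonzero[OF assms] by (metis scale_right_imp_eq)
qed

text \<open>
  The Jacobi identity for three roots with sum zero is a linear relation between their coroots.
  These satisfy only one relation up to scalars, so the coefficients are proportional to it.
\<close>

lemma N_c_cyclic:
  assumes a: "is_rt a" and b: "is_rt b" and ab: "ip a b = -1"
  shows "N a b * c (a + b) = N (- (a + b)) a * c b"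
proof -
  let ?g = "- (a + b)"
  have rg: "is_rt ?g" and rab: "is_rt (a + b)" using is_rt_add_iff[OF a b] ab is_rt_uminus by blast+
  have ip: "ip b ?g = -1" "ip ?g a = -1"
    using a b ab by (simp_all add: ip_simps is_rt_def ip_commute[of b a])
  have 1: "bracket (X ?g) (bracket (X a) (X b)) = scale (- (N a b * c (a + b))) (coroot (a + b))"
    using bracket_X_uminus[OF rg] bracket_X_X[OF a b ab] c_uminus[OF rab] coroot_uminus[of "a + b"]
    by (simp add: right.scale del: minus_add_distrib)
  have 2: "bracket (X a) (bracket (X b) (X ?g)) = scale (N b ?g * c a) (coroot a)"
    using bracket_X_uminus[OF a] bracket_X_X[OF b rg ip(1)] by (simp add: right.scale)
  have 3: "bracket (X b) (bracket (X ?g) (X a)) = scale (N ?g a * c b) (coroot b)"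
    using bracket_X_uminus[OF b] bracket_X_X[OF rg a ip(2)] by (simp add: right.scale)
  have sum: "scale (- (N a b * c (a + b))) (coroot (a + b)) +
      (scale (N b ?g * c a) (coroot a) + scale (N ?g a * c b) (coroot b)) = 0"
    using jacobi[of "X ?g" "X a" "X b"] by (simp only: 1 2 3 add.assoc)
  have "functional \<epsilon> u (scale (- (N a b * c (a + b))) (coroot (a + b)) +
      (scale (N b ?g * c a) (coroot a) + scale (N ?g a * c b) (coroot b))) =
    - (N a b * c (a + b)) * of_int (ip u (a + b)) +
    (N b ?g * c a * of_int (ip u a) + N ?g a * c b * of_int (ip u b))" for u
    by (simp only: functional_add functional_scale functional_coroot coroot_in_T
        subspace_scale[OF subspace_T] subspace_add[OF subspace_T])
  then have eq: "- (N a b * c (a + b)) * of_int (ip u (a + b)) +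
    (N b ?g * c a * of_int (ip u a) + N ?g a * c b * of_int (ip u b)) = 0" for u
    using functional_scale[OF coroot_in_T, of u 0 0] unfolding sum by simp
  \<comment> \<open>The vector \<open>a + b + b\<close> is orthogonal to \<open>a\<close> and pairs to \<open>3\<close> with \<open>b\<close>.\<close>
  show ?thesis
    using eq[of "a + b + b"] a b ab by (simp add: ip_simps is_rt_def ip_commute[of b a])
qed

lemma simple_lie_ideal: "lie_ideal I \<Longrightarrow> x \<in> I \<Longrightarrow> x \<noteq> 0 \<Longrightarrow> I = UNIV"
  using simple unfolding simple_lie_def by blast

text \<open>
  The root vectors with \<open>c a = 0\<close> span the radical of the Killing form. Their span is an
  ideal by \<open>N_c_cyclic\<close>, and a proper one because it contains no coroot.
\<close>

lemma c_nonzero: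
  assumes a: "is_rt a"
  shows "c a \<noteq> 0"
proof
  assume "c a = 0"
  define K where "K = X ` {b. is_rt b \<and> c b = 0}"
  have span_K: "bracket x y \<in> span K" if "x \<in> T \<union> X ` Collect is_rt" "y \<in> K" for x y
  proof -
    from that(2) obtain b where b: "is_rt b" "c b = 0" and y: "y = X b" by (auto simp: K_def)
    from that(1) show ?thesis
    proof
      assume "x \<in> T"
      then show ?thesis
        using b that(2) by (simp add: y bracket_T_X span_scale span_base)
    next
      assume "x \<in> X ` Collect is_rt"
      then obtain d where d: "is_rt d" and x: "x = X d" by auto
      consider "0 \<le> ip d b" | "ip d b = -1" | "ip d b = -2"
        using ip_roots[OF d b(1)] by auto
      then show ?thesis
      proof cases
        case 1
        then show ?thesis using bracket_X_X_eq_0[OF d b(1)] by (simp add: x y span_zero)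
      next
        case 2
        then have "is_rt (d + b)" using d b by (simp add: is_rt_add_iff)
        moreover have "N d b * c (d + b) = 0" using N_c_cyclic[OF d b(1) 2] b(2) by simp
        ultimately show ?thesis
          using bracket_X_X[OF d b(1) 2] by (auto simp: x y K_def span_zero intro: span_scale span_base)
      next
        case 3
        then have "d = - b"
          using rt_add_eq_0_iff[OF d b(1)] by (simp add: add_eq_0_iff2)
        then show ?thesis
          using bracket_X_uminus[OF d] c_uminus[OF b(1)] b(2) by (simp add: x y span_zero)
      qed
    qed
  qed
  have "bracket x y \<in> span K" if y: "y \<in> span K" for x y
  proof -
    have X_K: "bracket x y \<in> span K" if "x \<in> T \<union> X ` Collect is_rt" for x
      using y by (induction rule: span_induct_alt)
        (auto simp: right.zero right.add right.scale span_zero intro!: span_add span_scale span_K that)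
    have "x \<in> span (T \<union> X ` Collect is_rt)" by (simp add: span_T_X)
    then show ?thesis
      by (induction rule: span_induct_alt)
        (auto simp: left.zero left.add left.scale span_zero intro!: span_add span_scale X_K)
  qed
  then have "lie_ideal (span K)" by (simp add: lie_ideal_def subspace_span)
  moreover have "X a \<in> span K" using a \<open>c a = 0\<close> by (auto simp: K_def intro: span_base)
  ultimately have "span K = UNIV" using X_nonzero[OF a] by (rule simple_lie_ideal)
  then have "coroot a \<in> span (X ` {b. is_rt b \<and> c b = 0})" by (simp add: K_def)
  then have "coroot a \<in> span (X ` {b \<in> {b. is_rt b \<and> c b = 0}. b + b = 0})"
    using X_weight_space T_weight_space[OF coroot_in_T] by (intro ad.weight_vector_in_span) auto
  moreover have "{b \<in> {b. is_rt b \<and> c b = 0}. b + b = 0} = {}"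
    using is_rt_nonzero vec4_double_inject[of _ 0] by (auto simp only: add_0)
  ultimately have "coroot a \<in> span (X ` {})" by (simp only:)
  then have "coroot a = 0" by simp
  then show False using coroot_nonzero[OF a] by contradiction
qed

lemma N_nonzero:
  assumes "is_rt a" "is_rt b" "ip a b = -1"
  shows "N a b \<noteq> 0"
  using functional_bracket_X_uminus(2)[OF assms] c_nonzero[OF assms(1)] by auto

end

section \<open>Words in the lowering operators\<close>

text \<open>
  A word lists the indices of lowering operators, the last letter acting first. It lowers weights by
  the sum of its positive roots.
\<close>

definition word_drop :: "nat list \<Rightarrow> vec4" where
  "word_drop ws = sum_list (map rt ws)"

lemma word_drop_simps [simp]:
  "word_drop [] = 0" "word_drop (i # ws) = rt i + word_drop ws"
  by (simp_all add: word_drop_def)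

text \<open>
  Pairing with the half-sum \<open>(3, 2, 1, 0)\<close> of the positive roots gives the height of a root.
\<close>

lemma height_rt: "i \<in> {1..12} \<Longrightarrow> 1 \<le> ip (3, 2, 1, 0) (rt i)"
proof -
  have "\<forall>i\<in>{1..12}. 1 \<le> ip (3, 2, 1, 0) (rt i)"
    unfolding atLeast1_atMost12 by code_simp
  then show "i \<in> {1..12} \<Longrightarrow> 1 \<le> ip (3, 2, 1, 0) (rt i)" by blast
qed

lemma length_le_height: "set ws \<subseteq> {1..12} \<Longrightarrow> int (length ws) \<le> ip (3, 2, 1, 0) (word_drop ws)"
proof (induction ws)
  case (Cons i ws)
  then show ?case using height_rt[of i] by (auto simp: ip_simps)
qed (simp add: ip_simps)

lemma word_drop_eq_0: "set ws \<subseteq> {1..12} \<Longrightarrow> word_drop ws = 0 \<Longrightarrow> ws = []"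
  using length_le_height[of ws] by (simp add: ip_simps)

text \<open>
  Twice the sum of the positive roots of a word cannot vanish, as each of them has positive height.
\<close>

lemma word_weight_unchanged:
  assumes "set ws \<subseteq> {1..12}" "a - word_drop ws - word_drop ws = a"
  shows "ws = []"
proof -
  have "word_drop ws + word_drop ws = 0 + 0" using assms(2) by (simp add: algebra_simps)
  then have "word_drop ws = 0" by (simp only: vec4_double_inject)
  with assms(1) show ?thesis by (rule word_drop_eq_0)
qed

definition simple_indices :: "nat set" where
  "simple_indices = {4, 9, 11, 12}"

lemma simple_indices_subset: "i \<in> simple_indices \<Longrightarrow> i \<in> {1..12}"
  by (auto simp: simple_indices_def)

text \<open>
  Every positive root is reached from a simple one by adding simple roots.
\<close>

lemma positive_root_induct [consumes 1, case_names simple add]: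
  assumes "i \<in> {1..12}" and simple: "\<And>i. i \<in> simple_indices \<Longrightarrow> Q i"
    and add: "\<And>i j k. i \<in> simple_indices \<Longrightarrow> j \<in> {1..12} \<Longrightarrow> k \<in> {1..12} \<Longrightarrow>
      rt k = rt i + rt j \<Longrightarrow> Q j \<Longrightarrow> Q k"
  shows "Q i"
proof -
  have add': "Q j \<Longrightarrow> Q k"
    if "i \<in> simple_indices \<and> j \<in> {1..12} \<and> k \<in> {1..12} \<and> rt k = rt i + rt j" for i j k
    using add that by blast
  have Q: "Q 4" "Q 9" "Q 11" "Q 12"
    using simple by (auto simp: simple_indices_def)
  have "Q 7" using add'[of 12 11 7] Q by (simp add: simple_indices_def rt_def)
  moreover have Q10: "Q 10" using add'[of 11 9 10] Q by (simp add: simple_indices_def rt_def)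
  moreover have Q5: "Q 5" using add'[of 11 4 5] Q by (simp add: simple_indices_def rt_def)
  moreover have "Q 8" using add'[of 12 10 8] Q10 by (simp add: simple_indices_def rt_def)
  moreover have "Q 6" using add'[of 12 5 6] Q5 by (simp add: simple_indices_def rt_def)
  moreover have Q2: "Q 2" using add'[of 4 10 2] Q10 by (simp add: simple_indices_def rt_def)
  moreover have Q3: "Q 3" using add'[of 12 2 3] Q2 by (simp add: simple_indices_def rt_def)
  moreover have "Q 1" using add'[of 11 3 1] Q3 by (simp add: simple_indices_def rt_def)
  ultimately show ?thesis
    using assms(1) Q unfolding atLeast1_atMost12 by blast
qed

context d4_module begin

lemma nonzero_in_spanD: "x \<in> V.span (s ` I) \<Longrightarrow> x \<noteq> 0 \<Longrightarrow> \<exists>i. i \<in> I"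
  by (cases "I = {}") auto

abbreviation word_vector :: "nat list \<Rightarrow> 'v \<Rightarrow> 'v" where
  "word_vector ws \<equiv> foldr (\<lambda>i. act (f i)) ws"

lemma act_X_add:
  assumes "is_rt a" "is_rt b" "is_rt (a + b)"
  shows "act (X (a + b)) w = scaleV (inverse (N a b)) (act (X a) (act (X b) w) - act (X b) (act (X a) w))"
proof -
  have "ip a b = -1" using assms by (simp add: is_rt_add_iff)
  then have "scaleV (N a b) (act (X (a + b)) w) = act (X a) (act (X b) w) - act (X b) (act (X a) w)"
    using bracket_X_X[OF assms(1,2)] by (simp flip: act_bracket act_left.scale)
  then show ?thesis
    using N_nonzero[OF assms(1,2) \<open>ip a b = -1\<close>] by (metis V.scale_one V.scale_scale left_inverse)
qed

lemma act_e_weight_space: "i \<in> {1..12} \<Longrightarrow> w \<in> weight_space a \<Longrightarrow> act (e i) w \<in> weight_space (a + rt i + rt i)"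
  using act_X_weight_space[OF is_rt_rt, of i w a] by (simp add: X_rt)

lemma act_f_weight_space: "i \<in> {1..12} \<Longrightarrow> w \<in> weight_space a \<Longrightarrow> act (f i) w \<in> weight_space (a - rt i - rt i)"
  using act_X_weight_space[of "- rt i" w a] is_rt_rt[of i] X_uminus_rt[of i] by simp

lemma word_vector_weight_space:
  "set ws \<subseteq> {1..12} \<Longrightarrow> w \<in> weight_space a \<Longrightarrow> word_vector ws w \<in> weight_space (a - word_drop ws - word_drop ws)"
proof (induction ws)
  case (Cons i ws)
  then have "act (f i) (word_vector ws w) \<in> weight_space (a - word_drop ws - word_drop ws - rt i - rt i)"
    by (intro act_f_weight_space) auto
  then show ?case by (simp add: algebra_simps)
qed simp

lemma act_closed_f:
  assumes W: "V.subspace W"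
    and simple: "\<And>i w. i \<in> simple_indices \<Longrightarrow> w \<in> W \<Longrightarrow> act (f i) w \<in> W"
    and "i \<in> {1..12}" "w \<in> W"
  shows "act (f i) w \<in> W"
  using assms(3,4)
proof (induction i arbitrary: w rule: positive_root_induct)
  case (add i j k)
  have "f k = X (- rt i + - rt j)" using add(3,4) X_uminus_rt[of k] by (simp add: algebra_simps)
  moreover have "act (X (- rt i + - rt j)) w =
      scaleV (inverse (N (- rt i) (- rt j))) (act (f i) (act (f j) w) - act (f j) (act (f i) w))"
    using add(1-4) is_rt_rt[of i] is_rt_rt[of j] is_rt_rt[of k] is_rt_uminus[of "rt i + rt j"]
      X_uminus_rt[of i] X_uminus_rt[of j] simple_indices_subset[of i]
    by (subst act_X_add) (auto simp: algebra_simps)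
  ultimately show ?case
    using add simple by (auto intro!: V.subspace_scale[OF W] V.subspace_diff[OF W])
qed (rule simple)

lemma act_e_eq_0:
  assumes simple: "\<And>i. i \<in> simple_indices \<Longrightarrow> act (e i) w = 0"
    and "i \<in> {1..12}"
  shows "act (e i) w = 0"
  using assms(2)
proof (induction i rule: positive_root_induct)
  case (add i j k)
  have "e k = X (rt i + rt j)" using add(3,4) X_rt[of k] by simp
  moreover have "act (X (rt i + rt j)) w =
      scaleV (inverse (N (rt i) (rt j))) (act (e i) (act (e j) w) - act (e j) (act (e i) w))"
    using add(1-4) is_rt_rt[of i] is_rt_rt[of j] is_rt_rt[of k]
      X_rt[of i] X_rt[of j] simple_indices_subset[of i]
    by (subst act_X_add) auto
  ultimately show ?case
    using add(5) simple[OF add(1)] by (simp add: act_right.zero)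
qed (rule simple)

text \<open>
  Commuting \<open>x\<close> past the first letter of a word leaves \<open>x\<close> acting on a shorter word, plus another Lie
  algebra element acting on that shorter word. This suffices to see that words applied to a singular
  vector span a submodule, without any reordering of letters.
\<close>

lemma act_span_words:
  assumes weight: "w \<in> weight_space a" and singular: "\<And>i. i \<in> {1..12} \<Longrightarrow> act (e i) w = 0"
    and y: "y \<in> V.span ((\<lambda>ws. word_vector ws w) ` {ws. set ws \<subseteq> {1..12}})"
  shows "act x y \<in> V.span ((\<lambda>ws. word_vector ws w) ` {ws. set ws \<subseteq> {1..12}})"
proof -
  let ?W = "V.span ((\<lambda>ws. word_vector ws w) ` {ws. set ws \<subseteq> {1..12}})"
  have word: "word_vector ws w \<in> ?W" if "set ws \<subseteq> {1..12}" for ws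
    using that by (intro V.span_base) auto
  have f: "act (f i) y \<in> ?W" if "y \<in> ?W" "i \<in> {1..12}" for y i
    using that(1)
  proof (induction rule: V.span_induct_alt)
    case (step a z y)
    then obtain ws where "set ws \<subseteq> {1..12}" "z = word_vector ws w" by auto
    then have "act (f i) z \<in> ?W" using word[of "i # ws"] that(2) by simp
    then show ?case
      using step by (simp add: act_right.add act_right.scale V.span_add V.span_scale)
  qed (simp add: act_right.zero V.span_zero)
  have *: "act x (word_vector ws w) \<in> ?W" if "set ws \<subseteq> {1..12}" for x ws
    using that
  proof (induction ws arbitrary: x)
    case Nil
    have "x \<in> span (f ` {1..12} \<union> T \<union> e ` {1..12})" by (simp only: triangular UNIV_I)
    then have "act x w \<in> ?W"
    proof (induction rule: span_induct_alt)
      case (step a z y)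
      have "act z w \<in> ?W"
        using step(1) f[OF word[of "[]"]] singular weight word[of "[]"]
        by (auto simp: weight_space_def V.span_zero intro: V.span_scale)
      then show ?case
        using step by (simp add: act_left.add act_left.scale V.span_add V.span_scale)
    qed (simp add: act_left.zero V.span_zero)
    then show ?case by simp
  next
    case (Cons i ws)
    have "act x (act (f i) (word_vector ws w))
        = act (f i) (act x (word_vector ws w)) + act (bracket x (f i)) (word_vector ws w)"
      by (simp add: act_bracket)
    then show ?case
      using Cons f by (simp add: V.span_add)
  qed
  show ?thesis
    using y
  proof (induction rule: V.span_induct_alt)
    case (step a z y)
    then show ?case
      using * by (auto simp: act_right.add act_right.scale intro!: V.span_add V.span_scale)
  qed (simp add: act_right.zero V.span_zero)
qed

end

lemma product_module:
  assumes "d4_module scale bracket T \<epsilon> e f scaleV act" "d4_module scale bracket T \<epsilon> e f scaleW act'"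
  shows "d4_module scale bracket T \<epsilon> e f (\<lambda>c (x, y). (scaleV c x, scaleW c y))
    (\<lambda>g (x, y). (act g x, act' g y))"
proof -
  interpret V: d4_module scale bracket T \<epsilon> e f scaleV act by fact
  interpret W: d4_module scale bracket T \<epsilon> e f scaleW act' by fact
  show ?thesis
    by unfold_locales
      (auto simp: V.V.scale_right_distrib W.V.scale_right_distrib V.V.scale_left_distrib
        W.V.scale_left_distrib V.act_left.add W.act_left.add V.act_left.scale W.act_left.scale
        V.act_right.add W.act_right.add V.act_right.scale W.act_right.scale
        V.act_bracket W.act_bracket)
qed

text \<open>
  The doubled coordinates of \<open>k\<^sub>1\<omega>\<^sub>1 + k\<^sub>2\<omega>\<^sub>2 + k\<^sub>3\<omega>\<^sub>3 + k\<^sub>4\<omega>\<^sub>4\<close>.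
\<close>

definition highest_weight :: "(nat \<Rightarrow> int) \<Rightarrow> vec4" where
  "highest_weight k = (2 * k 1 + 2 * k 2 + k 3 + k 4, 2 * k 2 + k 3 + k 4, k 3 + k 4, k 4 - k 3)"

context d4_irrep begin

sublocale d4_module scale bracket T \<epsilon> e f scaleV act
  by (intro d4_module.intro d4_module_axioms.intro d4_lie_algebra_axioms V.vector_space_axioms
      linear_act_left linear_act_right act_bracket)

lemma highest_vector_weight_space: "v \<in> weight_space (highest_weight k)"
proof -
  have "weight \<epsilon> k h = functional \<epsilon> (highest_weight k) h / 2" for h
  proof -
    have "{1..4} = {1, 2, 3, 4::nat}" by auto
    then show ?thesis
      by (simp add: weight_def fund_weight_def highest_weight_def functional.simps field_simps)
  qed
  then show ?thesis by (simp add: weight_space_def hw_weight)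
qed

lemma span_words: "V.span ((\<lambda>ws. word_vector ws v) ` {ws. set ws \<subseteq> {1..12}}) = UNIV"
proof -
  let ?W = "V.span ((\<lambda>ws. word_vector ws v) ` {ws. set ws \<subseteq> {1..12}})"
  have "v \<in> ?W" by (rule V.span_base) (auto intro!: image_eqI[of _ _ "[]"])
  moreover have "?W = {0} \<or> ?W = UNIV"
    using act_span_words[OF highest_vector_weight_space hw_annihilated]
    by (intro irreducible V.subspace_span) auto
  ultimately show ?thesis using hw_nonzero by blast
qed

lemma weight_space_eq_span_words:
  assumes "w \<in> weight_space a"
  shows "w \<in> V.span ((\<lambda>ws. word_vector ws v) `
    {ws \<in> {ws. set ws \<subseteq> {1..12}}. highest_weight k - word_drop ws - word_drop ws = a})"
  using assms
  by (intro weight_vector_in_span word_vector_weight_space highest_vector_weight_space) (simp_all only: span_words UNIV_I mem_Collect_eq)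

text \<open>
  A nonzero singular vector generates the whole module, so its weight and the highest weight would
  each lie below the other.
\<close>

lemma singular_eq_0:
  assumes w: "w \<in> weight_space a" and a: "a \<noteq> highest_weight k"
    and singular: "\<And>i. i \<in> simple_indices \<Longrightarrow> act (e i) w = 0"
  shows "w = 0"
proof (rule ccontr)
  assume "w \<noteq> 0"
  let ?D = "{ws. set ws \<subseteq> {1..12::nat}}" let ?W = "V.span ((\<lambda>ws. word_vector ws w) ` ?D)"
  have "w \<in> ?W" by (rule V.span_base) (auto intro!: image_eqI[of _ _ "[]"])
  moreover have "?W = {0} \<or> ?W = UNIV"
    using act_span_words[OF w act_e_eq_0[OF singular]]
    by (intro irreducible V.subspace_span) auto
  ultimately have "v \<in> ?W" using \<open>w \<noteq> 0\<close> by blast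
  then have "v \<in> V.span ((\<lambda>ws. word_vector ws w) `
      {ws \<in> ?D. a - word_drop ws - word_drop ws = highest_weight k})"
    using w highest_vector_weight_space by (intro weight_vector_in_span word_vector_weight_space) auto
  from nonzero_in_spanD[OF this hw_nonzero]
  obtain ws where ws: "set ws \<subseteq> {1..12}" "a - word_drop ws - word_drop ws = highest_weight k"
    by blast
  from nonzero_in_spanD[OF weight_space_eq_span_words[OF w] \<open>w \<noteq> 0\<close>]
  obtain ws' where ws': "set ws' \<subseteq> {1..12}" "highest_weight k - word_drop ws' - word_drop ws' = a"
    by blast
  have "(word_drop ws' + word_drop ws) + (word_drop ws' + word_drop ws) = 0 + 0"
    using ws(2) unfolding ws'(2)[symmetric] by (simp add: algebra_simps)
  then have "word_drop (ws' @ ws) = 0"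
    by (simp only: vec4_double_inject) (simp add: word_drop_def)
  then have "ws' @ ws = []" using ws(1) ws'(1) by (intro word_drop_eq_0) auto
  then show False using ws'(2) a by simp
qed

end

section \<open>Uniqueness of irreducible modules\<close>

definition exponent_word :: "(nat \<Rightarrow> nat) \<Rightarrow> nat list" where
  "exponent_word p = concat (map (\<lambda>i. replicate (p i) i) [1..<13])"

lemma set_exponent_word: "set (exponent_word p) \<subseteq> {1..12}"
  by (auto simp: exponent_word_def)

lemma monomial_vector_eq_word:
  "monomial_vector f act v p = foldr (\<lambda>i. act (f i)) (exponent_word p) v"
proof -
  have rep: "foldr g (replicate n i) w = (g i ^^ n) w" for g :: "nat \<Rightarrow> 'a \<Rightarrow> 'a" and n i w
    by (induction n) auto
  have "foldr (\<lambda>i. act (f i) ^^ p i) is v =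
      foldr (\<lambda>i. act (f i)) (concat (map (\<lambda>i. replicate (p i) i) is)) v" for "is"
    by (induction "is") (simp_all add: rep)
  then show ?thesis by (simp only: monomial_vector_def exponent_word_def)
qed

text \<open>
  The submodule \<open>G\<close> of the product that is generated by the pair of highest weight vectors is the
  graph of an isomorphism. Indeed, the vectors \<open>y\<close> with \<open>(0, y)\<close> in \<open>G\<close> form a submodule of the second
  factor, and it does not contain \<open>v'\<close>: the only vectors of highest weight in \<open>G\<close> are the multiples
  of \<open>(v, v')\<close>.
\<close>

lemma span_monomials_transfer:
  assumes V: "d4_irrep scale bracket T \<epsilon> e f scaleV act k v"
    and W: "d4_irrep scale bracket T \<epsilon> e f scaleW act' k v'"
    and span: "monomial_vector f act v p \<in> module.span scaleV (monomial_vector f act v ` S)"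
  shows "monomial_vector f act' v' p \<in> module.span scaleW (monomial_vector f act' v' ` S)"
proof -
  interpret V: d4_irrep scale bracket T \<epsilon> e f scaleV act k v by fact
  interpret W: d4_irrep scale bracket T \<epsilon> e f scaleW act' k v' by fact
  define scaleP where "scaleP = (\<lambda>c (x, y). (scaleV c x, scaleW c y))"
  define actP where "actP = (\<lambda>g (x, y). (act g x, act' g y))"
  have P_simps: "scaleP c (x, y) = (scaleV c x, scaleW c y)" "actP g (x, y) = (act g x, act' g y)"
    for c x y g by (simp_all add: scaleP_def actP_def)
  interpret P: d4_module scale bracket T \<epsilon> e f scaleP actP
    unfolding scaleP_def actP_def
    by (rule product_module) (rule V.d4_module_axioms W.d4_module_axioms)+
  define G where "G = P.V.span ((\<lambda>ws. P.word_vector ws (v, v')) ` {ws. set ws \<subseteq> {1..12}})"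
  have word: "P.word_vector ws (v, v') = (V.word_vector ws v, W.word_vector ws v')" for ws
    by (induction ws) (simp_all add: P_simps)
  have weight: "(v, v') \<in> P.weight_space (highest_weight k)"
    using V.highest_vector_weight_space W.highest_vector_weight_space
    by (simp add: V.weight_space_def W.weight_space_def P.weight_space_def P_simps)
  have G_act: "actP x y \<in> G" if "y \<in> G" for x y
    using that unfolding G_def
    by (intro P.act_span_words[OF weight])
      (simp_all add: P_simps V.hw_annihilated W.hw_annihilated zero_prod_def)
  define K where "K = {y. (0, y) \<in> G}"
  have "W.V.subspace K"
    unfolding W.V.subspace_def
  proof (intro conjI ballI allI)
    show "0 \<in> K" using P.V.span_zero by (simp add: K_def G_def zero_prod_def)
    show "x + y \<in> K" if "x \<in> K" "y \<in> K" for x y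
      using that P.V.span_add[of "(0, x)" _ "(0, y)"] by (simp add: K_def G_def)
    show "scaleW c x \<in> K" if "x \<in> K" for c x
      using that P.V.span_scale[of "(0, x)" _ c] by (simp add: K_def G_def P_simps)
  qed
  moreover have "act' x w \<in> K" if "w \<in> K" for x w
    using that G_act[of "(0, w)" x] by (simp add: K_def P_simps V.act_right.zero)
  ultimately have "K = {0} \<or> K = UNIV" by (rule W.irreducible)
  moreover have "v' \<notin> K"
  proof
    assume "v' \<in> K"
    moreover have "(0, v') \<in> P.weight_space (highest_weight k)"
      using W.highest_vector_weight_space
      by (simp add: W.weight_space_def P.weight_space_def P_simps V.act_right.zero)
    ultimately have "(0, v') \<in> P.V.span ((\<lambda>ws. P.word_vector ws (v, v')) `
        {ws \<in> {ws. set ws \<subseteq> {1..12}}. highest_weight k - word_drop ws - word_drop ws = highest_weight k})"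
      using weight unfolding K_def G_def
      by (intro P.weight_vector_in_span P.word_vector_weight_space) auto
    moreover have "{ws \<in> {ws. set ws \<subseteq> {1..12}}. highest_weight k - word_drop ws - word_drop ws
        = highest_weight k} \<subseteq> {[]}"
      using word_weight_unchanged[of _ "highest_weight k"] by auto
    ultimately have "(0, v') \<in> P.V.span {(v, v')}"
      using P.V.span_mono by (smt (verit, best) foldr.simps(1) id_apply image_empty image_insert image_mono subsetD)
    then obtain c where "0 = scaleV c v" "v' = scaleW c v'"
      by (auto simp: P.V.span_singleton P_simps)
    then show False using V.hw_nonzero W.hw_nonzero by auto
  qed
  ultimately have K: "K = {0}" by blast
  have pair: "(monomial_vector f act v q, monomial_vector f act' v' q) \<in> G" for q
    using set_exponent_word unfolding monomial_vector_eq_word G_def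
    by (intro P.V.span_base image_eqI[OF _ CollectI]) (simp_all add: word)
  have "\<exists>y. y \<in> W.V.span (monomial_vector f act' v' ` S) \<and> (x, y) \<in> G"
    if "x \<in> V.V.span (monomial_vector f act v ` S)" for x
    using that
  proof (induction rule: V.V.span_induct_alt)
    case base
    have "(0, 0) \<in> G" using P.V.span_zero by (simp add: G_def zero_prod_def)
    then show ?case using W.V.span_zero by blast
  next
    case (step c z x)
    then obtain y q where y: "y \<in> W.V.span (monomial_vector f act' v' ` S)" "(x, y) \<in> G"
      and q: "q \<in> S" "z = monomial_vector f act v q" by auto
    have "scaleP c (z, monomial_vector f act' v' q) + (x, y) \<in> G"
      using pair[of q] y(2) q(2) unfolding G_def by (intro P.V.span_add P.V.span_scale) auto
    moreover have "scaleW c (monomial_vector f act' v' q) + y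
        \<in> W.V.span (monomial_vector f act' v' ` S)"
      using y(1) q(1) by (intro W.V.span_add W.V.span_scale y(1)) (auto intro: W.V.span_base)
    ultimately show ?case by (auto simp: P_simps)
  qed
  from this[OF span] obtain y where y: "y \<in> W.V.span (monomial_vector f act' v' ` S)"
    "(monomial_vector f act v p, y) \<in> G" by blast
  have "monomial_vector f act' v' p - y \<in> K"
    using P.V.span_diff[OF pair[of p, unfolded G_def] y(2)[unfolded G_def]] by (simp add: K_def G_def)
  then show ?thesis using y(1) K by simp
qed

lemma essential_signatures_altdef:
  "essential_signatures f scaleV act k v =
     (\<lambda>p. (k, \<lambda>i. int (p i))) ` {p \<in> exponents. monomial_vector f act v p \<notin>
       module.span scaleV (monomial_vector f act v ` {p' \<in> exponents. exponent_less p' p})}"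
proof -
  have "{monomial_vector f act v p' | p'. p' \<in> exponents \<and> exponent_less p' p}
     = monomial_vector f act v ` {p' \<in> exponents. exponent_less p' p}" for p by auto
  then show ?thesis by (auto simp: essential_signatures_def)
qed

lemma essential_signatures_unique:
  assumes V: "d4_irrep scale bracket T \<epsilon> e f scaleV act k v"
    and W: "d4_irrep scale bracket T \<epsilon> e f scaleW act' k v'"
  shows "essential_signatures f scaleV act k v = essential_signatures f scaleW act' k v'"
proof -
  have "monomial_vector f act v p \<in> module.span scaleV (monomial_vector f act v ` S) \<longleftrightarrow>
    monomial_vector f act' v' p \<in> module.span scaleW (monomial_vector f act' v' ` S)" for p S
    using span_monomials_transfer[OF V W] span_monomials_transfer[OF W V] by blast
  then show ?thesis by (simp only: essential_signatures_altdef)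
qed

context d4_lie_algebra begin

text \<open>
  The highest root \<open>\<epsilon>\<^sub>1 + \<epsilon>\<^sub>2\<close> equals \<open>\<omega>\<^sub>2\<close>, and submodules of the adjoint module are ideals.
\<close>

lemma adjoint_irrep: "d4_irrep scale bracket T \<epsilon> e f scale bracket (fund_coords 2) (e 1)"
proof -
  interpret ad: d4_module scale bracket T \<epsilon> e f scale bracket by (rule adjoint_module)
  show ?thesis
  proof (intro d4_irrep.intro d4_irrep_axioms.intro d4_lie_algebra_axioms vector_space_axioms
        ad.linear_act_left ad.linear_act_right ad.act_bracket finite_dim)
    show "W = {0} \<or> W = UNIV" if "subspace W" "\<And>x w. w \<in> W \<Longrightarrow> bracket x w \<in> W" for W
      using that simple by (auto simp: simple_lie_def lie_ideal_def)
    show "e 1 \<noteq> 0" using e_root_vector[of 1] by simp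
    show "bracket h (e 1) = scale (weight \<epsilon> (fund_coords 2) h) (e 1)" if "h \<in> T" for h
    proof -
      have "{1..4} = {1, 2, 3, 4::nat}" by auto
      then have "weight \<epsilon> (fund_coords 2) h = pos_root \<epsilon> 1 h"
        by (simp add: weight_def fund_coords_def fund_weight_def pos_root_def)
      then show ?thesis using e_root_vector[of 1] that by (simp add: root_space_def)
    qed
    show "bracket (e i) (e 1) = 0" if "i \<in> {1..12}" for i
    proof -
      have "\<forall>i\<in>{1..12}. 0 \<le> ip (rt i) (rt 1)"
        unfolding atLeast1_atMost12 by code_simp
      then show ?thesis
        using bracket_X_X_eq_0[of "rt i" "rt 1"] that X_rt[of 1] by (simp add: is_rt_rt X_rt)
    qed
  qed (auto simp: fund_coords_def)
qed

end

section \<open>Essential signatures from a list of monomials\<close>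

text \<open>
  Nonnegativity of the inner products with all fundamental weights (doubled for the spin weights),
  a condition that sums of positive roots satisfy. It prunes the search for such sums.
\<close>

definition nonneg_drop :: "vec4 \<Rightarrow> bool" where
  "nonneg_drop d \<longleftrightarrow> 0 \<le> ip (1, 0, 0, 0) d \<and> 0 \<le> ip (1, 1, 0, 0) d \<and>
     0 \<le> ip (1, 1, 1, 1) d \<and> 0 \<le> ip (1, 1, 1, -1) d"

fun smul :: "nat \<Rightarrow> vec4 \<Rightarrow> vec4" where
  "smul n (a1, a2, a3, a4) = (int n * a1, int n * a2, int n * a3, int n * a4)"

text \<open>
  All ways to write \<open>d\<close> as a combination of the positive roots with indices in the list, with
  coefficients in \<open>\<nat>\<close>. Every coefficient is at most the height of \<open>d\<close>.
\<close>

fun partitions :: "nat list \<Rightarrow> vec4 \<Rightarrow> nat list list" where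
  "partitions [] d = (if d = 0 then [[]] else [])"
| "partitions (i # is) d =
     concat (map (\<lambda>n. map ((#) n) (partitions is (d - smul n (rt i))))
       (filter (\<lambda>n. nonneg_drop (d - smul n (rt i))) [0..<Suc (nat (ip (3, 2, 1, 0) d))]))"

lemma nonneg_drop_rt: "i \<in> {1..12} \<Longrightarrow> nonneg_drop (rt i)"
proof -
  have "\<forall>i\<in>{1..12}. nonneg_drop (rt i)"
    unfolding atLeast1_atMost12 by code_simp
  then show "i \<in> {1..12} \<Longrightarrow> nonneg_drop (rt i)" by blast
qed

lemma nonneg_word_drop: "set ws \<subseteq> {1..12} \<Longrightarrow> nonneg_drop (word_drop ws)"
proof (induction ws)
  case (Cons i ws)
  then have "nonneg_drop (rt i)" "nonneg_drop (word_drop ws)" using nonneg_drop_rt[of i] by auto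
  then show ?case by (simp add: nonneg_drop_def ip_simps)
qed (simp add: nonneg_drop_def ip_simps)

lemma word_drop_append: "word_drop (ws @ ws') = word_drop ws + word_drop ws'"
  by (simp add: word_drop_def)

lemma word_drop_replicate: "word_drop (replicate n i) = smul n (rt i)"
proof (induction n)
  case 0
  then show ?case by (cases "rt i") (simp add: zero_prod_def)
next
  case (Suc n)
  then show ?case by (cases "rt i") (simp add: algebra_simps)
qed

lemma partitions_complete:
  assumes "set is \<subseteq> {1..12}"
  shows "map p is \<in> set (partitions is (word_drop (concat (map (\<lambda>i. replicate (p i) i) is))))"
  using assms
proof (induction "is")
  case (Cons i "is")
  define d where "d = word_drop (concat (map (\<lambda>i. replicate (p i) i) is))"
  define d' where "d' = word_drop (concat (map (\<lambda>i. replicate (p i) i) (i # is)))"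
  have words: "set (concat (map (\<lambda>i. replicate (p i) i) js)) \<subseteq> {1..12}" if "set js \<subseteq> {1..12}" for js
    using that by auto
  have d: "d' = smul (p i) (rt i) + d"
    by (simp add: d_def d'_def word_drop_append word_drop_replicate)
  have "int (p i) \<le> ip (3, 2, 1, 0) d'"
    using length_le_height[OF words[OF Cons.prems]] by (simp add: d'_def)
  then have "p i < Suc (nat (ip (3, 2, 1, 0) d'))" by linarith
  moreover have "nonneg_drop d"
    unfolding d_def using Cons.prems by (intro nonneg_word_drop words) simp
  moreover have "map p is \<in> set (partitions is d)"
    using Cons by (simp add: d_def)
  ultimately have "p i # map p is \<in> set (partitions (i # is) d')"
    by (auto simp: d simp del: upt_Suc intro!: bexI[of _ "p i"])
  then show ?case by (simp add: d'_def)
qed simp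

fun partial_sums :: "nat \<Rightarrow> nat list \<Rightarrow> nat list" where
  "partial_sums s [] = []"
| "partial_sums s (x # xs) = (s + x) # partial_sums (s + x) xs"

fun lex_less :: "nat list \<Rightarrow> nat list \<Rightarrow> bool" where
  "lex_less (x # xs) (y # ys) \<longleftrightarrow> x < y \<or> x = y \<and> lex_less xs ys"
| "lex_less _ _ \<longleftrightarrow> False"

lemma length_partial_sums [simp]: "length (partial_sums s xs) = length xs"
  by (induction xs arbitrary: s) auto

lemma nth_partial_sums: "n < length xs \<Longrightarrow> partial_sums s xs ! n = s + sum_list (take (Suc n) xs)"
proof (induction xs arbitrary: s n)
  case (Cons x xs)
  then show ?case by (cases n) auto
qed simp

lemma lex_lessD:
  "lex_less xs ys \<Longrightarrow> length xs = length ys \<Longrightarrow>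
    \<exists>n<length xs. (\<forall>m<n. xs ! m = ys ! m) \<and> xs ! n < ys ! n"
proof (induction xs ys rule: lex_less.induct)
  case (1 x xs y ys)
  show ?case
  proof (cases "x < y")
    case True
    then show ?thesis by (intro exI[of _ 0]) auto
  next
    case False
    then obtain n where "n < length xs" "\<forall>m<n. xs ! m = ys ! m" "xs ! n < ys ! n" "x = y"
      using 1 by auto
    then show ?thesis by (intro exI[of _ "Suc n"]) (auto simp: nth_Cons split: nat.split)
  qed
qed auto

definition exponent_list :: "(nat \<Rightarrow> nat) \<Rightarrow> nat list" where
  "exponent_list p = map p [1..<13]"

lemma partial_sum_eq_nth:
  assumes "n < 12"
  shows "partial_sum p (Suc n) = rev (partial_sums 0 (exponent_list p)) ! n"
proof -
  have "rev (partial_sums 0 (exponent_list p)) ! n = sum_list (take (12 - n) (exponent_list p))"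
  proof -
    have "Suc (11 - n) = 12 - n" using assms by simp
    then show ?thesis
      using assms by (simp add: rev_nth nth_partial_sums exponent_list_def del: upt_Suc)
  qed
  also have "take (12 - n) (exponent_list p) = map p [1..<13 - n]"
    using assms Suc_diff_le[of n 12] by (simp add: exponent_list_def take_map del: upt_Suc)
  also have "sum_list \<dots> = partial_sum p (Suc n)"
  proof -
    have "{1..12 - Suc n + 1} = set [1..<13 - n]" using assms by auto
    then show ?thesis
      by (simp only: partial_sum_def sum_list_distinct_conv_sum_set[OF distinct_upt])
  qed
  finally show ?thesis by simp
qed

text \<open>
  Signatures are compared by their partial sums, the longest sum first.
\<close>

lemma exponent_less_lex:
  assumes "lex_less (rev (partial_sums 0 (exponent_list p))) (rev (partial_sums 0 (exponent_list p')))"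
  shows "exponent_less p p'"
proof -
  obtain n where "n < 12" "\<forall>m<n. partial_sum p (Suc m) = partial_sum p' (Suc m)"
    "partial_sum p (Suc n) < partial_sum p' (Suc n)"
    using lex_lessD[OF assms] by (auto simp: partial_sum_eq_nth exponent_list_def simp del: upt_Suc)
  moreover have "\<forall>j\<in>{1..<Suc n}. partial_sum p j = partial_sum p' j"
    using calculation(2) by (metis Suc_le_D atLeastLessThan_iff not_less_eq One_nat_def)
  ultimately show ?thesis unfolding exponent_less_def by (intro bexI[of _ "Suc n"]) auto
qed

lemma exponent_less_asym: "exponent_less p p' \<Longrightarrow> \<not> exponent_less p' p"
  unfolding exponent_less_def
  by (metis atLeastAtMost_iff atLeastLessThan_iff linorder_neqE_nat order_less_asym)

lemma exponents_eqI: "p \<in> exponents \<Longrightarrow> p' \<in> exponents \<Longrightarrow> exponent_list p = exponent_list p' \<Longrightarrow> p = p'"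
proof
  fix i assume "p \<in> exponents" "p' \<in> exponents" and eq: "exponent_list p = exponent_list p'"
  have "p i = p' i" if "i \<in> {1..12}"
    using eq that by (auto simp: exponent_list_def simp del: upt_Suc)
  then show "p i = p' i"
    using \<open>p \<in> exponents\<close> \<open>p' \<in> exponents\<close> by (cases "i \<in> {1..12}") (auto simp: exponents_def)
qed

definition exponent_drop :: "(nat \<Rightarrow> nat) \<Rightarrow> vec4" where
  "exponent_drop p = word_drop (exponent_word p)"

text \<open>
  An exponent is encoded as the word of its monomial. Each exponent that has the weight of a listed
  one, without being listed itself, has to come later in the order, unless its vector is known to
  vanish, as recorded by \<open>z\<close>.
\<close>

definition first_in_weight :: "(nat list \<Rightarrow> bool) \<Rightarrow> nat list list \<Rightarrow> bool" where
  "first_in_weight z ws \<longleftrightarrow> list_all (\<lambda>w. exponent_word (count_list w) = w \<and>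
     list_all (\<lambda>xs. z xs \<or> xs \<in> set (map (\<lambda>w. exponent_list (count_list w)) ws) \<or>
        lex_less (rev (partial_sums 0 (exponent_list (count_list w)))) (rev (partial_sums 0 xs)))
       (partitions [1..<13] (word_drop w))) ws"

lemma count_list_exponents: "exponent_word (count_list w) = w \<Longrightarrow> count_list w \<in> exponents"
  using set_exponent_word[of "count_list w"] by (auto simp: exponents_def intro!: count_notin)

context d4_irrep begin

abbreviation monomial :: "(nat \<Rightarrow> nat) \<Rightarrow> 'v" where
  "monomial \<equiv> monomial_vector f act v"

lemma monomial_weight_space: "monomial p \<in> weight_space (highest_weight k - exponent_drop p - exponent_drop p)"
  unfolding monomial_vector_eq_word exponent_drop_def
  using set_exponent_word highest_vector_weight_space by (rule word_vector_weight_space)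

lemma monomial_in_span_same_weight:
  assumes "monomial p \<in> V.span (monomial ` S)"
  shows "monomial p \<in> V.span (monomial ` {q \<in> S. exponent_drop q = exponent_drop p})"
proof -
  have "highest_weight k - exponent_drop q - exponent_drop q = highest_weight k - exponent_drop p - exponent_drop p
      \<longleftrightarrow> exponent_drop q = exponent_drop p" for q
    using vec4_double_inject[of "exponent_drop p" "exponent_drop q"] by (auto simp: algebra_simps)
  then show ?thesis
    using weight_vector_in_span[OF monomial_weight_space assms monomial_weight_space] by simp
qed

text \<open>
  By \<open>monomial_in_span_same_weight\<close>, only monomials of the same weight matter. An exponent of that weight outside
  the list comes after the listed ones, which already span the weight space, so it is not essential.
  Conversely, the exponents that precede a listed one are listed as well (or have a vanishing vector),
  so linear independence makes it essential.
\<close>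

lemma essential_signatures_eq:
  assumes ws: "first_in_weight z ws"
    and z: "\<And>p. p \<in> exponents \<Longrightarrow> z (exponent_list p) \<Longrightarrow> monomial p = 0"
    and span: "V.span ((\<lambda>w. word_vector w v) ` set ws) = UNIV"
    and independent: "\<And>w. w \<in> set ws \<Longrightarrow> word_vector w v \<notin>
      V.span ((\<lambda>w'. word_vector w' v) ` {w' \<in> set ws. w' \<noteq> w \<and> word_drop w' = word_drop w})"
  shows "essential_signatures f scaleV act k v = (\<lambda>w. (k, \<lambda>i. int (count_list w i))) ` set ws"
proof -
  define B where "B = count_list ` set ws"
  have word: "exponent_word (count_list w) = w" if "w \<in> set ws" for w
    using ws that by (simp add: first_in_weight_def list_all_iff)
  have monomial: "monomial (count_list w) = word_vector w v" if "w \<in> set ws" for w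
    using that by (simp add: monomial_vector_eq_word word)
  have "monomial ` B = (\<lambda>w. word_vector w v) ` set ws"
    unfolding B_def image_image by (intro image_cong refl monomial)
  with span have span_B: "V.span (monomial ` B) = UNIV" by simp
  have B: "B \<subseteq> exponents" using count_list_exponents word by (auto simp: B_def)
  have indep: "monomial b \<notin> V.span (monomial ` {b' \<in> B. b' \<noteq> b \<and> exponent_drop b' = exponent_drop b})"
    if "b \<in> B" for b
  proof -
    from that obtain w where w: "w \<in> set ws" "b = count_list w" by (auto simp: B_def)
    have "{b' \<in> B. b' \<noteq> b \<and> exponent_drop b' = exponent_drop b} \<subseteq>
        count_list ` {w' \<in> set ws. w' \<noteq> w \<and> word_drop w' = word_drop w}"
      using w word by (auto simp: B_def exponent_drop_def)
    then have "monomial ` {b' \<in> B. b' \<noteq> b \<and> exponent_drop b' = exponent_drop b} \<subseteq>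
        (\<lambda>w'. word_vector w' v) ` {w' \<in> set ws. w' \<noteq> w \<and> word_drop w' = word_drop w}"
      using monomial by force
    from V.span_mono[OF this] show ?thesis
      using independent[OF w(1)] monomial[OF w(1)] w(2) by auto
  qed
  have first: "exponent_less b p \<or> monomial p = 0"
    if b: "b \<in> B" and p: "p \<in> exponents" "p \<notin> B" and eq: "exponent_drop p = exponent_drop b" for b p
  proof -
    from b obtain w where w: "w \<in> set ws" "b = count_list w" by (auto simp: B_def)
    have "exponent_list p \<in> set (partitions [1..<13] (word_drop w))"
    proof -
      have "set [1..<13] \<subseteq> {1..12::nat}" by auto
      from partitions_complete[OF this, of p] show ?thesis
        using eq w(2) word[OF w(1)]
        by (simp only: exponent_list_def exponent_drop_def exponent_word_def)
    qed
    then have "z (exponent_list p) \<or> exponent_list p \<in> (\<lambda>w. exponent_list (count_list w)) ` set ws \<or>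
        lex_less (rev (partial_sums 0 (exponent_list b))) (rev (partial_sums 0 (exponent_list p)))"
      using ws w unfolding first_in_weight_def list_all_iff set_map by blast
    moreover have "exponent_list p \<notin> (\<lambda>w. exponent_list (count_list w)) ` set ws"
      using p B exponents_eqI unfolding B_def by blast
    ultimately show ?thesis using z p(1) exponent_less_lex by blast
  qed
  have "monomial p \<notin> V.span (monomial ` {p' \<in> exponents. exponent_less p' p}) \<longleftrightarrow> p \<in> B"
    if p: "p \<in> exponents" for p
  proof
    assume "p \<in> B"
    show "monomial p \<notin> V.span (monomial ` {p' \<in> exponents. exponent_less p' p})"
    proof
      assume "monomial p \<in> V.span (monomial ` {p' \<in> exponents. exponent_less p' p})"
      from monomial_in_span_same_weight[OF this]
      have "monomial p \<in> V.span (monomial ` {q \<in> {p' \<in> exponents. exponent_less p' p}. exponent_drop q = exponent_drop p})" .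
      moreover have "monomial ` {q \<in> {p' \<in> exponents. exponent_less p' p}. exponent_drop q = exponent_drop p} \<subseteq>
          V.span (monomial ` {b' \<in> B. b' \<noteq> p \<and> exponent_drop b' = exponent_drop p})"
      proof safe
        fix q assume q: "q \<in> exponents" "exponent_less q p" "exponent_drop q = exponent_drop p"
        show "monomial q \<in> V.span (monomial ` {b' \<in> B. b' \<noteq> p \<and> exponent_drop b' = exponent_drop p})"
        proof (cases "q \<in> B")
          case True
          moreover have "q \<noteq> p" using q(2) exponent_less_asym by blast
          ultimately show ?thesis using q by (intro V.span_base) auto
        next
          case False
          then have "monomial q = 0" using first[OF \<open>p \<in> B\<close> q(1) False q(3)] q(2) exponent_less_asym by blast
          then show ?thesis by (simp add: V.span_zero)
        qed
      qed
      ultimately have "monomial p \<in> V.span (monomial ` {b' \<in> B. b' \<noteq> p \<and> exponent_drop b' = exponent_drop p})"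
        using V.span_minimal V.subspace_span by blast
      with indep[OF \<open>p \<in> B\<close>] show False by contradiction
    qed
  next
    assume not_in: "monomial p \<notin> V.span (monomial ` {p' \<in> exponents. exponent_less p' p})"
    show "p \<in> B"
    proof (rule ccontr)
      assume "p \<notin> B"
      have "monomial p \<noteq> 0" using not_in V.span_zero by metis
      then have "monomial ` {q \<in> B. exponent_drop q = exponent_drop p} \<subseteq>
          monomial ` {p' \<in> exponents. exponent_less p' p}"
        using first[OF _ p \<open>p \<notin> B\<close>] B by auto
      moreover have "monomial p \<in> V.span (monomial ` {q \<in> B. exponent_drop q = exponent_drop p})"
        by (rule monomial_in_span_same_weight) (simp add: span_B)
      ultimately show False using not_in V.span_mono by blast
    qed
  qed
  then have "{p \<in> exponents. monomial p \<notin> V.span (monomial ` {p' \<in> exponents. exponent_less p' p})} = B"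
    using B by blast
  then show ?thesis
    unfolding essential_signatures_altdef by (simp add: B_def image_image)
qed

end

section \<open>The adjoint representation\<close>

text \<open>
  The essential signatures of \<open>V(\<omega>\<^sub>2)\<close>, as words.
\<close>

definition words2 :: "nat list list" where
  "words2 = [[], [1], [2], [3], [5], [6], [7], [8], [10], [11],
     [1, 1], [1, 2], [1, 3], [1, 5], [1, 6], [1, 7], [1, 8], [1, 10], [1, 11],
     [2, 6], [2, 11], [3, 10], [3, 11], [5, 8], [6, 8], [6, 10], [6, 11], [8, 11]]"

text \<open>
  Applying lowering operators to the highest root vector keeps each vector on the line of some root
  vector or of some coroot. Such lines can be followed by computation without knowing the structure
  constants. The value \<open>None\<close> stands for vectors that may vanish.
\<close>

datatype line = Root vec4 | Coroot vec4

fun lower :: "nat \<Rightarrow> line option \<Rightarrow> line option" where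
  "lower i (Some (Root b)) = (if b = rt i then Some (Coroot b)
     else if ip (- rt i) b = -1 then Some (Root (- rt i + b)) else None)"
| "lower i (Some (Coroot b)) = (if ip (- rt i) b = 0 then None else Some (Root (- rt i)))"
| "lower i None = None"

definition adjoint_line :: "nat list \<Rightarrow> line option" where
  "adjoint_line w = foldr lower w (Some (Root (rt 1)))"

context d4_lie_algebra begin

fun spans_line :: "'g \<Rightarrow> line option \<Rightarrow> bool" where
  "spans_line x (Some (Root b)) \<longleftrightarrow> is_rt b \<and> (\<exists>n. n \<noteq> 0 \<and> x = scale n (X b))"
| "spans_line x (Some (Coroot b)) \<longleftrightarrow> is_rt b \<and> (\<exists>n. n \<noteq> 0 \<and> x = scale n (coroot b))"
| "spans_line x None \<longleftrightarrow> True"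

lemma bracket_f_spans_line:
  assumes "i \<in> {1..12}" "spans_line x l"
  shows "spans_line (bracket (f i) x) (lower i l)"
proof -
  have i: "is_rt (- rt i)" "f i = X (- rt i)"
    using assms(1) by (simp_all add: is_rt_rt X_uminus_rt)
  consider b where "l = Some (Root b)" "b = rt i" | b where "l = Some (Root b)" "b \<noteq> rt i" "ip (- rt i) b = -1"
    | b where "l = Some (Coroot b)" "ip (- rt i) b \<noteq> 0" | "lower i l = None"
    by (metis lower.simps line.exhaust option.exhaust)
  then show ?thesis
  proof cases
    case 1
    then obtain n where n: "n \<noteq> 0" "x = scale n (X (rt i))" using assms(2) by auto
    have "bracket (f i) (X (rt i)) = scale (- c (rt i)) (coroot (rt i))"
      using bracket_X_uminus[OF i(1)] c_uminus[of "rt i"] is_rt_rt[OF assms(1)] i(2)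
      by (simp add: coroot_uminus)
    then have "bracket (f i) x = scale (n * - c (rt i)) (coroot (rt i))"
      by (simp add: n right.scale)
    moreover have "n * - c (rt i) \<noteq> 0"
      using n(1) c_nonzero[OF is_rt_rt[OF assms(1)]] by simp
    ultimately have "\<exists>m. m \<noteq> 0 \<and> bracket (f i) x = scale m (coroot (rt i))" by blast
    then show ?thesis
      using 1 is_rt_rt[OF assms(1)] by simp
  next
    case 2
    then obtain n where n: "n \<noteq> 0" "x = scale n (X b)" and b: "is_rt b" using assms(2) by auto
    have "bracket (f i) x = scale (n * N (- rt i) b) (X (- rt i + b))"
      using bracket_X_X[OF i(1) b 2(3)] by (simp add: n i(2) right.scale)
    moreover have "n * N (- rt i) b \<noteq> 0" using n N_nonzero[OF i(1) b 2(3)] by simp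
    ultimately have "\<exists>m. m \<noteq> 0 \<and> bracket (f i) x = scale m (X (- rt i + b))" by blast
    moreover have "is_rt (- rt i + b)" using is_rt_add_iff[OF i(1) b] 2(3) by blast
    ultimately show ?thesis using 2 by simp
  next
    case 3
    then obtain n where n: "n \<noteq> 0" "x = scale n (coroot b)" and b: "is_rt b" using assms(2) by auto
    have "bracket (f i) (coroot b) = - bracket (coroot b) (X (- rt i))"
      unfolding i(2) by (rule bracket_antisym)
    then have "bracket (f i) x = scale (n * - of_int (ip (- rt i) b)) (X (- rt i))"
      by (simp add: n right.scale bracket_T_X[OF i(1) coroot_in_T] functional_coroot)
    moreover have "n * - of_int (ip (- rt i) b) \<noteq> 0" using n 3 by simp
    ultimately have "\<exists>m. m \<noteq> 0 \<and> bracket (f i) x = scale m (X (- rt i))" by blast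
    then show ?thesis using 3 i(1) by simp
  qed simp
qed

lemma adjoint_word_spans_line:
  "set w \<subseteq> {1..12} \<Longrightarrow> spans_line (foldr (\<lambda>i. bracket (f i)) w (e 1)) (adjoint_line w)"
proof (induction w)
  case Nil
  have "e 1 = scale 1 (X (rt 1))" using X_rt[of 1] by simp
  then show ?case
    using is_rt_rt[of 1] by (auto simp: adjoint_line_def intro!: exI[of _ 1])
next
  case (Cons i w)
  then show ?case using bracket_f_spans_line[of i] by (simp add: adjoint_line_def)
qed

text \<open>
  The coroots of \<open>\<alpha>\<^sub>1, \<alpha>\<^sub>3, \<alpha>\<^sub>5, \<alpha>\<^sub>6\<close> are those that the listed words of weight zero produce. The
  coefficients solve the resulting linear system.
\<close>

lemma T_combination:
  assumes "h \<in> T"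
  shows "h \<in> span (coroot ` {rt 1, rt 3, rt 5, rt 6})"
proof -
  define t where "t i = \<epsilon> i h" for i :: nat
  define h' where "h' = scale ((t 1 + t 2 - t 3 - t 4) / 2) (coroot (rt 1)) + (scale (t 3) (coroot (rt 3)) +
    (scale ((t 3 + t 2 + t 4 - t 1) / 2) (coroot (rt 5)) + scale ((t 1 - t 2 - t 3 + t 4) / 2) (coroot (rt 6))))"
  have "h = h'"
  proof (rule T_eqI)
    show "h' \<in> T"
      unfolding h'_def by (intro subspace_add[OF subspace_T] subspace_scale[OF subspace_T] coroot_in_T)
    fix a :: vec4
    obtain a1 a2 a3 a4 where a: "a = (a1, a2, a3, a4)" by (cases a)
    have "functional \<epsilon> a h' = (t 1 + t 2 - t 3 - t 4) / 2 * of_int (ip a (rt 1)) + (t 3 * of_int (ip a (rt 3)) +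
        ((t 3 + t 2 + t 4 - t 1) / 2 * of_int (ip a (rt 5)) + (t 1 - t 2 - t 3 + t 4) / 2 * of_int (ip a (rt 6))))"
      unfolding h'_def
      by (simp only: functional_add functional_scale functional_coroot coroot_in_T
        subspace_scale[OF subspace_T] subspace_add[OF subspace_T])
    also have "\<dots> = functional \<epsilon> a h"
      by (simp add: a rt_def functional.simps field_simps flip: t_def)
    finally show "functional \<epsilon> a h = functional \<epsilon> a h'" ..
  qed (rule assms)
  then show ?thesis
    unfolding h'_def by (simp only:) (intro span_add span_scale span_base; simp)
qed

lemma coroot_notin_span:
  assumes "ip u a \<noteq> 0" "\<And>b. b \<in> S \<Longrightarrow> ip u b = 0"
  shows "coroot a \<notin> span (coroot ` S)"
proof
  assume "coroot a \<in> span (coroot ` S)"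
  moreover have "subspace {h \<in> T. functional \<epsilon> u h = 0}"
    using functional_scale[of 0 u 0] subspace_0[OF subspace_T]
    by (auto simp: subspace_def functional_add functional_scale
      subspace_scale[OF subspace_T] subspace_add[OF subspace_T])
  moreover have "coroot ` S \<subseteq> {h \<in> T. functional \<epsilon> u h = 0}"
    using assms(2) by (auto simp: coroot_in_T functional_coroot)
  ultimately have "coroot a \<in> {h \<in> T. functional \<epsilon> u h = 0}"
    using span_minimal by blast
  then show False using assms(1) by (simp add: functional_coroot)
qed

end

text \<open>
  The exception concerns the weight \<open>\<epsilon>\<^sub>2 - \<epsilon>\<^sub>1\<close>, whose first exponent is that of \<open>f 1\<close> and \<open>f 12\<close>, ahead
  of the listed one of \<open>f 6\<close> and \<open>f 8\<close>. Monomials with \<open>f 12\<close> vanish, because \<open>\<omega>\<^sub>2\<close> is orthogonal to \<open>\<alpha>\<^sub>1\<^sub>2\<close>.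
\<close>

lemma first_in_weight_words2: "first_in_weight (\<lambda>xs. 0 < last xs) words2"
  by code_simp

lemma adjoint_lines_words2:
  "\<forall>i\<in>{1..12}. Some (Root (rt i)) \<in> set (map adjoint_line words2) \<and>
     Some (Root (- rt i)) \<in> set (map adjoint_line words2)"
  "\<forall>i\<in>{1, 3, 5, 6}. Some (Coroot (rt i)) \<in> set (map adjoint_line words2)"
  unfolding atLeast1_atMost12 by code_simp+

lemma words2_nonzero_weights:
  "\<forall>w\<in>set words2. set w \<subseteq> {1..12} \<and> adjoint_line w \<noteq> None \<and>
     (word_drop w \<noteq> rt 1 \<longrightarrow> (\<forall>w'\<in>set words2. word_drop w' = word_drop w \<longrightarrow> w' = w))"
  unfolding atLeast1_atMost12 by code_simp

text \<open>The vectors \<open>u\<close> form, up to scalars, the basis dual to the four coroots.\<close>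

lemma words2_zero_weight:
  "\<forall>w\<in>set words2. word_drop w = rt 1 \<longrightarrow> adjoint_line w = Some (Coroot (rt (hd w))) \<and>
     (\<exists>u\<in>set [(1, 1, -1, -1), (0, 0, 1, 0), (1, -1, -1, 1), (1, -1, -1, -1)].
        ip u (rt (hd w)) \<noteq> 0 \<and>
        (\<forall>w'\<in>set words2. word_drop w' = rt 1 \<and> w' \<noteq> w \<longrightarrow> ip u (rt (hd w')) = 0))"
  by code_simp

text \<open>
  The listed words lead to the lines of all root vectors and of four independent coroots.
\<close>

lemma (in d4_lie_algebra) essential_signatures_adjoint:
  "essential_signatures f scale bracket (fund_coords 2) (e 1) =
     (\<lambda>w. (fund_coords 2, \<lambda>i. int (count_list w i))) ` set words2"
proof -
  interpret ad: d4_irrep scale bracket T \<epsilon> e f scale bracket "fund_coords 2" "e 1"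
    by (rule adjoint_irrep)
  have line: "spans_line (ad.word_vector w (e 1)) (adjoint_line w)" if "w \<in> set words2" for w
    using that words2_nonzero_weights by (intro adjoint_word_spans_line) blast
  have line_in_span: "x \<in> span ((\<lambda>w. ad.word_vector w (e 1)) ` set words2)"
    if x: "l \<in> set (map adjoint_line words2)"
      "\<And>y. spans_line y l \<Longrightarrow> \<exists>n. n \<noteq> 0 \<and> y = scale n x" for l x
  proof -
    from x(1) obtain w where w: "w \<in> set words2" "l = adjoint_line w" by auto
    then obtain n where "n \<noteq> 0" "ad.word_vector w (e 1) = scale n x" using x(2) line by blast
    then have "x = scale (inverse n) (ad.word_vector w (e 1))" by simp
    then show ?thesis using w(1) by (simp only:) (intro span_scale span_base imageI)
  qed
  show ?thesis
  proof (rule ad.essential_signatures_eq[OF first_in_weight_words2])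
    fix p assume p: "p \<in> exponents" "0 < last (exponent_list p)"
    have upt: "[1..<13] = [1..<12] @ [12::nat]" using upt_Suc_append[of 1 12] by simp
    have "last (exponent_list p) = p 12" by (simp only: exponent_list_def upt map_append) simp
    then have "0 < p 12" using p by simp
    have "ip (- rt 12) (rt 1) = 0" by (simp add: rt_def)
    then have "bracket (f 12) (e 1) = 0"
      using bracket_X_X_eq_0[of "- rt 12" "rt 1"] is_rt_rt[of 1] is_rt_rt[of 12] X_rt[of 1] X_uminus_rt[of 12]
      by simp
    moreover have "exponent_word p = concat (map (\<lambda>i. replicate (p i) i) [1..<12]) @ replicate (p 12) 12"
      by (simp only: exponent_word_def upt map_append concat_append) simp
    moreover have "p 12 = Suc (p 12 - 1)" using \<open>0 < p 12\<close> by simp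
    then have "replicate (p 12) (12::nat) = replicate (p 12 - 1) 12 @ [12]"
      by (metis replicate_Suc replicate_append_same)
    ultimately have "ad.monomial p = foldr (\<lambda>i. bracket (f i))
        (concat (map (\<lambda>i. replicate (p i) i) [1..<12]) @ replicate (p 12 - 1) 12) 0"
      by (simp add: monomial_vector_eq_word)
    moreover have "foldr (\<lambda>i. bracket (f i)) w 0 = 0" for w
      by (induction w) (simp_all add: right.zero)
    ultimately show "ad.monomial p = 0" by simp
  next
    have X: "X a \<in> span ((\<lambda>w. ad.word_vector w (e 1)) ` set words2)" if "is_rt a" for a
    proof -
      have "Some (Root a) \<in> set (map adjoint_line words2)"
        using that adjoint_lines_words2(1) by (elim is_rt_cases) blast+
      then show ?thesis by (rule line_in_span) auto
    qed
    have "coroot (rt i) \<in> span ((\<lambda>w. ad.word_vector w (e 1)) ` set words2)" if "i \<in> {1, 3, 5, 6}" for i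
    proof -
      have "Some (Coroot (rt i)) \<in> set (map adjoint_line words2)"
        using that adjoint_lines_words2(2) by blast
      then show ?thesis by (rule line_in_span) auto
    qed
    then have "coroot ` {rt 1, rt 3, rt 5, rt 6} \<subseteq> span ((\<lambda>w. ad.word_vector w (e 1)) ` set words2)"
      by auto
    then have "T \<subseteq> span ((\<lambda>w. ad.word_vector w (e 1)) ` set words2)"
      using T_combination span_minimal[OF _ subspace_span] by blast
    then have "T \<union> X ` Collect is_rt \<subseteq> span ((\<lambda>w. ad.word_vector w (e 1)) ` set words2)"
      using X by auto
    from span_minimal[OF this subspace_span]
    show "span ((\<lambda>w. ad.word_vector w (e 1)) ` set words2) = UNIV"
      by (auto simp: span_T_X)
  next
    fix w assume w: "w \<in> set words2"
    let ?S = "{w' \<in> set words2. w' \<noteq> w \<and> word_drop w' = word_drop w}"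
    show "ad.word_vector w (e 1) \<notin> span ((\<lambda>w'. ad.word_vector w' (e 1)) ` ?S)"
    proof (cases "word_drop w = rt 1")
      case False
      then have "?S = {}" using words2_nonzero_weights w by blast
      moreover have "ad.word_vector w (e 1) \<noteq> 0"
      proof -
        obtain b where "adjoint_line w = Some (Root b) \<or> adjoint_line w = Some (Coroot b)"
          using words2_nonzero_weights w by (metis line.exhaust not_None_eq)
        then show ?thesis
          using line[OF w] X_nonzero[of b] coroot_nonzero[of b] by auto
      qed
      ultimately show ?thesis by (simp only: image_empty span_empty) blast
    next
      case True
      have coroot: "\<exists>n. n \<noteq> 0 \<and> ad.word_vector w' (e 1) = scale n (coroot (rt (hd w')))"
        if "w' \<in> set words2" "word_drop w' = rt 1" for w'
        using line[OF that(1)] words2_zero_weight that by auto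
      obtain u where u: "ip u (rt (hd w)) \<noteq> 0"
        "\<And>w'. w' \<in> set words2 \<Longrightarrow> word_drop w' = rt 1 \<Longrightarrow> w' \<noteq> w \<Longrightarrow> ip u (rt (hd w')) = 0"
        using words2_zero_weight w True by blast
      have "(\<lambda>w'. ad.word_vector w' (e 1)) ` ?S \<subseteq> span (coroot ` (\<lambda>w'. rt (hd w')) ` ?S)"
        using coroot True by (force intro: span_scale span_base)
      from span_minimal[OF this subspace_span]
      have "coroot (rt (hd w)) \<in> span (coroot ` (\<lambda>w'. rt (hd w')) ` ?S)"
        if "ad.word_vector w (e 1) \<in> span ((\<lambda>w'. ad.word_vector w' (e 1)) ` ?S)"
      proof -
        obtain n where n: "n \<noteq> 0" "ad.word_vector w (e 1) = scale n (coroot (rt (hd w)))"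
          using coroot[OF w True] by blast
        then have "coroot (rt (hd w)) = scale (inverse n) (ad.word_vector w (e 1))" by simp
        then show ?thesis
          using that \<open>span _ \<subseteq> span _\<close> by (auto intro!: span_scale)
      qed
      moreover have "coroot (rt (hd w)) \<notin> span (coroot ` (\<lambda>w'. rt (hd w')) ` ?S)"
        using u True by (intro coroot_notin_span[of u]) auto
      ultimately show ?thesis by blast
    qed
  qed
qed

section \<open>Minuscule representations\<close>

definition word_weight :: "vec4 \<Rightarrow> nat list \<Rightarrow> vec4" where
  "word_weight l w = l - word_drop w - word_drop w"

text \<open>
  In doubled coordinates, a minuscule weight pairs with all coroots to \<open>-2\<close>, \<open>0\<close> or \<open>2\<close>, and the pairing
  tells whether a neighbour along the root is again a weight. The last condition says that only \<open>l\<close>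
  is dominant.
\<close>

definition minuscule :: "vec4 \<Rightarrow> vec4 list \<Rightarrow> bool" where
  "minuscule l P \<longleftrightarrow> list_all (\<lambda>i. 0 \<le> ip l (rt i)) [1..<13] \<and>
     list_all (\<lambda>a. list_all (\<lambda>i. ip a (rt i) \<in> {-2, 0, 2} \<and>
        (ip a (rt i) = 2 \<longleftrightarrow> a - rt i - rt i \<in> set P) \<and>
        (ip a (rt i) = -2 \<longleftrightarrow> a + rt i + rt i \<in> set P)) [1..<13] \<and>
       (a = l \<or> list_ex (\<lambda>i. ip a (rt i) = -2) [4, 9, 11, 12])) P"

text \<open>
  Each letter of the word, applied from the right, finds a weight that it can lower.
\<close>

fun lowers :: "vec4 \<Rightarrow> nat list \<Rightarrow> bool" where
  "lowers l [] \<longleftrightarrow> True"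
| "lowers l (i # w) \<longleftrightarrow> lowers l w \<and> i \<in> {1..12} \<and> ip (word_weight l w) (rt i) = 2"

lemma ip_simple_rt:
  "i \<in> simple_indices \<Longrightarrow> j \<in> simple_indices \<Longrightarrow> i \<noteq> j \<Longrightarrow> ip (rt i) (rt j) \<in> {-1, 0}"
proof -
  have "\<forall>i\<in>simple_indices. \<forall>j\<in>simple_indices. i \<noteq> j \<longrightarrow> ip (rt i) (rt j) \<in> {-1, 0}"
    unfolding simple_indices_def by code_simp
  then show "i \<in> simple_indices \<Longrightarrow> j \<in> simple_indices \<Longrightarrow> i \<noteq> j \<Longrightarrow> ip (rt i) (rt j) \<in> {-1, 0}"
    by blast
qed

lemma ip_rt_self: "i \<in> {1..12} \<Longrightarrow> ip (rt i) (rt i) = 2"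
  using is_rt_rt by (simp add: is_rt_def)

context d4_irrep begin

lemma span_simple_words:
  "V.span ((\<lambda>ws. word_vector ws v) ` {ws. set ws \<subseteq> simple_indices}) = UNIV"
proof -
  let ?W = "V.span ((\<lambda>ws. word_vector ws v) ` {ws. set ws \<subseteq> simple_indices})"
  have simple: "act (f i) w \<in> ?W" if "i \<in> simple_indices" "w \<in> ?W" for i w
    using that(2)
  proof (induction rule: V.span_induct_alt)
    case (step a z y)
    then obtain ws where "set ws \<subseteq> simple_indices" "z = word_vector ws v" by auto
    then have "act (f i) z \<in> ?W"
      using that(1) by (intro V.span_base image_eqI[of _ _ "i # ws"]) auto
    then show ?case
      using step by (simp add: act_right.add act_right.scale V.span_add V.span_scale)
  qed (simp add: act_right.zero V.span_zero)
  have "word_vector ws v \<in> ?W" if "set ws \<subseteq> {1..12}" for ws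
    using that
  proof (induction ws)
    case Nil
    show ?case by (rule V.span_base) (auto intro!: image_eqI[of _ _ "[]"])
  next
    case (Cons i ws)
    then show ?case using act_closed_f[OF V.subspace_span simple] by auto
  qed
  then have "(\<lambda>ws. word_vector ws v) ` {ws. set ws \<subseteq> {1..12}} \<subseteq> ?W" by auto
  from V.span_minimal[OF this V.subspace_span] show ?thesis by (simp only: span_words) blast
qed

text \<open>
  A weight space other than the highest one is spanned by the images of the weight spaces one simple
  root above.
\<close>

lemma weight_space_subset:
  assumes W: "V.subspace W" and a: "a \<noteq> highest_weight k"
    and lower: "\<And>i w. i \<in> simple_indices \<Longrightarrow> w \<in> weight_space (a + rt i + rt i) \<Longrightarrow> act (f i) w \<in> W"
  shows "weight_space a \<subseteq> W"
proof
  fix w assume w: "w \<in> weight_space a"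
  let ?D = "{ws \<in> {ws. set ws \<subseteq> simple_indices}. highest_weight k - word_drop ws - word_drop ws = a}"
  have simple: "set ws \<subseteq> {1..12}" if "set ws \<subseteq> simple_indices" for ws
    using that simple_indices_subset by blast
  have "w \<in> V.span ((\<lambda>ws. word_vector ws v) ` ?D)"
    using w by (intro weight_vector_in_span word_vector_weight_space highest_vector_weight_space simple)
      (simp_all only: span_simple_words UNIV_I mem_Collect_eq)
  moreover have "word_vector ws v \<in> W" if "ws \<in> ?D" for ws
  proof (cases ws)
    case Nil
    then show ?thesis using that a by simp
  next
    case (Cons i ws')
    have "word_vector ws' v \<in> weight_space (highest_weight k - word_drop ws' - word_drop ws')"
      using that Cons by (intro word_vector_weight_space highest_vector_weight_space simple) auto
    moreover have "highest_weight k - word_drop ws' - word_drop ws' = a + rt i + rt i"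
      using that Cons by (auto simp: algebra_simps)
    ultimately show ?thesis using lower[of i] that Cons by simp
  qed
  then have "(\<lambda>ws. word_vector ws v) ` ?D \<subseteq> W" by blast
  from V.span_minimal[OF this W]
  show "w \<in> W" using calculation by blast
qed

lemma weight_space_high:
  assumes "w \<in> weight_space a" "a \<noteq> highest_weight k" "ip (3, 2, 1, 0) (highest_weight k) \<le> ip (3, 2, 1, 0) a"
  shows "w = 0"
proof (rule ccontr)
  assume "w \<noteq> 0"
  from nonzero_in_spanD[OF weight_space_eq_span_words[OF assms(1)] this]
  obtain ws where ws: "set ws \<subseteq> {1..12}" "highest_weight k - word_drop ws - word_drop ws = a" by blast
  have "ip (3, 2, 1, 0) a = ip (3, 2, 1, 0) (highest_weight k) - 2 * ip (3, 2, 1, 0) (word_drop ws)"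
    by (simp add: ip_simps flip: ws(2))
  then have "ws = []"
    using length_le_height[OF ws(1)] assms(3) by (cases ws) auto
  then show False using ws(2) assms(2) by simp
qed

lemma act_e_f_same:
  assumes "i \<in> {1..12}" "w \<in> weight_space a"
  shows "act (e i) (act (f i) w) = act (f i) (act (e i) w) + scaleV (c (rt i) * of_int (ip a (rt i)) / 2) w"
proof -
  have "bracket (e i) (f i) = scale (c (rt i)) (coroot (rt i))"
    using bracket_X_uminus[OF is_rt_rt[OF assms(1)]] assms(1) by (simp add: X_rt X_uminus_rt)
  then have "act (e i) (act (f i) w) - act (f i) (act (e i) w) = scaleV (c (rt i)) (act (coroot (rt i)) w)"
    by (simp flip: act_bracket act_left.scale)
  then show ?thesis using act_coroot[OF assms(2)] by (simp add: algebra_simps)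
qed

lemma act_f_commute:
  assumes "i \<in> {1..12}" "j \<in> {1..12}" "0 \<le> ip (rt i) (rt j)"
  shows "act (f i) (act (f j) w) = act (f j) (act (f i) w)"
proof -
  have "bracket (f i) (f j) = 0"
    using bracket_X_X_eq_0[of "- rt i" "- rt j"] assms by (simp add: is_rt_rt X_uminus_rt ip_simps)
  then show ?thesis using act_bracket[of "f i" "f j" w] by (simp add: act_left.zero)
qed

context
  fixes P :: "vec4 list"
  assumes minuscule: "minuscule (highest_weight k) P"
    and highest_in_P: "highest_weight k \<in> set P"
begin

lemma minusculeD:
  assumes "a \<in> set P" "i \<in> {1..12}"
  shows "ip a (rt i) \<in> {-2, 0, 2}"
    "ip a (rt i) = 2 \<longleftrightarrow> a - rt i - rt i \<in> set P"
    "ip a (rt i) = -2 \<longleftrightarrow> a + rt i + rt i \<in> set P"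
proof -
  have "i \<in> set [1..<13]" using assms(2) by auto
  then show "ip a (rt i) \<in> {-2, 0, 2}"
    "ip a (rt i) = 2 \<longleftrightarrow> a - rt i - rt i \<in> set P"
    "ip a (rt i) = -2 \<longleftrightarrow> a + rt i + rt i \<in> set P"
    using minuscule assms(1) unfolding minuscule_def list_all_iff by blast+
qed

text \<open>
  Both claims are proved together by induction on the distance from the highest weight.

  For a weight \<open>a\<close> outside \<open>P\<close>, a vector \<open>f\<^sub>i w\<close> of weight \<open>a\<close> is shown to be singular. For \<open>j \<noteq> i\<close> the
  vector \<open>e\<^sub>j f\<^sub>i w\<close> has a weight whose pairing with the coroot of \<open>\<alpha>\<^sub>i\<close> is too small for \<open>P\<close>. And
  \<open>e\<^sub>i f\<^sub>i w\<close> vanishes by a computation in the \<open>sl\<^sub>2\<close> of \<open>\<alpha>\<^sub>i\<close>, for which \<open>w\<close> is either annihilated by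
  \<open>e\<^sub>i\<close> with pairing 0, or, by the second claim, obtained by \<open>f\<^sub>i\<close> from a vector annihilated by \<open>e\<^sub>i\<close>.

  For the second claim, a vector of weight \<open>a\<close> is a sum of vectors \<open>f\<^sub>j w\<close>. If \<open>j \<noteq> i\<close> and \<open>w \<noteq> 0\<close>, then
  \<open>\<alpha>\<^sub>i\<close> and \<open>\<alpha>\<^sub>j\<close> are orthogonal, as otherwise the pairing with \<open>\<alpha>\<^sub>i\<close> of the weight of \<open>w\<close> would be too
  small. So \<open>f\<^sub>i\<close> and \<open>f\<^sub>j\<close> commute, and the claim for the weight of \<open>w\<close> can be used.
\<close>

lemma minuscule_structure:
  "(a \<notin> set P \<longrightarrow> weight_space a \<subseteq> {0}) \<and>
   (a \<in> set P \<longrightarrow> (\<forall>i\<in>simple_indices. ip a (rt i) = -2 \<longrightarrow> weight_space a \<subseteq> act (f i) ` weight_space (a + rt i + rt i)))"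
proof (induction "nat (ip (3, 2, 1, 0) (highest_weight k) - ip (3, 2, 1, 0) a)" arbitrary: a rule: less_induct)
  case less
  let ?h = "ip (3, 2, 1, 0)"
  have image_subspace: "V.subspace (act (f i) ` weight_space b)" for i b
    by (intro act_right.subspace_image subspace_weight_space)
  show ?case
  proof (cases "?h (highest_weight k) \<le> ?h a")
    case True
    show ?thesis
    proof (cases "a = highest_weight k")
      case True
      have "0 \<le> ip a (rt i)" if "i \<in> simple_indices" for i
      proof -
        have "i \<in> set [1..<13]" using simple_indices_subset[OF that] by auto
        then show ?thesis using minuscule True unfolding minuscule_def list_all_iff by blast
      qed
      then show ?thesis using True highest_in_P by force
    next
      case False
      then have "weight_space a \<subseteq> {0}" using True weight_space_high by blast
      then show ?thesis using V.subspace_0[OF image_subspace] by blast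
    qed
  next
    case False
    then have a: "a \<noteq> highest_weight k" by auto
    have IH: "b \<notin> set P \<Longrightarrow> w \<in> weight_space b \<Longrightarrow> w = 0"
      "b \<in> set P \<Longrightarrow> i \<in> simple_indices \<Longrightarrow> ip b (rt i) = -2 \<Longrightarrow> w \<in> weight_space b \<Longrightarrow>
        \<exists>u\<in>weight_space (b + rt i + rt i). w = act (f i) u" if "?h a < ?h b" for b i w
      using less[of b] that False by auto
    have up: "?h b < ?h (b + rt i + rt i)" if "i \<in> simple_indices" for i b
      using height_rt[OF simple_indices_subset[OF that]] by (simp add: ip_simps)
    show ?thesis
    proof (intro conjI impI ballI)
      assume notP: "a \<notin> set P"
      show "weight_space a \<subseteq> {0}"
      proof (rule weight_space_subset[OF V.subspace_single_0 a])
        fix i w assume i: "i \<in> simple_indices" and w: "w \<in> weight_space (a + rt i + rt i)"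
        note i' = simple_indices_subset[OF i]
        let ?b = "a + rt i + rt i"
        have fw: "act (f i) w \<in> weight_space a" using act_f_weight_space[OF i' w] by simp
        show "act (f i) w \<in> {0}"
        proof (cases "?b \<in> set P")
          case False
          then show ?thesis using IH(1)[OF up[OF i] False w] by (simp add: act_right.zero)
        next
          case True
          have "ip ?b (rt i) \<noteq> 2" using minusculeD(2)[OF True i'] notP by auto
          then have b: "ip ?b (rt i) \<in> {-2, 0}" using minusculeD(1)[OF True i'] by auto
          have other: "act (e j) (act (f i) w) = 0" if j: "j \<in> simple_indices" "j \<noteq> i" for j
          proof -
            let ?d = "a + rt j + rt j"
            have "act (e j) (act (f i) w) \<in> weight_space ?d"
              using act_e_weight_space[OF simple_indices_subset[OF j(1)] fw] .
            moreover have "ip ?d (rt i) \<notin> {-2, 0, 2}"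
              using b ip_simple_rt[OF j(1) i j(2)] ip_rt_self[OF i'] by (auto simp: ip_simps)
            then have "?d \<notin> set P" using minusculeD(1)[OF _ i'] by blast
            ultimately show ?thesis using IH(1)[OF up[OF j(1)]] by blast
          qed
          have same: "act (e i) (act (f i) w) = 0"
          proof (cases "ip ?b (rt i) = 0")
            case True
            have "act (e i) w \<in> weight_space (?b + rt i + rt i)" using act_e_weight_space[OF i' w] .
            moreover have "?b + rt i + rt i \<notin> set P"
              using minusculeD(3)[OF \<open>?b \<in> set P\<close> i'] True by auto
            ultimately have "act (e i) w = 0"
              using IH(1)[OF less_trans[OF up[OF i] up[OF i]]] by blast
            then show ?thesis using act_e_f_same[OF i' w] True by (simp add: act_right.zero)
          next
            case False
            with b have b': "ip ?b (rt i) = -2" by auto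
            obtain u where u: "u \<in> weight_space (?b + rt i + rt i)" "w = act (f i) u"
              using IH(2)[OF up[OF i] True i b' w] by blast
            let ?d = "?b + rt i + rt i"
            have d: "?d \<in> set P" "ip ?d (rt i) = 2"
              using minusculeD(3)[OF True i'] b' ip_rt_self[OF i'] by (auto simp: ip_simps)
            have "act (e i) u \<in> weight_space (?d + rt i + rt i)" using act_e_weight_space[OF i' u(1)] .
            moreover have "?d + rt i + rt i \<notin> set P"
              using minusculeD(3)[OF d(1) i'] d(2) by auto
            ultimately have "act (e i) u = 0"
              using IH(1)[OF less_trans[OF less_trans[OF up[OF i] up[OF i]] up[OF i]]] by blast
            then have "act (e i) w = scaleV (c (rt i)) u"
              using act_e_f_same[OF i' u(1)] d(2) by (simp add: u(2) act_right.zero)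
            then show ?thesis
              using act_e_f_same[OF i' w] b' by (simp add: act_right.scale u(2)[symmetric])
          qed
          have "act (f i) w = 0"
            using other same by (intro singular_eq_0[OF fw a]) blast
          then show ?thesis by simp
        qed
      qed
    next
      fix i assume aP: "a \<in> set P" and i: "i \<in> simple_indices" and ai: "ip a (rt i) = -2"
      note i' = simple_indices_subset[OF i]
      show "weight_space a \<subseteq> act (f i) ` weight_space (a + rt i + rt i)"
      proof (rule weight_space_subset[OF image_subspace a])
        fix j w assume j: "j \<in> simple_indices" and w: "w \<in> weight_space (a + rt j + rt j)"
        note j' = simple_indices_subset[OF j]
        let ?b = "a + rt j + rt j"
        consider "j = i" | "?b \<notin> set P" | "j \<noteq> i" "?b \<in> set P" by blast
        then show "act (f j) w \<in> act (f i) ` weight_space (a + rt i + rt i)"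
        proof cases
          case 1
          then show ?thesis using w by blast
        next
          case 2
          then have "w = 0" using IH(1)[OF up[OF j]] w by blast
          then show ?thesis using V.subspace_0[OF image_subspace] by (simp add: act_right.zero)
        next
          case 3
          have aj: "ip a (rt j) = -2" using minusculeD(3)[OF aP j'] 3(2) by blast
          have ij: "ip (rt i) (rt j) = 0"
          proof (rule ccontr)
            assume "ip (rt i) (rt j) \<noteq> 0"
            then have "ip ?b (rt i) = -4"
              using ip_simple_rt[OF i j] 3(1) ai by (auto simp: ip_simps ip_commute[of "rt j"])
            then show False using minusculeD(1)[OF 3(2) i'] by simp
          qed
          then have "ip ?b (rt i) = -2" using ai by (simp add: ip_simps ip_commute[of "rt j"])
          then obtain u where u: "u \<in> weight_space (?b + rt i + rt i)" "w = act (f i) u"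
            using IH(2)[OF up[OF j] 3(2) i _ w] by blast
          have "act (f j) w = act (f i) (act (f j) u)"
            using act_f_commute[OF j' i'] ij by (simp add: u(2) ip_commute[of "rt j"])
          moreover have "act (f j) u \<in> weight_space (a + rt i + rt i)"
            using act_f_weight_space[OF j' u(1)] by (simp add: algebra_simps)
          ultimately show ?thesis by blast
        qed
      qed
    qed
  qed
qed

lemma outside_weights: "a \<notin> set P \<Longrightarrow> w \<in> weight_space a \<Longrightarrow> w = 0"
  using minuscule_structure[of a] by blast

text \<open>
  Every weight but the highest has a simple root along which it can be raised, and by
  \<open>minuscule_structure\<close> its weight space is the image of the one above.
\<close>

lemma weight_space_one_dimensional:
  assumes "a \<in> set P"
  shows "\<exists>u. weight_space a \<subseteq> V.span {u}"
  using assms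
proof (induction "nat (ip (3, 2, 1, 0) (highest_weight k) - ip (3, 2, 1, 0) a)" arbitrary: a rule: less_induct)
  case less
  show ?case
  proof (cases "a = highest_weight k")
    case True
    have "w \<in> V.span {v}" if "w \<in> weight_space a" for w
    proof -
      have "{ws \<in> {ws. set ws \<subseteq> {1..12}}. highest_weight k - word_drop ws - word_drop ws = a} \<subseteq> {[]}"
        using word_weight_unchanged[of _ a] True by auto
      then have "(\<lambda>ws. word_vector ws v) ` {ws \<in> {ws. set ws \<subseteq> {1..12}}.
          highest_weight k - word_drop ws - word_drop ws = a} \<subseteq> {v}" by auto
      from V.span_mono[OF this] show ?thesis using weight_space_eq_span_words[OF that] by blast
    qed
    then show ?thesis by blast
  next
    case False
    then have "list_ex (\<lambda>i. ip a (rt i) = -2) [4, 9, 11, 12]"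
      using minuscule less.prems unfolding minuscule_def list_all_iff by blast
    then have "\<exists>i\<in>simple_indices. ip a (rt i) = -2" by (simp add: simple_indices_def)
    then obtain i where i: "i \<in> simple_indices" "ip a (rt i) = -2" by blast
    note i' = simple_indices_subset[OF i(1)]
    have sub: "weight_space a \<subseteq> act (f i) ` weight_space (a + rt i + rt i)"
      using minuscule_structure[of a] i less.prems by blast
    show ?thesis
    proof (cases "ip (3, 2, 1, 0) (highest_weight k) \<le> ip (3, 2, 1, 0) a")
      case True
      then have "weight_space a \<subseteq> V.span {0}" using weight_space_high[of _ a] \<open>a \<noteq> highest_weight k\<close> by auto
      then show ?thesis by blast
    next
      case False
      then have "nat (ip (3, 2, 1, 0) (highest_weight k) - ip (3, 2, 1, 0) (a + rt i + rt i))
        < nat (ip (3, 2, 1, 0) (highest_weight k) - ip (3, 2, 1, 0) a)"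
        using height_rt[OF i'] by (simp add: ip_simps)
      moreover have "a + rt i + rt i \<in> set P" using minusculeD(3)[OF less.prems i'] i(2) by blast
      ultimately obtain u where u: "weight_space (a + rt i + rt i) \<subseteq> V.span {u}" using less.hyps by blast
      have "act (f i) w \<in> V.span {act (f i) u}" if "w \<in> weight_space (a + rt i + rt i)" for w
      proof -
        have "w \<in> V.span {u}" using that u by blast
        then obtain n where "w = scaleV n u" by (auto simp: V.span_singleton)
        then show ?thesis by (simp add: act_right.scale V.span_scale V.span_base)
      qed
      then show ?thesis using sub by blast
    qed
  qed
qed

text \<open>
  Here \<open>e\<^sub>i w = 0\<close>, so \<open>e\<^sub>i f\<^sub>i w\<close> is \<open>c\<close> times \<open>w\<close> with \<open>c \<noteq> 0\<close>.
\<close>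

lemma act_f_nonzero:
  assumes "a \<in> set P" "w \<in> weight_space a" "w \<noteq> 0" "i \<in> {1..12}" "ip a (rt i) = 2"
  shows "act (f i) w \<noteq> 0"
proof
  assume "act (f i) w = 0"
  have "act (e i) w \<in> weight_space (a + rt i + rt i)" using act_e_weight_space[OF assms(4,2)] .
  moreover have "a + rt i + rt i \<notin> set P" using minusculeD(3)[OF assms(1,4)] assms(5) by auto
  ultimately have "act (e i) w = 0" using outside_weights by blast
  then have "scaleV (c (rt i)) w = 0"
    using act_e_f_same[OF assms(4,2)] assms(5) \<open>act (f i) w = 0\<close> by (simp add: act_right.zero)
  then show False using c_nonzero[OF is_rt_rt[OF assms(4)]] assms(3) by simp
qed

lemma lowers_nonzero:
  "lowers (highest_weight k) w \<Longrightarrow>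
     word_weight (highest_weight k) w \<in> set P \<and> word_vector w v \<in> weight_space (word_weight (highest_weight k) w) \<and>
     word_vector w v \<noteq> 0"
proof (induction w)
  case Nil
  then show ?case using highest_in_P highest_vector_weight_space hw_nonzero by (simp add: word_weight_def)
next
  case (Cons i w)
  let ?a = "word_weight (highest_weight k) w"
  have i: "i \<in> {1..12}" "ip ?a (rt i) = 2" and w: "?a \<in> set P" "word_vector w v \<in> weight_space ?a" "word_vector w v \<noteq> 0"
    using Cons by auto
  have "word_weight (highest_weight k) (i # w) = ?a - rt i - rt i"
    by (simp add: word_weight_def algebra_simps)
  then show ?case
    using act_f_nonzero[OF w i] act_f_weight_space[OF i(1) w(2)] minusculeD(2)[OF w(1) i(1)] i(2) by simp
qed

end

text \<open>
  The listed words have distinct weights, and by \<open>outside_weights\<close> there are no others. Since weight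
  spaces are lines, the vectors of the words form a basis.
\<close>

lemma essential_signatures_minuscule:
  assumes minuscule: "minuscule (highest_weight k) (map (word_weight (highest_weight k)) ws)"
    and lowers: "list_all (lowers (highest_weight k)) ws"
    and distinct: "distinct (map word_drop ws)"
    and first: "first_in_weight (\<lambda>_. False) ws" and Nil: "[] \<in> set ws"
  shows "essential_signatures f scaleV act k v = (\<lambda>w. (k, \<lambda>i. int (count_list w i))) ` set ws"
proof (rule essential_signatures_eq[OF first])
  let ?P = "map (word_weight (highest_weight k)) ws"
  have highest: "highest_weight k \<in> set ?P"
    using Nil by (auto simp: word_weight_def intro!: image_eqI[of _ _ "[]"])
  have nonzero: "word_vector w v \<in> weight_space (word_weight (highest_weight k) w)" "word_vector w v \<noteq> 0"
    if "w \<in> set ws" for w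
    using lowers_nonzero[OF minuscule highest] lowers that by (auto simp: list_all_iff)
  have weight_space: "weight_space a \<subseteq> V.span ((\<lambda>w. word_vector w v) ` set ws)" for a
  proof (cases "a \<in> set ?P")
    case True
    then obtain w where w: "w \<in> set ws" "a = word_weight (highest_weight k) w" by auto
    obtain u where u: "weight_space a \<subseteq> V.span {u}" using weight_space_one_dimensional[OF minuscule highest True] by blast
    then obtain n where n: "word_vector w v = scaleV n u"
      using nonzero(1)[OF w(1)] w(2) by (auto simp: V.span_singleton)
    then have "u = scaleV (inverse n) (word_vector w v)"
      using nonzero(2)[OF w(1)] by auto
    then have "u \<in> V.span ((\<lambda>w. word_vector w v) ` set ws)"
      using w(1) by (simp only:) (intro V.span_scale V.span_base imageI)
    then have "V.span {u} \<subseteq> V.span ((\<lambda>w. word_vector w v) ` set ws)"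
      by (intro V.span_minimal V.subspace_span) auto
    then show ?thesis using u by blast
  next
    case False
    then have "weight_space a \<subseteq> {0}" using outside_weights[OF minuscule highest] by blast
    then show ?thesis using V.span_zero by blast
  qed
  have "(\<lambda>w. word_vector w v) ` {w. set w \<subseteq> {1..12}} \<subseteq> V.span ((\<lambda>w. word_vector w v) ` set ws)"
    using word_vector_weight_space[OF _ highest_vector_weight_space] weight_space by blast
  from V.span_minimal[OF this V.subspace_span]
  show "V.span ((\<lambda>w. word_vector w v) ` set ws) = UNIV" by (simp only: span_words) blast
  fix w assume w: "w \<in> set ws"
  have "{w' \<in> set ws. w' \<noteq> w \<and> word_drop w' = word_drop w} = {}"
    using distinct w by (auto simp: distinct_map dest: inj_onD)
  then show "word_vector w v \<notin> V.span ((\<lambda>w'. word_vector w' v) `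
      {w' \<in> set ws. w' \<noteq> w \<and> word_drop w' = word_drop w})"
    using nonzero(2)[OF w] by (simp only: image_empty V.span_empty) blast
qed simp

end

text \<open>
  The essential signatures of \<open>V(\<omega>\<^sub>1)\<close>, \<open>V(\<omega>\<^sub>3)\<close> and \<open>V(\<omega>\<^sub>4)\<close>, as words.
\<close>

definition words1 :: "nat list list" where
  "words1 = [[], [1], [3], [6], [7], [8], [12], [1, 12]]"

definition words3 :: "nat list list" where
  "words3 = [[], [1], [2], [3], [8], [9], [10], [3, 10]]"

definition words4 :: "nat list list" where
  "words4 = [[], [1], [2], [3], [4], [5], [6], [2, 6]]"

definition minuscule_words :: "vec4 \<Rightarrow> nat list list \<Rightarrow> bool" where
  "minuscule_words l ws \<longleftrightarrow> minuscule l (map (word_weight l) ws) \<and> list_all (lowers l) ws \<and>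
     distinct (map word_drop ws) \<and> first_in_weight (\<lambda>_. False) ws"

lemma minuscule_words:
  "minuscule_words (2, 0, 0, 0) words1" "minuscule_words (1, 1, 1, -1) words3"
  "minuscule_words (1, 1, 1, 1) words4"
  by code_simp+

section \<open>Polyhedral cones and their generators\<close>

text \<open>
  A generator is given by the index of a fundamental weight and the word of an exponent. Vectors and
  linear forms have the 16 coordinates \<open>k\<^sub>1, \<dots>, k\<^sub>4, p\<^sub>1, \<dots>, p\<^sub>1\<^sub>2\<close> in this order.
\<close>

type_synonym generator = "nat \<times> nat list"

definition gvec :: "generator \<Rightarrow> int list" where
  "gvec g = map (fund_coords (fst g)) [1..<5] @ map (\<lambda>j. int (count_list (snd g) j)) [1..<13]"

fun dot :: "int list \<Rightarrow> int list \<Rightarrow> int" where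
  "dot (a # as) (b # bs) = a * b + dot as bs"
| "dot _ _ = 0"

fun form :: "int list \<Rightarrow> (nat \<Rightarrow> rat) \<Rightarrow> rat" where
  "form [] x = 0"
| "form (a # as) x = of_int a * x 0 + form as (\<lambda>i. x (Suc i))"

definition row_comb :: "int \<Rightarrow> int list \<Rightarrow> int \<Rightarrow> int list \<Rightarrow> int list" where
  "row_comb c a d b = map2 (\<lambda>x y. c * x + d * y) a b"

definition row_sum :: "int list list \<Rightarrow> int list" where
  "row_sum rs = foldr (map2 (+)) rs (replicate 16 0)"

lemma form_diff: "form a (\<lambda>i. x i - t * y i) = form a x - t * form a y"
  by (induction a arbitrary: x y) (simp_all add: algebra_simps)

lemma form_gvec: "form a (\<lambda>i. of_int (b ! i)) = of_int (dot a b)" if "length a = length b"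
  using that by (induction a b rule: list_induct2) simp_all

lemma form_row_comb:
  "length a = length b \<Longrightarrow> form (row_comb c a d b) x = of_int c * form a x + of_int d * form b x"
  unfolding row_comb_def by (induction a b arbitrary: x rule: list_induct2) (simp_all add: algebra_simps)

lemma length_row_sum: "list_all (\<lambda>r. length r = 16) rs \<Longrightarrow> length (row_sum rs) = 16"
  unfolding row_sum_def by (induction rs) auto

lemma form_row_sum:
  assumes "list_all (\<lambda>r. length r = 16) rs"
  shows "form (row_sum rs) x = (\<Sum>r\<leftarrow>rs. form r x)"
  using assms
proof (induction rs)
  case Nil
  have "form (replicate n 0) x = 0" for n by (induction n arbitrary: x) simp_all
  then show ?case by (simp add: row_sum_def)
next
  case (Cons r rs)
  have add: "length a = length b \<Longrightarrow> form (map2 (+) a b) x = form a x + form b x" for a b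
    by (induction a b arbitrary: x rule: list_induct2) (simp_all add: algebra_simps)
  have "row_sum (r # rs) = map2 (+) r (row_sum rs)" by (simp add: row_sum_def)
  then show ?case using Cons by (simp add: add length_row_sum)
qed

definition in_hcone :: "int list list \<Rightarrow> (nat \<Rightarrow> rat) \<Rightarrow> bool" where
  "in_hcone H x \<longleftrightarrow> (\<forall>r\<in>set H. 0 \<le> form r x)"

text \<open>
  Fourier--Motzkin elimination of \<open>t\<close>, where \<open>d a\<close> is the value of the form \<open>a\<close> on the generator. The
  forms with \<open>d a < 0\<close> bound \<open>t\<close> from below and those with \<open>d a > 0\<close> from above. The largest lower bound
  (or 0) works if it does not exceed any upper bound, and this is what the combinations of pairs say.
\<close>

lemma fourier_motzkin_step:
  fixes H :: "int list list"
  assumes nonneg: "\<And>a. a \<in> set H \<Longrightarrow> 0 \<le> d a \<Longrightarrow> 0 \<le> form a x"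
    and pairs: "\<And>a b. a \<in> set H \<Longrightarrow> b \<in> set H \<Longrightarrow> d a < 0 \<Longrightarrow> 0 < d b \<Longrightarrow>
      0 \<le> of_int (d b) * form a x - of_int (d a) * form b x"
  shows "\<exists>t\<ge>0. \<forall>a\<in>set H. 0 \<le> form a x - t * of_int (d a)"
proof -
  define M where "M = insert 0 ((\<lambda>a. form a x / of_int (d a)) ` {a \<in> set H. d a < 0})"
  have fin: "finite M" "M \<noteq> {}" by (simp_all add: M_def)
  have "0 \<le> form a x - Max M * of_int (d a)" if a: "a \<in> set H" for a
  proof (cases "d a < 0")
    case True
    then have "form a x / of_int (d a) \<le> Max M" using a fin by (intro Max_ge) (auto simp: M_def)
    then show ?thesis using True by (simp add: neg_divide_le_eq)
  next
    case False
    have "Max M \<in> M" using fin by (rule Max_in)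
    then consider "Max M = 0" | b where "b \<in> set H" "d b < 0" "Max M = form b x / of_int (d b)"
      by (auto simp: M_def)
    then show ?thesis
    proof cases
      case 1
      then show ?thesis using nonneg[OF a] False by simp
    next
      case 2
      show ?thesis
      proof (cases "d a = 0")
        case True
        then show ?thesis using nonneg[OF a] by simp
      next
        case nz: False
        then have "0 \<le> of_int (d a) * form b x - of_int (d b) * form a x"
          using pairs[OF 2(1) a 2(2)] False by simp
        then have "form b x / of_int (d b) * of_int (d a) \<le> form a x"
          using 2(2) by (simp add: field_simps)
        then show ?thesis using 2(3) by simp
      qed
    qed
  qed
  moreover have "0 \<le> Max M" using fin by (intro Max_ge) (auto simp: M_def)
  ultimately show ?thesis by blast
qed

text \<open>
  An insertion consists of the new generator, of the inequalities that it adds, and of a certificate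
  for each pair of forms to be combined. A certificate \<open>(m, is)\<close> claims that \<open>m\<close> times the combination is
  the sum of the forms with indices \<open>is\<close> in the new list of inequalities.
\<close>

type_synonym insertion = "generator \<times> int list list \<times> (int \<times> nat list) list"

fun insert_generator :: "int list list \<Rightarrow> insertion \<Rightarrow> int list list" where
  "insert_generator H (g, new, _) = filter (\<lambda>a. 0 \<le> dot a (gvec g)) H @ new"

fun insertion_ok :: "int list list \<Rightarrow> insertion \<Rightarrow> bool" where
  "insertion_ok H (g, new, certs) \<longleftrightarrow>
     (let H' = insert_generator H (g, new, certs);
        combs = concat (map (\<lambda>a. map (\<lambda>b. row_comb (dot b (gvec g)) a (- dot a (gvec g)) b)
          (filter (\<lambda>b. 0 < dot b (gvec g)) H)) (filter (\<lambda>a. dot a (gvec g) < 0) H))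
      in list_all (\<lambda>r. length r = 16) new \<and> length combs = length certs \<and>
        list_all (\<lambda>(r, m, is). 0 < m \<and> list_all (\<lambda>i. i < length H') is \<and>
          row_comb m r 0 r = row_sum (map ((!) H') is)) (zip combs certs))"

fun insertions_ok :: "int list list \<Rightarrow> insertion list \<Rightarrow> int list list \<Rightarrow> bool" where
  "insertions_ok H [] F \<longleftrightarrow> list_all (\<lambda>r. r \<in> set F) H"
| "insertions_ok H (s # ss) F \<longleftrightarrow> insertion_ok H s \<and> insertions_ok (insert_generator H s) ss F"

lemma insertion_ok_decompose:
  assumes H: "list_all (\<lambda>r. length r = 16) H" and ok: "insertion_ok H s"
    and x: "in_hcone (insert_generator H s) x"
  shows "\<exists>t\<ge>0. in_hcone H (\<lambda>i. x i - t * of_int (gvec (fst s) ! i))"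
proof -
  obtain g new certs where s: "s = (g, new, certs)" by (cases s)
  define d where "d a = dot a (gvec g)" for a
  let ?H = "insert_generator H s"
  have len: "length a = 16" if "a \<in> set H" for a using H that by (simp add: list_all_iff)
  have lenH': "list_all (\<lambda>r. length r = 16) ?H" using ok H by (auto simp: s list_all_iff Let_def)
  have gvec: "length (gvec g) = 16" by (simp add: gvec_def)
  have nonneg: "0 \<le> form a x" if "a \<in> set H" "0 \<le> d a" for a
    using x that by (auto simp: in_hcone_def s d_def)
  have pairs: "0 \<le> of_int (d b) * form a x - of_int (d a) * form b x"
    if ab: "a \<in> set H" "b \<in> set H" "d a < 0" "0 < d b" for a b
  proof -
    define combs where "combs = concat (map (\<lambda>a. map (\<lambda>b. row_comb (d b) a (- d a) b)
          (filter (\<lambda>b. 0 < d b) H)) (filter (\<lambda>a. d a < 0) H))"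
    let ?r = "row_comb (d b) a (- d a) b"
    have "?r \<in> set combs" using ab by (auto simp: combs_def)
    moreover have "length combs = length certs"
      and zip: "list_all (\<lambda>(r, m, is). 0 < m \<and> list_all (\<lambda>i. i < length ?H) is \<and>
          row_comb m r 0 r = row_sum (map ((!) ?H) is)) (zip combs certs)"
      using ok by (simp_all add: s Let_def combs_def d_def)
    ultimately obtain m "is" where "(?r, m, is) \<in> set (zip combs certs)"
      by (metis in_set_impl_in_set_zip1 surj_pair)
    then have m: "0 < m" and "is": "list_all (\<lambda>i. i < length ?H) is"
      and eq: "row_comb m ?r 0 ?r = row_sum (map ((!) ?H) is)"
      using zip by (auto simp: list_all_iff)
    have rows: "(!) ?H i \<in> set ?H" if "i \<in> set is" for i
      using "is" that by (auto simp: list_all_iff)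
    have "of_int m * form ?r x = form (row_sum (map ((!) ?H) is)) x"
      by (simp add: form_row_comb flip: eq)
    also have "\<dots> = (\<Sum>r\<leftarrow>map ((!) ?H) is. form r x)"
      using rows lenH' by (intro form_row_sum) (auto simp: list_all_iff)
    also have "\<dots> \<ge> 0"
      using rows x by (intro sum_list_nonneg) (auto simp: in_hcone_def)
    finally have "0 \<le> form ?r x" using m by (simp add: zero_le_mult_iff)
    then show ?thesis using ab len by (simp add: form_row_comb)
  qed
  from fourier_motzkin_step[of H d x, OF nonneg pairs]
  obtain t where "t \<ge> 0" "\<forall>a\<in>set H. 0 \<le> form a x - t * of_int (d a)" by blast
  moreover have "form a (\<lambda>i. x i - t * of_int (gvec g ! i)) = form a x - t * of_int (d a)"
    if "a \<in> set H" for a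
    using that len gvec by (simp add: form_diff form_gvec d_def)
  ultimately show ?thesis by (auto simp: s in_hcone_def)
qed

lemma insertions_ok_induct:
  assumes "list_all (\<lambda>r. length r = 16) H" "insertions_ok H ss F" "in_hcone F x"
    and base: "\<And>y. in_hcone H y \<Longrightarrow> Q y"
    and step: "\<And>g t y. g \<in> fst ` set ss \<Longrightarrow> 0 \<le> t \<Longrightarrow> Q (\<lambda>i. y i - t * of_int (gvec g ! i)) \<Longrightarrow> Q y"
  shows "Q x"
  using assms
proof (induction ss arbitrary: H)
  case Nil
  then show ?case by (auto simp: in_hcone_def list_all_iff)
next
  case (Cons s ss)
  have H': "list_all (\<lambda>r. length r = 16) (insert_generator H s)"
    using Cons.prems(1,2) by (cases s) (auto simp: list_all_iff Let_def)
  show ?case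
  proof (rule Cons.IH[OF H'])
    fix y assume "in_hcone (insert_generator H s) y"
    then obtain t where t: "t \<ge> 0" "in_hcone H (\<lambda>i. y i - t * of_int (gvec (fst s) ! i))"
      using insertion_ok_decompose Cons.prems(1,2) by fastforce
    from Cons.prems(4)[OF t(2)] show "Q y"
      using Cons.prems(5)[of "fst s" t y] t(1) by simp
  next
    show "Q y" if "g \<in> fst ` set ss" "0 \<le> t" "Q (\<lambda>i. y i - t * of_int (gvec g ! i))" for g t y
      using that Cons.prems(5)[of g t y] by simp
  qed (use Cons.prems in auto)
qed

text \<open>
  The forms are the coordinates with respect to the basis given by the generators. Multiplying the
  two matrices gives the identity in either order, and the order checked here is the one that
  expands a point in the generators.
\<close>

definition dual_bases :: "(int list \<times> generator) list \<Rightarrow> bool" where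
  "dual_bases B \<longleftrightarrow> list_all (\<lambda>(d, g). length d = 16) B \<and>
     list_all (\<lambda>j. list_all (\<lambda>l. (\<Sum>(d, g)\<leftarrow>B. d ! j * gvec g ! l) = (if j = l then 1 else 0)) [0..<16]) [0..<16]"

lemma form_eq_sum: "form a x = (\<Sum>j<length a. of_int (a ! j) * x j)"
  by (induction a arbitrary: x) (simp_all add: sum.lessThan_Suc_shift del: sum.lessThan_Suc)

lemma dual_bases_expand:
  assumes B: "dual_bases B" and l: "l < 16"
  shows "x l = (\<Sum>(d, g)\<leftarrow>B. form d x * of_int (gvec g ! l))"
proof -
  have len: "length d = 16" if "(d, g) \<in> set B" for d g
    using B that by (auto simp: dual_bases_def list_all_iff)
  have swap: "(\<Sum>(d, g)\<leftarrow>C. form d x * of_int (gvec g ! l)) =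
      (\<Sum>j<16. x j * of_int (\<Sum>(d, g)\<leftarrow>C. d ! j * gvec g ! l))"
    if "set C \<subseteq> set B" for C
    using that
  proof (induction C)
    case (Cons c C)
    obtain d g where c: "c = (d, g)" by (cases c)
    then have "length d = 16" using Cons.prems len[of d g] by auto
    then show ?case
      using Cons by (simp add: c form_eq_sum sum_distrib_left distrib_left sum.distrib mult_ac)
  qed simp
  have "of_int (\<Sum>(d, g)\<leftarrow>B. d ! j * gvec g ! l) = (if j = l then 1 else 0 :: rat)" if "j < 16" for j
  proof -
    have "j \<in> set [0..<16]" "l \<in> set [0..<16]" using that l by auto
    then have "(\<Sum>(d, g)\<leftarrow>B. d ! j * gvec g ! l) = (if j = l then 1 else 0)"
      using B unfolding dual_bases_def list_all_iff by blast
    then show ?thesis by simp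
  qed
  then have "(\<Sum>j<16. x j * of_int (\<Sum>(d, g)\<leftarrow>B. d ! j * gvec g ! l)) = (\<Sum>j<16. if j = l then x j else 0)"
    by (intro sum.cong) auto
  then show ?thesis using swap[of B] l by simp
qed

lemma dual_bases_induct:
  assumes B: "dual_bases B" and x: "in_hcone (map fst B) x"
    and base: "\<And>y. (\<And>l. l < 16 \<Longrightarrow> y l = 0) \<Longrightarrow> Q y"
    and step: "\<And>g t y. g \<in> snd ` set B \<Longrightarrow> 0 \<le> t \<Longrightarrow> Q (\<lambda>i. y i - t * of_int (gvec g ! i)) \<Longrightarrow> Q y"
  shows "Q x"
proof -
  have "Q y" if "set C \<subseteq> set B" "\<And>l. l < 16 \<Longrightarrow> y l = (\<Sum>(d, g)\<leftarrow>C. form d x * of_int (gvec g ! l))" for C y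
    using that
  proof (induction C arbitrary: y)
    case Nil
    then show ?case by (intro base) simp
  next
    case (Cons c C)
    obtain d g where c: "c = (d, g)" by (cases c)
    have "Q (\<lambda>i. y i - form d x * of_int (gvec g ! i))"
      using Cons.prems by (intro Cons.IH) (auto simp: c)
    then show ?case
      using x Cons.prems(1) by (intro step[of g "form d x" y]) (force simp: c in_hcone_def)+
  qed
  from this[of B x] dual_bases_expand[OF B] show ?thesis by blast
qed

section \<open>The inequalities of the cone\<close>

text \<open>
  The inequalities of the theorem, each written as a form that is nonnegative on the cone: first
  those of single coordinates, then the other 70.
\<close>

definition coordinate_rows :: "int list list" where
  "coordinate_rows =
    [
    [0, 0, 0, 0, 1, 0, 0, 0, 0, 0, 0, 0, 0, 0, 0, 0],
    [0, 0, 0, 0, 0, 1, 0, 0, 0, 0, 0, 0, 0, 0, 0, 0],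
    [0, 0, 0, 0, 0, 0, 1, 0, 0, 0, 0, 0, 0, 0, 0, 0],
    [0, 0, 0, 0, 0, 0, 0, 1, 0, 0, 0, 0, 0, 0, 0, 0],
    [0, 0, 0, 0, 0, 0, 0, 0, 1, 0, 0, 0, 0, 0, 0, 0],
    [0, 0, 0, 0, 0, 0, 0, 0, 0, 1, 0, 0, 0, 0, 0, 0],
    [0, 0, 0, 0, 0, 0, 0, 0, 0, 0, 1, 0, 0, 0, 0, 0],
    [0, 0, 0, 0, 0, 0, 0, 0, 0, 0, 0, 1, 0, 0, 0, 0],
    [0, 0, 0, 0, 0, 0, 0, 0, 0, 0, 0, 0, 1, 0, 0, 0],
    [0, 0, 0, 0, 0, 0, 0, 0, 0, 0, 0, 0, 0, 1, 0, 0],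
    [0, 0, 0, 0, 0, 0, 0, 0, 0, 0, 0, 0, 0, 0, 1, 0],
    [0, 0, 0, 0, 0, 0, 0, 0, 0, 0, 0, 0, 0, 0, 0, 1]]"

definition inequality_rows :: "int list list" where
  "inequality_rows =
    [
    [1, 0, 0, 0, 0, 0, 0, 0, 0, 0, 0, 0, 0, 0, 0, -1],
    [0, 1, 0, 0, 0, 0, 0, 0, 0, 0, 0, 0, 0, 0, -1, 0],
    [0, 0, 1, 0, 0, 0, 0, 0, 0, 0, 0, 0, -1, 0, 0, 0],
    [0, 0, 0, 1, 0, 0, 0, -1, 0, 0, 0, 0, 0, 0, 0, 0],
    [1, 1, 0, 0, 0, 0, 0, 0, 0, 0, -1, 0, 0, 0, -1, -1],
    [1, 1, 1, 0, 0, 0, 0, 0, 0, 0, -1, -1, -1, -1, 0, -1],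
    [1, 1, 1, 0, 0, 0, 0, 0, 0, 0, -1, 0, -1, -1, -1, -1],
    [0, 1, 1, 0, 0, 0, 0, 0, 0, 0, 0, 0, -1, -1, -1, 0],
    [1, 1, 0, 1, 0, 0, 0, -1, -1, -1, -1, 0, 0, 0, 0, -1],
    [1, 1, 0, 1, 0, 0, 0, -1, -1, 0, -1, 0, 0, 0, -1, -1],
    [0, 1, 0, 1, 0, 0, 0, -1, -1, 0, 0, 0, 0, 0, -1, 0],
    [0, 1, 1, 1, 0, -1, 0, -1, -1, 0, 0, 0, -1, -1, 0, 0],
    [0, 1, 1, 1, 0, 0, 0, -1, -1, 0, 0, 0, -1, -1, -1, 0],
    [1, 1, 1, 1, 0, 0, -1, -1, -1, -1, -1, 0, -1, 0, 0, -1],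
    [1, 1, 1, 1, 0, -1, -1, -1, -1, 0, -1, 0, -1, 0, 0, -1],
    [1, 1, 1, 1, 0, -1, -1, -1, 0, 0, -1, -1, -1, 0, 0, -1],
    [1, 1, 1, 1, 0, -1, 0, -1, 0, 0, -1, -1, -1, -1, 0, -1],
    [1, 1, 1, 1, 0, 0, 0, -1, -1, 0, -1, 0, -1, -1, -1, -1],
    [1, 1, 1, 1, 0, -1, 0, -1, -1, 0, -1, 0, -1, -1, 0, -1],
    [1, 2, 1, 1, -1, 0, -1, -1, -1, -1, -1, -1, -1, 0, -1, 0],
    [1, 2, 1, 1, -1, -1, -1, -1, -1, 0, -1, -1, -1, 0, -1, 0],
    [1, 2, 1, 1, 0, 0, -1, -1, -1, -1, -1, -1, -1, 0, -1, -1],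
    [1, 2, 1, 1, 0, -1, -1, -1, -1, 0, -1, -1, -1, 0, -1, -1],
    [1, 2, 1, 1, -1, -1, 0, -1, -1, 0, -1, -1, -1, -1, -1, 0],
    [1, 2, 1, 1, 0, -1, 0, -1, -1, 0, -1, -1, -1, -1, -1, -1],
    [1, 2, 1, 1, -1, 0, 0, -1, -1, -1, -1, -1, -1, -1, -1, 0],
    [1, 2, 1, 1, 0, 0, 0, -1, -1, -1, -1, -1, -1, -1, -1, -1],
    [1, 2, 2, 1, 0, -1, -1, -1, -1, 0, -1, -1, -2, -1, -1, -1],
    [1, 2, 2, 1, 0, 0, -1, -1, -1, -1, -1, -1, -2, -1, -1, -1],
    [1, 2, 2, 1, -1, -1, -1, -1, -1, 0, -1, -1, -2, -1, -1, 0],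
    [1, 2, 2, 1, -1, 0, -1, -1, -1, -1, -1, -1, -2, -1, -1, 0],
    [1, 2, 2, 1, 0, -1, 0, -1, -1, 0, -1, -1, -2, -2, -1, -1],
    [1, 2, 1, 2, 0, -1, -1, -2, -1, -1, -1, -1, -1, 0, -1, -1],
    [1, 2, 1, 2, 0, -1, 0, -2, -1, -1, -1, -1, -1, -1, -1, -1],
    [1, 2, 1, 2, -1, -1, -1, -2, -1, -1, -1, -1, -1, 0, -1, 0],
    [1, 2, 1, 2, -1, -1, 0, -2, -1, -1, -1, -1, -1, -1, -1, 0],
    [1, 2, 1, 2, 0, -1, -1, -2, -2, -1, -1, 0, -1, 0, -1, -1],
    [1, 2, 1, 2, 0, -1, 0, -2, -2, -1, -1, 0, -1, -1, -1, -1],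
    [2, 2, 1, 1, 0, 0, -1, -1, -1, -1, -2, -1, -1, 0, -1, -2],
    [2, 2, 1, 1, 0, 0, 0, -1, -1, -1, -2, -1, -1, -1, -1, -2],
    [2, 2, 1, 1, 0, -1, -1, -1, -1, 0, -2, -1, -1, 0, -1, -2],
    [2, 2, 1, 1, 0, -1, 0, -1, -1, 0, -2, -1, -1, -1, -1, -2],
    [1, 2, 2, 2, -1, -1, -1, -2, -1, -1, -1, -1, -2, -1, -1, 0],
    [1, 2, 2, 2, 0, -1, -1, -2, -1, -1, -1, -1, -2, -1, -1, -1],
    [1, 2, 2, 2, 0, -1, -1, -2, -2, -1, -1, 0, -2, -1, -1, -1],
    [2, 2, 1, 2, 0, -1, -1, -2, -1, -1, -2, -1, -1, 0, -1, -2],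
    [2, 2, 1, 2, 0, -1, 0, -2, -1, -1, -2, -1, -1, -1, -1, -2],
    [2, 2, 1, 2, 0, -1, -1, -2, -2, -1, -2, 0, -1, 0, -1, -2],
    [2, 2, 1, 2, 0, -1, 0, -2, -2, -1, -2, 0, -1, -1, -1, -2],
    [2, 2, 2, 1, 0, -1, -1, -1, -1, 0, -2, -1, -2, -1, -1, -2],
    [2, 2, 2, 1, 0, 0, -1, -1, -1, -1, -2, -1, -2, -1, -1, -2],
    [2, 2, 2, 1, 0, -1, 0, -1, -1, 0, -2, -1, -2, -2, -1, -2],
    [2, 2, 2, 2, 0, -1, -1, -2, -1, -1, -2, -1, -2, -1, -1, -2],
    [2, 2, 2, 2, 0, -1, -1, -2, -2, -1, -2, 0, -2, -1, -1, -2],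
    [1, 3, 1, 2, 0, -1, -1, -2, -2, -1, -1, -1, -1, 0, -2, -1],
    [1, 3, 1, 2, 0, -1, 0, -2, -2, -1, -1, -1, -1, -1, -2, -1],
    [1, 3, 1, 2, -1, -1, -1, -2, -2, -1, -1, -1, -1, 0, -2, 0],
    [1, 3, 1, 2, -1, -1, 0, -2, -2, -1, -1, -1, -1, -1, -2, 0],
    [1, 3, 2, 2, -1, -1, 0, -2, -2, -1, -1, -1, -2, -2, -2, 0],
    [1, 3, 2, 2, 0, -1, 0, -2, -2, -1, -1, -1, -2, -2, -2, -1],
    [2, 3, 1, 2, -1, -1, 0, -2, -2, -1, -2, -1, -1, -1, -2, -1],
    [2, 3, 1, 2, -1, -1, -1, -2, -2, -1, -2, -1, -1, 0, -2, -1],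
    [2, 3, 2, 2, -1, -1, 0, -2, -2, -1, -2, -1, -2, -2, -2, -1],
    [1, 3, 3, 2, 0, -1, -1, -2, -2, -1, -1, -1, -3, -2, -2, -1],
    [1, 3, 3, 2, -1, -1, -1, -2, -2, -1, -1, -1, -3, -2, -2, 0],
    [3, 3, 1, 2, 0, -1, -1, -2, -2, -1, -3, -1, -1, 0, -2, -3],
    [3, 3, 1, 2, 0, -1, 0, -2, -2, -1, -3, -1, -1, -1, -2, -3],
    [3, 3, 3, 2, 0, -1, -1, -2, -2, -1, -3, -1, -3, -2, -2, -3],
    [2, 3, 3, 2, -1, -1, -1, -2, -2, -1, -2, -1, -3, -2, -2, -1],
    [3, 3, 2, 2, 0, -1, 0, -2, -2, -1, -3, -1, -2, -2, -2, -3]]"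

text \<open>
  Sixteen generators that form a basis, together with the dual basis. The order of insertion, here and
  below, keeps the number of pairs small: there are 181 of them.
\<close>

definition first_simplex :: "(int list \<times> nat \<times> nat list) list" where
  "first_simplex =
    [
    ([0, 0, 0, 0, 0, 0, 0, 0, 0, 0, 0, 0, 0, 1, 0, 0], (2, [10])),
    ([1, 0, 0, 0, 0, 0, 0, 0, 0, 0, -1, 0, 0, 0, 0, -1], (1, [])),
    ([0, 0, 0, 0, 0, 0, 0, 0, 0, 0, 0, 0, 1, 0, 0, 0], (3, [9])),
    ([0, 2, 0, 1, -1, -1, -1, -1, -2, -1, 0, -2, 0, -2, -1, 1], (2, [2])),
    ([0, 0, 0, 0, 0, 0, 0, 0, 0, 0, 0, 1, 0, 0, 0, 0], (2, [8])),
    ([0, -2, 0, -1, 1, 2, 1, 1, 2, 1, 0, 2, 0, 2, 1, -1], (2, [1, 2])),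
    ([0, 0, 0, 0, 0, 0, 0, 0, 0, 1, 0, 0, 0, 0, 0, 0], (2, [1, 6])),
    ([0, 0, 1, 0, 0, 0, 0, 0, 0, 0, 0, 0, -1, 0, 0, 0], (3, [])),
    ([0, 0, 0, 1, 0, 0, 0, -1, 0, 0, 0, 0, 0, 0, 0, 0], (4, [1])),
    ([0, 0, 0, 0, 0, 0, 0, 0, 0, 0, 0, 0, 0, 0, 1, 0], (2, [1, 11])),
    ([0, 1, 0, 0, 0, -1, -1, 0, -1, -1, 0, -1, 0, -1, -1, 0], (2, [1, 1])),
    ([0, 0, 0, 0, 0, 0, 1, 0, 0, 0, 0, 0, 0, 0, 0, 0], (2, [1, 3])),
    ([0, 0, 0, 0, 0, 0, 0, 0, 1, 0, 0, 0, 0, 0, 0, 0], (2, [5])),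
    ([0, 0, 0, 0, 0, 0, 0, 0, 0, 0, 1, 0, 0, 0, 0, 0], (1, [7])),
    ([0, 0, 0, 0, 0, 0, 0, 0, 0, 0, 0, 0, 0, 0, 0, 1], (1, [1, 12])),
    ([0, 0, 0, 0, 0, 0, 0, 1, 0, 0, 0, 0, 0, 0, 0, 0], (4, [4]))]"

definition insertions :: "insertion list" where
  "insertions =
    [((2, [1, 10]),
     [[0, 2, 0, 1, -1, -1, -1, -1, -2, -1, 0, -2, 0, -1, -1, 1],
      [0, 0, 0, 0, 0, 1, 0, 0, 0, 0, 0, 0, 0, 0, 0, 0]],
     [(1, [15]), (1, [16])]),
     ((2, [1, 8]),
     [[0, 2, 0, 1, -1, -1, -1, -1, -2, -1, 0, -1, 0, -1, -1, 1]],
     [(1, [16]), (1, [0, 15])]),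
     ((2, []),
     [[0, 0, 0, -1, 1, 0, -1, 1, 0, -1, 0, 0, 0, 0, -1, -1]],
     [(1, [16]), (1, [0, 0, 3, 3, 14, 14])]),
     ((1, [1]),
     [[1, 2, 0, 1, -1, -1, -1, -1, -2, -1, -1, -1, 0, -1, -1, 0]],
     [(1, [16]), (1, [0, 3, 8, 8, 14])]),
     ((2, [6]),
     [[0, 0, 0, -1, 1, 0, -1, 1, 0, 0, 0, 0, 0, 0, -1, -1]],
     [(1, [16]), (1, [0, 1, 3, 8, 8, 14])]),
     ((4, []),
     [[0, 0, 0, 0, 1, 0, -1, 0, 0, 0, 0, 0, 0, 0, -1, -1]],
     [(1, [16]), (1, [0, 1, 3, 4, 8, 8, 14])]),
     ((1, [8]),
     [[1, 1, 0, 0, 0, -1, -1, 0, -1, -1, -1, -1, 0, -1, -1, -1],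
      [0, 1, 0, 0, 0, -1, -1, 0, -1, -1, 0, 0, 0, -1, -1, 0]],
     [(1, [16]), (1, [17])]),
     ((3, [1]),
     [[1, 2, 1, 1, -1, -1, -1, -1, -2, -1, -1, -1, -1, -1, -1, 0]],
     [(1, [17]), (1, [0, 4, 6, 13, 15, 16])]),
     ((2, [3]),
     [[0, 0, 0, 0, 1, 0, 0, 0, 0, 0, 0, 0, 0, 0, -1, -1]],
     [(1, [17]), (1, [0, 4, 5, 6, 13, 14, 15])]),
     ((1, [6]),
     [[0, 1, 0, 0, 0, -1, -1, 0, -1, 0, 0, 0, 0, -1, -1, 0]],
     [(1, [14, 3]), (1, [17])]),
     ((2, [11]),
     [[0, 0, 0, 0, 1, 0, 0, 0, 0, 0, 0, 0, 0, 0, 0, -1]],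
     [(1, [17]), (1, [16, 14, 0, 5, 6, 8, 13])]),
     ((2, [6, 10]),
     [[1, 1, 0, 0, 0, -1, -1, 0, -1, -1, -1, -1, 0, 0, -1, -1],
      [1, 1, 0, 0, 0, -1, -1, 0, -1, 0, -1, -1, 0, -1, -1, -1]],
     [(1, [17]), (1, [18])]),
     ((2, [1, 5]),
     [[1, 2, 1, 1, -1, -1, -1, -1, -1, -1, -1, -1, -1, -1, -1, 0]],
     [(1, [18]), (1, [14, 16, 5, 6, 7, 8, 13])]),
     ((1, [3]),
     [[0, 1, 0, 0, 0, -1, 0, 0, -1, 0, 0, 0, 0, -1, -1, 0]],
     [(1, [16, 3]), (1, [18])]),
     ((2, [6, 11]),
     [[1, 1, 0, 0, 0, -1, -1, 0, -1, -1, -1, -1, 0, 0, 0, -1]],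
     [(1, [15, 0]), (1, [18])]),
     ((2, [3, 11]),
     [[1, 1, 0, 0, 0, -1, -1, 0, -1, 0, -1, -1, 0, -1, 0, -1],
      [1, 1, 0, 0, 0, -1, 0, 0, -1, 0, -1, -1, 0, -1, -1, -1]],
     [(1, [18]), (1, [19])]),
     ((2, [2, 6]),
     [[1, 1, 0, 0, 0, 0, -1, 0, -1, -1, -1, -1, 0, 0, 0, -1]],
     [(1, [17, 0]), (1, [19])]),
     ((2, [1]),
     [],
     []),
     ((4, [6]),
     [[1, 1, 0, 1, 0, 0, -1, -1, -1, -1, -1, -1, 0, 0, 0, -1]],
     [(1, [17, 0, 13]), (1, [19])]),
     ((2, [8, 11]),
     [],
     [(1, [16, 1]), (1, [17, 8])]),
     ((4, [3]),
     [[1, 1, 0, 1, 0, -1, -1, -1, -1, 0, -1, -1, 0, -1, 0, -1],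
      [1, 1, 0, 0, 0, -1, 0, 0, -1, 0, -1, -1, 0, -1, 0, -1]],
     [(1, [18]), (1, [19])]),
     ((2, [3, 10]),
     [[1, 1, 0, 1, 0, -1, -1, -1, -1, 0, -1, -1, 0, 0, 0, -1]],
     [(1, [19]), (1, [18, 6])]),
     ((2, [6, 8]),
     [[1, 1, 0, 1, 0, 0, -1, -1, -1, -1, -1, 0, 0, 0, 0, -1],
      [1, 2, 0, 1, 0, -1, -1, -1, -2, -1, -1, -1, 0, -1, -1, -1]],
     [(1, [19]), (1, [18, 13]), (1, [20])]),
     ((3, [8]),
     [[1, 1, 1, 0, 0, -1, 0, 0, -1, 0, -1, -1, -1, -1, 0, -1],
      [1, 1, 0, 1, 0, -1, -1, -1, -1, 0, -1, 0, 0, 0, 0, -1],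
      [1, 1, 1, 1, 0, -1, -1, -1, -1, 0, -1, -1, -1, 0, 0, -1],
      [1, 2, 1, 1, 0, -1, -1, -1, -2, -1, -1, -1, -1, -1, -1, -1]],
     [(1, [16, 1, 7]), (1, [18]), (1, [19]), (1, [20]), (1, [17, 16]), (1, [21])]),
     ((3, [2]),
     [[0, 1, 1, 0, 0, -1, 0, 0, -1, 0, 0, 0, -1, -1, -1, 0],
      [0, 1, 0, 0, 0, 0, 0, 0, -1, 0, 0, 0, 0, -1, -1, 0]],
     [(1, [20]), (1, [21]), (1, [18, 3]), (1, [16, 4])]),
     ((3, [10]),
     [[0, 1, 0, 0, 0, 0, 0, 0, -1, 0, 0, 0, 0, 0, -1, 0]],
     [(1, [21]), (1, [20, 13]), (1, [19, 4])]),
     ((2, [2, 11]),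
     [[0, 1, 1, 0, 0, -1, 0, 0, -1, 0, 0, 0, -1, -1, 0, 0],
      [0, 1, 1, 0, 0, 0, 0, 0, -1, 0, 0, 0, -1, -1, -1, 0]],
     [(1, [21]), (1, [22]), (1, [19, 3])]),
     ((2, [5, 8]),
     [[1, 1, 1, 0, 0, -1, 0, 0, 0, 0, -1, -1, -1, -1, 0, -1],
      [1, 1, 1, 1, 0, -1, -1, -1, -1, 0, -1, 0, -1, 0, 0, -1],
      [1, 1, 1, 1, 0, -1, -1, -1, 0, 0, -1, -1, -1, 0, 0, -1],
      [1, 2, 1, 1, 0, -1, -1, -1, -2, -1, -1, 0, -1, -1, -1, -1]],
     [(1, [18, 1]), (1, [20]), (1, [21]), (1, [22]), (1, [23]), (1, [14, 15])]),
     ((4, [2]),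
     [[0, 1, 1, 1, 0, -1, 0, -1, -1, 0, 0, 0, -1, -1, 0, 0],
      [1, 1, 1, 1, 0, -1, 0, -1, 0, 0, -1, -1, -1, -1, 0, -1],
      [1, 1, 1, 0, 0, 0, 0, 0, 0, 0, -1, -1, -1, -1, 0, -1]],
     [(1, [22]), (1, [18, 7]), (1, [21, 7]), (1, [23]), (1, [24]), (1, [14, 15, 7, 1])]),
     ((3, [3]),
     [[1, 1, 1, 1, 0, 0, -1, -1, -1, -1, -1, 0, -1, 0, 0, -1],
      [1, 1, 0, 1, 0, 0, 0, -1, -1, -1, -1, 0, 0, 0, 0, -1]],
     [(1, [24]), (1, [25]), (1, [20, 13]), (1, [20, 7, 6]), (1, [14, 15, 7, 1, 6]),
      (1, [14, 15, 1, 7, 13])]),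
     ((4, [5]),
     [[0, 1, 0, 1, 0, 0, 0, -1, -1, 0, 0, 0, 0, 0, -1, 0],
      [0, 1, 0, 0, 0, 0, 0, 0, 0, 0, 0, 0, 0, 0, -1, 0],
      [0, 1, 1, 1, 0, 0, 0, -1, -1, 0, 0, 0, -1, -1, -1, 0],
      [0, 1, 1, 0, 0, 0, 0, 0, 0, 0, 0, 0, -1, -1, -1, 0],
      [1, 2, 2, 1, 0, -1, 0, -1, -1, 0, -1, -1, -2, -2, -1, -1],
      [1, 2, 1, 2, 0, -1, -1, -2, -2, -1, -1, 0, -1, -1, -1, -1]],
     [(1, [23]), (1, [24]), (1, [14, 15, 4, 0]), (1, [14, 15, 4, 8]), (1, [25]), (1, [26]),
      (1, [14, 15, 4, 5]), (1, [27]), (1, [28]), (1, [14, 15, 3]), (1, [16, 14, 15]),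
      (1, [18, 14, 15, 1])]),
     ((2, [1, 7]),
     [[1, 0, 0, 0, 0, 0, 0, 0, 0, 0, 0, 0, 0, 0, 0, -1],
      [1, 0, 0, 0, 1, 0, 0, 0, 0, 0, -1, 0, 0, 0, 0, -2],
      [1, 1, 1, 1, 0, -1, 0, -1, -1, 0, -1, 0, -1, -1, 0, -1],
      [1, 1, 0, 1, 0, 0, 0, -1, -1, 0, -1, 0, 0, 0, -1, -1],
      [1, 1, 0, 0, 0, 0, 0, 0, 0, 0, -1, 0, 0, 0, -1, -1],
      [1, 1, 1, 1, 0, 0, 0, -1, -1, 0, -1, 0, -1, -1, -1, -1],
      [1, 1, 1, 0, 0, 0, 0, 0, 0, 0, -1, 0, -1, -1, -1, -1],
      [2, 2, 2, 1, 0, -1, 0, -1, -1, 0, -2, -1, -2, -2, -1, -2],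
      [2, 2, 1, 2, 0, -1, -1, -2, -2, -1, -2, 0, -1, -1, -1, -2]],
     [(1, [28]), (1, [29]), (1, [30]), (1, [31]), (1, [32]), (1, [33]), (1, [34]), (1, [35]),
      (1, [36])]),
     ((2, [7]),
     [[2, 2, 1, 1, 0, -1, -1, -1, -1, -1, -2, -1, -1, -1, -1, -2]],
     [(1, [13, 28]), (1, [36]), (1, [29, 13]), (1, [30, 13]), (1, [31, 13]), (1, [32, 13]),
      (1, [33, 13]), (1, [34, 13]), (1, [35, 13])]),
     ((3, [3, 10]),
     [[1, 2, 1, 1, -1, -1, -1, -1, -1, -1, -1, -1, -1, 0, -1, 0],
      [1, 2, 2, 1, -1, -1, -1, -1, -1, -1, -1, -1, -2, -1, -1, 0],
      [1, 2, 1, 1, -1, -1, 0, -1, -1, -1, -1, -1, -1, -1, -1, 0],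
      [1, 2, 1, 2, 0, -1, -1, -2, -2, -1, -1, 0, -1, 0, -1, -1],
      [1, 2, 2, 2, 0, -1, -1, -2, -2, -1, -1, 0, -2, -1, -1, -1],
      [1, 2, 1, 2, 0, -1, 0, -2, -2, -1, -1, 0, -1, -1, -1, -1],
      [2, 2, 1, 2, 0, -1, -1, -2, -2, -1, -2, 0, -1, 0, -1, -2],
      [2, 2, 2, 2, 0, -1, -1, -2, -2, -1, -2, 0, -2, -1, -1, -2],
      [2, 2, 1, 2, 0, -1, 0, -2, -2, -1, -2, 0, -1, -1, -1, -2],
      [2, 2, 1, 1, 0, -1, -1, -1, -1, -1, -2, -1, -1, 0, -1, -2],
      [2, 2, 2, 1, 0, -1, -1, -1, -1, -1, -2, -1, -2, -1, -1, -2],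
      [2, 2, 1, 1, 0, -1, 0, -1, -1, -1, -2, -1, -1, -1, -1, -2]],
     [(1, [33]), (1, [34]), (1, [35]), (1, [36]), (1, [37]), (1, [38]), (1, [39]), (1, [40]),
      (1, [41]), (1, [42]), (1, [43]), (1, [44])]),
     ((4, [2, 6]),
     [[1, 2, 1, 1, -1, -1, -1, -1, -1, 0, -1, -1, -1, 0, -1, 0],
      [1, 2, 1, 2, -1, -1, -1, -2, -1, -1, -1, -1, -1, 0, -1, 0],
      [1, 2, 1, 1, -1, 0, -1, -1, -1, -1, -1, -1, -1, 0, -1, 0],
      [1, 3, 1, 2, -1, -1, -1, -2, -2, -1, -1, -1, -1, 0, -2, 0],
      [2, 3, 1, 2, -1, -1, -1, -2, -2, -1, -2, -1, -1, 0, -2, -1],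
      [1, 2, 2, 1, -1, -1, -1, -1, -1, 0, -1, -1, -2, -1, -1, 0],
      [1, 2, 2, 2, -1, -1, -1, -2, -1, -1, -1, -1, -2, -1, -1, 0],
      [1, 2, 2, 1, -1, 0, -1, -1, -1, -1, -1, -1, -2, -1, -1, 0],
      [1, 3, 3, 2, -1, -1, -1, -2, -2, -1, -1, -1, -3, -2, -2, 0],
      [2, 3, 3, 2, -1, -1, -1, -2, -2, -1, -2, -1, -3, -2, -2, -1],
      [1, 2, 1, 1, -1, -1, 0, -1, -1, 0, -1, -1, -1, -1, -1, 0],
      [1, 2, 1, 2, -1, -1, 0, -2, -1, -1, -1, -1, -1, -1, -1, 0],
      [1, 2, 1, 1, -1, 0, 0, -1, -1, -1, -1, -1, -1, -1, -1, 0],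
      [1, 3, 1, 2, -1, -1, 0, -2, -2, -1, -1, -1, -1, -1, -2, 0],
      [1, 3, 2, 2, -1, -1, 0, -2, -2, -1, -1, -1, -2, -2, -2, 0],
      [2, 3, 1, 2, -1, -1, 0, -2, -2, -1, -2, -1, -1, -1, -2, -1],
      [2, 3, 2, 2, -1, -1, 0, -2, -2, -1, -2, -1, -2, -2, -2, -1],
      [2, 2, 1, 1, 0, -1, -1, -1, -1, 0, -2, -1, -1, 0, -1, -2],
      [2, 2, 1, 2, 0, -1, -1, -2, -1, -1, -2, -1, -1, 0, -1, -2],
      [2, 2, 1, 1, 0, 0, -1, -1, -1, -1, -2, -1, -1, 0, -1, -2],
      [3, 3, 1, 2, 0, -1, -1, -2, -2, -1, -3, -1, -1, 0, -2, -3],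
      [2, 2, 2, 1, 0, -1, -1, -1, -1, 0, -2, -1, -2, -1, -1, -2],
      [2, 2, 2, 2, 0, -1, -1, -2, -1, -1, -2, -1, -2, -1, -1, -2],
      [2, 2, 2, 1, 0, 0, -1, -1, -1, -1, -2, -1, -2, -1, -1, -2],
      [3, 3, 3, 2, 0, -1, -1, -2, -2, -1, -3, -1, -3, -2, -2, -3],
      [2, 2, 1, 1, 0, -1, 0, -1, -1, 0, -2, -1, -1, -1, -1, -2],
      [2, 2, 1, 2, 0, -1, 0, -2, -1, -1, -2, -1, -1, -1, -1, -2],
      [2, 2, 1, 1, 0, 0, 0, -1, -1, -1, -2, -1, -1, -1, -1, -2],
      [3, 3, 1, 2, 0, -1, 0, -2, -2, -1, -3, -1, -1, -1, -2, -3],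
      [3, 3, 2, 2, 0, -1, 0, -2, -2, -1, -3, -1, -2, -2, -2, -3]],
     [(1, [39]), (1, [40]), (1, [41]), (1, [42]), (2, [47, 42]), (1, [43]), (2, [48, 43]),
      (1, [44]), (1, [45]), (1, [46]), (2, [47, 42]), (1, [47]), (2, [48, 43]), (1, [48]),
      (1, [49]), (1, [50]), (1, [51]), (1, [52]), (1, [53]), (1, [54]), (1, [55]), (1, [56]),
      (1, [57]), (1, [58]), (1, [43, 13]), (2, [63, 42, 13]), (1, [59]), (2, [63, 59]), (1, [60]),
      (1, [61]), (1, [62]), (2, [63, 42, 13]), (1, [48, 13]), (2, [63, 59]), (1, [63]), (1, [64]),
      (1, [65]), (1, [66]), (1, [54, 13]), (1, [55, 13]), (1, [67]), (1, [68])]),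
     ((1, [12]),
     [[0, 0, 0, 0, 1, 0, 0, 0, 0, 0, 0, 0, 0, 0, 0, 0],
      [1, 2, 1, 1, 0, -1, -1, -1, -1, 0, -1, -1, -1, 0, -1, -1],
      [1, 2, 1, 2, 0, -1, -1, -2, -1, -1, -1, -1, -1, 0, -1, -1],
      [1, 2, 1, 1, 0, 0, -1, -1, -1, -1, -1, -1, -1, 0, -1, -1],
      [1, 3, 1, 2, 0, -1, -1, -2, -2, -1, -1, -1, -1, 0, -2, -1],
      [1, 2, 2, 1, 0, -1, -1, -1, -1, 0, -1, -1, -2, -1, -1, -1],
      [1, 2, 2, 2, 0, -1, -1, -2, -1, -1, -1, -1, -2, -1, -1, -1],
      [1, 2, 2, 1, 0, 0, -1, -1, -1, -1, -1, -1, -2, -1, -1, -1],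
      [1, 3, 3, 2, 0, -1, -1, -2, -2, -1, -1, -1, -3, -2, -2, -1],
      [1, 2, 1, 1, 0, -1, 0, -1, -1, 0, -1, -1, -1, -1, -1, -1],
      [1, 2, 1, 2, 0, -1, 0, -2, -1, -1, -1, -1, -1, -1, -1, -1],
      [1, 2, 1, 1, 0, 0, 0, -1, -1, -1, -1, -1, -1, -1, -1, -1],
      [1, 3, 1, 2, 0, -1, 0, -2, -2, -1, -1, -1, -1, -1, -2, -1],
      [1, 3, 2, 2, 0, -1, 0, -2, -2, -1, -1, -1, -2, -2, -2, -1]],
     [(1, [68]), (1, [69]), (1, [70]), (1, [71]), (1, [72]), (2, [58, 72]), (1, [73]), (1, [74]),
      (1, [75]), (1, [76]), (2, [62, 76]), (1, [77]), (1, [78]), (1, [79]), (1, [80]), (1, [81]),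
      (2, [66, 80]), (2, [67, 81])])]"

definition generators :: "generator list" where
  "generators = map (Pair 1) words1 @ map (Pair 2) words2 @ map (Pair 3) words3 @ map (Pair 4) words4"

lemma dual_bases_first_simplex: "dual_bases first_simplex"
  by code_simp

lemma insertions_ok_insertions:
  "insertions_ok (map fst first_simplex) insertions (coordinate_rows @ inequality_rows)"
  by code_simp

lemma facet_rows_valid:
  "list_all (\<lambda>r. length r = 16 \<and> list_all (\<lambda>g. 0 \<le> dot r (gvec g)) generators)
     (coordinate_rows @ inequality_rows)"
  by code_simp

lemma generators_used:
  "list_all (\<lambda>(d, g). g \<in> set generators) first_simplex"
  "list_all (\<lambda>(g, new, certs). g \<in> set generators) insertions"
  by code_simp+

lemma generators_bounds:
  "list_all (\<lambda>(i, w). i \<in> set [1..<5] \<and> list_all (\<lambda>j. j \<in> set [1..<13]) w) generators"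
  by code_simp

text \<open>
  The 16 coordinates of a pair \<open>(k, p)\<close>.
\<close>

definition coord :: "(nat \<Rightarrow> 'a) \<times> (nat \<Rightarrow> 'a) \<Rightarrow> nat \<Rightarrow> 'a" where
  "coord s j = (if j < 4 then fst s (j + 1) else snd s (j - 3))"

definition generator_pair :: "generator \<Rightarrow> (nat \<Rightarrow> int) \<times> (nat \<Rightarrow> int)" where
  "generator_pair g = (fund_coords (fst g), \<lambda>i. int (count_list (snd g) i))"

lemma form_coord:
  "form [a1, a2, a3, a4, b1, b2, b3, b4, b5, b6, b7, b8, b9, b10, b11, b12] (coord (k, p)) =
     of_int a1 * k 1 + of_int a2 * k 2 + of_int a3 * k 3 + of_int a4 * k 4 + of_int b1 * p 1 +
     of_int b2 * p 2 + of_int b3 * p 3 + of_int b4 * p 4 + of_int b5 * p 5 + of_int b6 * p 6 +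
     of_int b7 * p 7 + of_int b8 * p 8 + of_int b9 * p 9 + of_int b10 * p 10 + of_int b11 * p 11 +
     of_int b12 * p 12"
  by (simp add: coord_def eval_nat_numeral)

lemma form_cong: "length a = 16 \<Longrightarrow> (\<And>j. j < 16 \<Longrightarrow> x j = y j) \<Longrightarrow> form a x = form a y"
  by (simp add: form_eq_sum)

lemma coord_generator_pair:
  assumes "j < 16"
  shows "coord (generator_pair g) j = gvec g ! j"
proof -
  have "Suc (j - 4) = j - 3" if "\<not> j < 4" using that by arith
  with assms show ?thesis
    by (auto simp: coord_def generator_pair_def gvec_def nth_append nth_upt simp del: upt_Suc)
qed

lemma generator_pair_support:
  assumes "g \<in> set generators"
  shows "i \<notin> {1..4} \<Longrightarrow> fst (generator_pair g) i = 0" "i \<notin> {1..12} \<Longrightarrow> snd (generator_pair g) i = 0"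
proof -
  have "fst g \<in> set [1..<5]" "set (snd g) \<subseteq> set [1..<13]"
    using assms generators_bounds by (auto simp: list_all_iff simp del: upt_Suc)
  then show "i \<notin> {1..4} \<Longrightarrow> fst (generator_pair g) i = 0" "i \<notin> {1..12} \<Longrightarrow> snd (generator_pair g) i = 0"
    by (auto simp: generator_pair_def fund_coords_def intro!: count_notin)
qed

lemma rational_cone_add:
  assumes "(k, p) \<in> rational_cone S" "s \<in> S" "0 \<le> t"
  shows "(\<lambda>i. k i + t * of_int (fst s i), \<lambda>i. p i + t * of_int (snd s i)) \<in> rational_cone S"
proof -
  obtain F c where F: "finite F" "F \<subseteq> S" "\<forall>s\<in>F. 0 \<le> c s"
    and k: "k = (\<lambda>i. \<Sum>s\<in>F. c s * of_int (fst s i))" and p: "p = (\<lambda>i. \<Sum>s\<in>F. c s * of_int (snd s i))"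
    using assms(1) by (auto simp: rational_cone_def)
  define c' where "c' u = (if u \<in> F then c u else 0) + (if u = s then t else 0)" for u
  have sum: "(\<Sum>u\<in>insert s F. c' u * h u) = (\<Sum>u\<in>F. c u * h u) + t * h s" for h
  proof -
    have "(\<Sum>u\<in>insert s F. c' u * h u) =
        (\<Sum>u\<in>insert s F. if u \<in> F then c u * h u else 0) + (\<Sum>u\<in>insert s F. if u = s then t * h u else 0)"
      unfolding sum.distrib[symmetric] by (intro sum.cong) (auto simp: c'_def algebra_simps)
    also have "(\<Sum>u\<in>insert s F. if u \<in> F then c u * h u else 0) = (\<Sum>u\<in>F. c u * h u)"
      using F(1) by (intro sum.mono_neutral_cong_right) auto
    finally show ?thesis using F(1) by simp
  qed
  have "(\<lambda>i. k i + t * of_int (fst s i), \<lambda>i. p i + t * of_int (snd s i)) =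
      (\<lambda>i. \<Sum>u\<in>insert s F. c' u * of_int (fst u i), \<lambda>i. \<Sum>u\<in>insert s F. c' u * of_int (snd u i))"
    by (simp only: sum k p)
  moreover have "finite (insert s F)" "insert s F \<subseteq> S" "\<forall>u\<in>insert s F. 0 \<le> c' u"
    using F assms by (auto simp: c'_def)
  ultimately show ?thesis unfolding rational_cone_def by blast
qed

lemma rational_cone_0: "(\<lambda>_. 0, \<lambda>_. 0) \<in> rational_cone S"
  unfolding rational_cone_def by (intro CollectI exI[of _ "{}"]) auto

text \<open>
  The generators satisfy the inequalities, hence so does the cone. Conversely, given a point that
  satisfies them, undoing the insertions one by one subtracts nonnegative multiples of generators until
  a point of the first simplicial cone remains, which is a nonnegative combination of its basis.
\<close>

lemma rational_cone_generators:
  "rational_cone (semigroup_generated (generator_pair ` set generators)) =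
     {(k, p). (\<forall>i. i \<notin> {1..4} \<longrightarrow> k i = 0) \<and> (\<forall>i. i \<notin> {1..12} \<longrightarrow> p i = 0) \<and>
        in_hcone (coordinate_rows @ inequality_rows) (coord (k, p))}"
  (is "rational_cone ?S = ?R")
proof (intro equalityI subsetI)
  let ?rows = "coordinate_rows @ inequality_rows"
  have len: "length r = 16" if "r \<in> set ?rows" for r
    using that facet_rows_valid by (auto simp: list_all_iff)
  have S: "(\<forall>i. i \<notin> {1..4} \<longrightarrow> fst s i = 0) \<and> (\<forall>i. i \<notin> {1..12} \<longrightarrow> snd s i = 0) \<and>
      (\<forall>r\<in>set ?rows. 0 \<le> form r (\<lambda>j. of_int (coord s j)))" if "s \<in> ?S" for s
    using that
  proof induction
    case (generator s)
    then obtain g where g: "g \<in> set generators" "s = generator_pair g" by auto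
    have "0 \<le> form r (\<lambda>j. of_int (coord s j))" if r: "r \<in> set ?rows" for r
    proof -
      have "form r (\<lambda>j. of_int (coord s j)) = form r (\<lambda>j. of_int (gvec g ! j))"
        using len[OF r] by (intro form_cong) (simp_all add: g(2) coord_generator_pair)
      also have "\<dots> = of_int (dot r (gvec g))"
        using len[OF r] by (intro form_gvec) (simp add: gvec_def)
      also have "\<dots> \<ge> 0" using facet_rows_valid r g(1) by (simp only: of_int_0_le_iff list_all_iff)
      finally show ?thesis .
    qed
    then show ?case using generator_pair_support[OF g(1)] g(2) by blast
  next
    case (add s t)
    have "form r (\<lambda>j. of_int (coord (s + t) j)) =
        form r (\<lambda>j. of_int (coord s j)) + form r (\<lambda>j. of_int (coord t j))" for r
    proof -
      have "coord (s + t) j = coord s j + coord t j" for j by (simp add: coord_def plus_fun_apply)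
      then show ?thesis by (simp add: form_eq_sum distrib_left sum.distrib)
    qed
    then show ?case using add by auto
  qed
  fix kp assume "kp \<in> rational_cone ?S"
  then obtain F c where F: "finite F" "F \<subseteq> ?S" "\<forall>s\<in>F. 0 \<le> c s"
    and kp: "kp = (\<lambda>i. \<Sum>s\<in>F. c s * of_int (fst s i), \<lambda>i. \<Sum>s\<in>F. c s * of_int (snd s i))"
    unfolding rational_cone_def by blast
  have "form r (coord kp) = (\<Sum>s\<in>F. c s * form r (\<lambda>j. of_int (coord s j)))" for r
  proof -
    have "coord kp j = (\<Sum>s\<in>F. c s * of_int (coord s j))" for j
      by (simp add: kp coord_def)
    then have "form r (coord kp) = (\<Sum>j<length r. \<Sum>s\<in>F. of_int (r ! j) * (c s * of_int (coord s j)))"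
      by (simp add: form_eq_sum sum_distrib_left)
    also have "\<dots> = (\<Sum>s\<in>F. \<Sum>j<length r. of_int (r ! j) * (c s * of_int (coord s j)))"
      by (rule sum.swap)
    also have "\<dots> = (\<Sum>s\<in>F. c s * form r (\<lambda>j. of_int (coord s j)))"
      by (simp add: form_eq_sum sum_distrib_left mult_ac)
    finally show ?thesis .
  qed
  moreover have "0 \<le> (\<Sum>s\<in>F. c s * form r (\<lambda>j. of_int (coord s j)))" if "r \<in> set ?rows" for r
    using F S that by (intro sum_nonneg mult_nonneg_nonneg) blast+
  ultimately have "in_hcone ?rows (coord kp)" by (simp add: in_hcone_def)
  moreover have "fst kp i = 0" if "i \<notin> {1..4}" for i
    unfolding kp fst_conv using F(2) S that by (intro sum.neutral) auto
  moreover have "snd kp i = 0" if "i \<notin> {1..12}" for i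
    unfolding kp snd_conv using F(2) S that by (intro sum.neutral) auto
  ultimately show "kp \<in> ?R" by (cases kp) auto
next
  let ?rows = "coordinate_rows @ inequality_rows"
  define pt :: "(nat \<Rightarrow> rat) \<Rightarrow> (nat \<Rightarrow> rat) \<times> (nat \<Rightarrow> rat)" where
    "pt x = (\<lambda>i. if i \<in> {1..4} then x (i - 1) else 0, \<lambda>i. if i \<in> {1..12} then x (i + 3) else 0)" for x
  have pt_add: "pt x \<in> rational_cone ?S"
    if g: "g \<in> set generators" and t: "0 \<le> t" and "pt (\<lambda>i. x i - t * of_int (gvec g ! i)) \<in> rational_cone ?S"
    for g t x
  proof -
    let ?y = "\<lambda>i. x i - t * of_int (gvec g ! i)"
    have "(\<lambda>i. fst (pt ?y) i + t * of_int (fst (generator_pair g) i),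
           \<lambda>i. snd (pt ?y) i + t * of_int (snd (generator_pair g) i)) \<in> rational_cone ?S"
      using that by (intro rational_cone_add) (auto intro!: semigroup_generated.generator)
    moreover have "fst (pt ?y) i + t * of_int (fst (generator_pair g) i) = fst (pt x) i" for i
    proof (cases "i \<in> {1..4}")
      case True
      then obtain j where "i = Suc j" "j < 4" by (cases i) auto
      then show ?thesis using coord_generator_pair[of j g] by (simp add: pt_def coord_def)
    next
      case False
      then show ?thesis using generator_pair_support(1)[OF g, of i] by (auto simp: pt_def)
    qed
    moreover have "snd (pt ?y) i + t * of_int (snd (generator_pair g) i) = snd (pt x) i" for i
      using generator_pair_support(2)[OF g, of i] coord_generator_pair[of "i + 3" g]
      by (auto simp: pt_def coord_def)
    ultimately show ?thesis by simp
  qed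
  have gens: "g \<in> set generators" if "g \<in> fst ` set insertions \<or> g \<in> snd ` set first_simplex" for g
    using that generators_used by (auto simp: list_all_iff)
  fix kp assume kp: "kp \<in> ?R"
  have "pt (coord kp) \<in> rational_cone ?S"
  proof (rule insertions_ok_induct[OF _ insertions_ok_insertions])
    show "list_all (\<lambda>r. length r = 16) (map fst first_simplex)"
      using dual_bases_first_simplex by (auto simp: dual_bases_def list_all_iff)
    show "in_hcone ?rows (coord kp)" using kp by auto
    fix y assume "in_hcone (map fst first_simplex) y"
    then show "pt y \<in> rational_cone ?S"
    proof (rule dual_bases_induct[OF dual_bases_first_simplex])
      fix y :: "nat \<Rightarrow> rat" assume "\<And>l. l < 16 \<Longrightarrow> y l = 0"
      then have "pt y = (\<lambda>_. 0, \<lambda>_. 0)" by (auto simp: pt_def fun_eq_iff)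
      then show "pt y \<in> rational_cone ?S" by (simp add: rational_cone_0)
    qed (use pt_add gens in blast)
  qed (use pt_add gens in blast)
  moreover have "fst (pt (coord kp)) i = fst kp i" for i
    using kp by (cases i) (auto simp: pt_def coord_def)
  moreover have "snd (pt (coord kp)) i = snd kp i" for i
    using kp by (auto simp: pt_def coord_def)
  then have "pt (coord kp) = kp" using calculation(2) by (simp add: prod_eq_iff fun_eq_iff)
  ultimately show "kp \<in> rational_cone ?S" by simp
qed

lemma in_hcone_append: "in_hcone (H @ H') x \<longleftrightarrow> in_hcone H x \<and> in_hcone H' x"
  by (auto simp: in_hcone_def)

lemma in_hcone_Cons: "in_hcone [r] x \<longleftrightarrow> 0 \<le> form r x"
  "in_hcone (r # r' # H) x \<longleftrightarrow> 0 \<le> form r x \<and> in_hcone (r' # H) x"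
  by (simp_all add: in_hcone_def)

lemma in_hcone_coordinate_rows:
  "in_hcone coordinate_rows (coord (k, p)) \<longleftrightarrow> (\<forall>i\<in>{1..12}. 0 \<le> p i)"
  unfolding atLeast1_atMost12 coordinate_rows_def in_hcone_Cons form_coord by simp

section \<open>The cone of the fundamental signatures\<close>

theorem proposition4:
  fixes scale :: "complex \<Rightarrow> 'g::ab_group_add \<Rightarrow> 'g" and bracket :: "'g \<Rightarrow> 'g \<Rightarrow> 'g"
    and T :: "'g set" and \<epsilon> :: "nat \<Rightarrow> 'g \<Rightarrow> complex" and e f :: "nat \<Rightarrow> 'g"
    and scale1 :: "complex \<Rightarrow> 'v1::ab_group_add \<Rightarrow> 'v1" and act1 :: "'g \<Rightarrow> 'v1 \<Rightarrow> 'v1" and v1 :: 'v1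
    and scale2 :: "complex \<Rightarrow> 'v2::ab_group_add \<Rightarrow> 'v2" and act2 :: "'g \<Rightarrow> 'v2 \<Rightarrow> 'v2" and v2 :: 'v2
    and scale3 :: "complex \<Rightarrow> 'v3::ab_group_add \<Rightarrow> 'v3" and act3 :: "'g \<Rightarrow> 'v3 \<Rightarrow> 'v3" and v3 :: 'v3
    and scale4 :: "complex \<Rightarrow> 'v4::ab_group_add \<Rightarrow> 'v4" and act4 :: "'g \<Rightarrow> 'v4 \<Rightarrow> 'v4" and v4 :: 'v4
  assumes "d4_lie_algebra scale bracket T \<epsilon> e f"
    and "d4_irrep scale bracket T \<epsilon> e f scale1 act1 (fund_coords 1) v1"
    and "d4_irrep scale bracket T \<epsilon> e f scale2 act2 (fund_coords 2) v2"
    and "d4_irrep scale bracket T \<epsilon> e f scale3 act3 (fund_coords 3) v3"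
    and "d4_irrep scale bracket T \<epsilon> e f scale4 act4 (fund_coords 4) v4"
  shows "rational_cone (semigroup_generated
      (essential_signatures f scale1 act1 (fund_coords 1) v1 \<union>
       essential_signatures f scale2 act2 (fund_coords 2) v2 \<union>
       essential_signatures f scale3 act3 (fund_coords 3) v3 \<union>
       essential_signatures f scale4 act4 (fund_coords 4) v4)) =
    {(k, p).
       (\<forall>i. i \<notin> {1..4} \<longrightarrow> k i = 0) \<and> (\<forall>i. i \<notin> {1..12} \<longrightarrow> p i = 0) \<and>
       (\<forall>i\<in>{1..12}. 0 \<le> p i) \<and>
       p 12 \<le> k 1 \<and>
       p 11 \<le> k 2 \<and>
       p 9 \<le> k 3 \<and>
       p 4 \<le> k 4 \<and>
       p 7 + p 11 + p 12 \<le> k 1 + k 2 \<and>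
       p 7 + p 8 + p 9 + p 10 + p 12 \<le> k 1 + k 2 + k 3 \<and>
       p 7 + p 9 + p 10 + p 11 + p 12 \<le> k 1 + k 2 + k 3 \<and>
       p 9 + p 10 + p 11 \<le> k 2 + k 3 \<and>
       p 4 + p 5 + p 6 + p 7 + p 12 \<le> k 1 + k 2 + k 4 \<and>
       p 4 + p 5 + p 7 + p 11 + p 12 \<le> k 1 + k 2 + k 4 \<and>
       p 4 + p 5 + p 11 \<le> k 2 + k 4 \<and>
       p 2 + p 4 + p 5 + p 9 + p 10 \<le> k 2 + k 3 + k 4 \<and>
       p 4 + p 5 + p 9 + p 10 + p 11 \<le> k 2 + k 3 + k 4 \<and>
       p 3 + p 4 + p 5 + p 6 + p 7 + p 9 + p 12 \<le> k 1 + k 2 + k 3 + k 4 \<and>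
       p 2 + p 3 + p 4 + p 5 + p 7 + p 9 + p 12 \<le> k 1 + k 2 + k 3 + k 4 \<and>
       p 2 + p 3 + p 4 + p 7 + p 8 + p 9 + p 12 \<le> k 1 + k 2 + k 3 + k 4 \<and>
       p 2 + p 4 + p 7 + p 8 + p 9 + p 10 + p 12 \<le> k 1 + k 2 + k 3 + k 4 \<and>
       p 4 + p 5 + p 7 + p 9 + p 10 + p 11 + p 12 \<le> k 1 + k 2 + k 3 + k 4 \<and>
       p 2 + p 4 + p 5 + p 7 + p 9 + p 10 + p 12 \<le> k 1 + k 2 + k 3 + k 4 \<and>
       p 1 + p 3 + p 4 + p 5 + p 6 + p 7 + p 8 + p 9 + p 11 \<le> k 1 + 2 * k 2 + k 3 + k 4 \<and>
       p 1 + p 2 + p 3 + p 4 + p 5 + p 7 + p 8 + p 9 + p 11 \<le> k 1 + 2 * k 2 + k 3 + k 4 \<and>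
       p 3 + p 4 + p 5 + p 6 + p 7 + p 8 + p 9 + p 11 + p 12 \<le> k 1 + 2 * k 2 + k 3 + k 4 \<and>
       p 2 + p 3 + p 4 + p 5 + p 7 + p 8 + p 9 + p 11 + p 12 \<le> k 1 + 2 * k 2 + k 3 + k 4 \<and>
       p 1 + p 2 + p 4 + p 5 + p 7 + p 8 + p 9 + p 10 + p 11 \<le> k 1 + 2 * k 2 + k 3 + k 4 \<and>
       p 2 + p 4 + p 5 + p 7 + p 8 + p 9 + p 10 + p 11 + p 12 \<le> k 1 + 2 * k 2 + k 3 + k 4 \<and>
       p 1 + p 4 + p 5 + p 6 + p 7 + p 8 + p 9 + p 10 + p 11 \<le> k 1 + 2 * k 2 + k 3 + k 4 \<and>
       p 4 + p 5 + p 6 + p 7 + p 8 + p 9 + p 10 + p 11 + p 12 \<le> k 1 + 2 * k 2 + k 3 + k 4 \<and>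
       p 2 + p 3 + p 4 + p 5 + p 7 + p 8 + 2 * p 9 + p 10 + p 11 + p 12 \<le> k 1 + 2 * k 2 + 2 * k 3 + k 4 \<and>
       p 3 + p 4 + p 5 + p 6 + p 7 + p 8 + 2 * p 9 + p 10 + p 11 + p 12 \<le> k 1 + 2 * k 2 + 2 * k 3 + k 4 \<and>
       p 1 + p 2 + p 3 + p 4 + p 5 + p 7 + p 8 + 2 * p 9 + p 10 + p 11 \<le> k 1 + 2 * k 2 + 2 * k 3 + k 4 \<and>
       p 1 + p 3 + p 4 + p 5 + p 6 + p 7 + p 8 + 2 * p 9 + p 10 + p 11 \<le> k 1 + 2 * k 2 + 2 * k 3 + k 4 \<and>
       p 2 + p 4 + p 5 + p 7 + p 8 + 2 * p 9 + 2 * p 10 + p 11 + p 12 \<le> k 1 + 2 * k 2 + 2 * k 3 + k 4 \<and>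
       p 2 + p 3 + 2 * p 4 + p 5 + p 6 + p 7 + p 8 + p 9 + p 11 + p 12 \<le> k 1 + 2 * k 2 + k 3 + 2 * k 4 \<and>
       p 2 + 2 * p 4 + p 5 + p 6 + p 7 + p 8 + p 9 + p 10 + p 11 + p 12 \<le> k 1 + 2 * k 2 + k 3 + 2 * k 4 \<and>
       p 1 + p 2 + p 3 + 2 * p 4 + p 5 + p 6 + p 7 + p 8 + p 9 + p 11 \<le> k 1 + 2 * k 2 + k 3 + 2 * k 4 \<and>
       p 1 + p 2 + 2 * p 4 + p 5 + p 6 + p 7 + p 8 + p 9 + p 10 + p 11 \<le> k 1 + 2 * k 2 + k 3 + 2 * k 4 \<and>
       p 2 + p 3 + 2 * p 4 + 2 * p 5 + p 6 + p 7 + p 9 + p 11 + p 12 \<le> k 1 + 2 * k 2 + k 3 + 2 * k 4 \<and>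
       p 2 + 2 * p 4 + 2 * p 5 + p 6 + p 7 + p 9 + p 10 + p 11 + p 12 \<le> k 1 + 2 * k 2 + k 3 + 2 * k 4 \<and>
       p 3 + p 4 + p 5 + p 6 + 2 * p 7 + p 8 + p 9 + p 11 + 2 * p 12 \<le> 2 * k 1 + 2 * k 2 + k 3 + k 4 \<and>
       p 4 + p 5 + p 6 + 2 * p 7 + p 8 + p 9 + p 10 + p 11 + 2 * p 12 \<le> 2 * k 1 + 2 * k 2 + k 3 + k 4 \<and>
       p 2 + p 3 + p 4 + p 5 + 2 * p 7 + p 8 + p 9 + p 11 + 2 * p 12 \<le> 2 * k 1 + 2 * k 2 + k 3 + k 4 \<and>
       p 2 + p 4 + p 5 + 2 * p 7 + p 8 + p 9 + p 10 + p 11 + 2 * p 12 \<le> 2 * k 1 + 2 * k 2 + k 3 + k 4 \<and>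
       p 1 + p 2 + p 3 + 2 * p 4 + p 5 + p 6 + p 7 + p 8 + 2 * p 9 + p 10 + p 11 \<le> k 1 + 2 * k 2 + 2 * k 3 + 2 * k 4 \<and>
       p 2 + p 3 + 2 * p 4 + p 5 + p 6 + p 7 + p 8 + 2 * p 9 + p 10 + p 11 + p 12 \<le> k 1 + 2 * k 2 + 2 * k 3 + 2 * k 4 \<and>
       p 2 + p 3 + 2 * p 4 + 2 * p 5 + p 6 + p 7 + 2 * p 9 + p 10 + p 11 + p 12 \<le> k 1 + 2 * k 2 + 2 * k 3 + 2 * k 4 \<and>
       p 2 + p 3 + 2 * p 4 + p 5 + p 6 + 2 * p 7 + p 8 + p 9 + p 11 + 2 * p 12 \<le> 2 * k 1 + 2 * k 2 + k 3 + 2 * k 4 \<and>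
       p 2 + 2 * p 4 + p 5 + p 6 + 2 * p 7 + p 8 + p 9 + p 10 + p 11 + 2 * p 12 \<le> 2 * k 1 + 2 * k 2 + k 3 + 2 * k 4 \<and>
       p 2 + p 3 + 2 * p 4 + 2 * p 5 + p 6 + 2 * p 7 + p 9 + p 11 + 2 * p 12 \<le> 2 * k 1 + 2 * k 2 + k 3 + 2 * k 4 \<and>
       p 2 + 2 * p 4 + 2 * p 5 + p 6 + 2 * p 7 + p 9 + p 10 + p 11 + 2 * p 12 \<le> 2 * k 1 + 2 * k 2 + k 3 + 2 * k 4 \<and>
       p 2 + p 3 + p 4 + p 5 + 2 * p 7 + p 8 + 2 * p 9 + p 10 + p 11 + 2 * p 12 \<le> 2 * k 1 + 2 * k 2 + 2 * k 3 + k 4 \<and>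
       p 3 + p 4 + p 5 + p 6 + 2 * p 7 + p 8 + 2 * p 9 + p 10 + p 11 + 2 * p 12 \<le> 2 * k 1 + 2 * k 2 + 2 * k 3 + k 4 \<and>
       p 2 + p 4 + p 5 + 2 * p 7 + p 8 + 2 * p 9 + 2 * p 10 + p 11 + 2 * p 12 \<le> 2 * k 1 + 2 * k 2 + 2 * k 3 + k 4 \<and>
       p 2 + p 3 + 2 * p 4 + p 5 + p 6 + 2 * p 7 + p 8 + 2 * p 9 + p 10 + p 11 + 2 * p 12 \<le> 2 * k 1 + 2 * k 2 + 2 * k 3 + 2 * k 4 \<and>
       p 2 + p 3 + 2 * p 4 + 2 * p 5 + p 6 + 2 * p 7 + 2 * p 9 + p 10 + p 11 + 2 * p 12 \<le> 2 * k 1 + 2 * k 2 + 2 * k 3 + 2 * k 4 \<and>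
       p 2 + p 3 + 2 * p 4 + 2 * p 5 + p 6 + p 7 + p 8 + p 9 + 2 * p 11 + p 12 \<le> k 1 + 3 * k 2 + k 3 + 2 * k 4 \<and>
       p 2 + 2 * p 4 + 2 * p 5 + p 6 + p 7 + p 8 + p 9 + p 10 + 2 * p 11 + p 12 \<le> k 1 + 3 * k 2 + k 3 + 2 * k 4 \<and>
       p 1 + p 2 + p 3 + 2 * p 4 + 2 * p 5 + p 6 + p 7 + p 8 + p 9 + 2 * p 11 \<le> k 1 + 3 * k 2 + k 3 + 2 * k 4 \<and>
       p 1 + p 2 + 2 * p 4 + 2 * p 5 + p 6 + p 7 + p 8 + p 9 + p 10 + 2 * p 11 \<le> k 1 + 3 * k 2 + k 3 + 2 * k 4 \<and>
       p 1 + p 2 + 2 * p 4 + 2 * p 5 + p 6 + p 7 + p 8 + 2 * p 9 + 2 * p 10 + 2 * p 11 \<le> k 1 + 3 * k 2 + 2 * k 3 + 2 * k 4 \<and>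
       p 2 + 2 * p 4 + 2 * p 5 + p 6 + p 7 + p 8 + 2 * p 9 + 2 * p 10 + 2 * p 11 + p 12 \<le> k 1 + 3 * k 2 + 2 * k 3 + 2 * k 4 \<and>
       p 1 + p 2 + 2 * p 4 + 2 * p 5 + p 6 + 2 * p 7 + p 8 + p 9 + p 10 + 2 * p 11 + p 12 \<le> 2 * k 1 + 3 * k 2 + k 3 + 2 * k 4 \<and>
       p 1 + p 2 + p 3 + 2 * p 4 + 2 * p 5 + p 6 + 2 * p 7 + p 8 + p 9 + 2 * p 11 + p 12 \<le> 2 * k 1 + 3 * k 2 + k 3 + 2 * k 4 \<and>
       p 1 + p 2 + 2 * p 4 + 2 * p 5 + p 6 + 2 * p 7 + p 8 + 2 * p 9 + 2 * p 10 + 2 * p 11 + p 12 \<le> 2 * k 1 + 3 * k 2 + 2 * k 3 + 2 * k 4 \<and>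
       p 2 + p 3 + 2 * p 4 + 2 * p 5 + p 6 + p 7 + p 8 + 3 * p 9 + 2 * p 10 + 2 * p 11 + p 12 \<le> k 1 + 3 * k 2 + 3 * k 3 + 2 * k 4 \<and>
       p 1 + p 2 + p 3 + 2 * p 4 + 2 * p 5 + p 6 + p 7 + p 8 + 3 * p 9 + 2 * p 10 + 2 * p 11 \<le> k 1 + 3 * k 2 + 3 * k 3 + 2 * k 4 \<and>
       p 2 + p 3 + 2 * p 4 + 2 * p 5 + p 6 + 3 * p 7 + p 8 + p 9 + 2 * p 11 + 3 * p 12 \<le> 3 * k 1 + 3 * k 2 + k 3 + 2 * k 4 \<and>
       p 2 + 2 * p 4 + 2 * p 5 + p 6 + 3 * p 7 + p 8 + p 9 + p 10 + 2 * p 11 + 3 * p 12 \<le> 3 * k 1 + 3 * k 2 + k 3 + 2 * k 4 \<and>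
       p 2 + p 3 + 2 * p 4 + 2 * p 5 + p 6 + 3 * p 7 + p 8 + 3 * p 9 + 2 * p 10 + 2 * p 11 + 3 * p 12 \<le> 3 * k 1 + 3 * k 2 + 3 * k 3 + 2 * k 4 \<and>
       p 1 + p 2 + p 3 + 2 * p 4 + 2 * p 5 + p 6 + 2 * p 7 + p 8 + 3 * p 9 + 2 * p 10 + 2 * p 11 + p 12 \<le> 2 * k 1 + 3 * k 2 + 3 * k 3 + 2 * k 4 \<and>
       p 2 + 2 * p 4 + 2 * p 5 + p 6 + 3 * p 7 + p 8 + 2 * p 9 + 2 * p 10 + 2 * p 11 + 3 * p 12 \<le> 3 * k 1 + 3 * k 2 + 2 * k 3 + 2 * k 4}"
proof -
  interpret d4_lie_algebra scale bracket T \<epsilon> e f by fact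
  interpret V1: d4_irrep scale bracket T \<epsilon> e f scale1 act1 "fund_coords 1" v1 by fact
  interpret V3: d4_irrep scale bracket T \<epsilon> e f scale3 act3 "fund_coords 3" v3 by fact
  interpret V4: d4_irrep scale bracket T \<epsilon> e f scale4 act4 "fund_coords 4" v4 by fact
  have hw: "highest_weight (fund_coords 1) = (2, 0, 0, 0)" "highest_weight (fund_coords 3) = (1, 1, 1, -1)"
    "highest_weight (fund_coords 4) = (1, 1, 1, 1)"
    by (simp_all add: highest_weight_def fund_coords_def)
  have Nil: "[] \<in> set words1" "[] \<in> set words3" "[] \<in> set words4"
    by (simp_all add: words1_def words3_def words4_def)
  have ess: "essential_signatures f scale1 act1 (fund_coords 1) v1 =
      (\<lambda>w. (fund_coords 1, \<lambda>i. int (count_list w i))) ` set words1"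
    "essential_signatures f scale2 act2 (fund_coords 2) v2 =
      (\<lambda>w. (fund_coords 2, \<lambda>i. int (count_list w i))) ` set words2"
    "essential_signatures f scale3 act3 (fund_coords 3) v3 =
      (\<lambda>w. (fund_coords 3, \<lambda>i. int (count_list w i))) ` set words3"
    "essential_signatures f scale4 act4 (fund_coords 4) v4 =
      (\<lambda>w. (fund_coords 4, \<lambda>i. int (count_list w i))) ` set words4"
    using minuscule_words Nil
      V1.essential_signatures_minuscule[of words1] V3.essential_signatures_minuscule[of words3]
      V4.essential_signatures_minuscule[of words4]
      essential_signatures_unique[OF assms(3) adjoint_irrep] essential_signatures_adjoint
    by (simp_all only: minuscule_words_def hw)
  have gens: "(\<lambda>w. (fund_coords 1, \<lambda>i. int (count_list w i))) ` set words1 \<union>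
      (\<lambda>w. (fund_coords 2, \<lambda>i. int (count_list w i))) ` set words2 \<union>
      (\<lambda>w. (fund_coords 3, \<lambda>i. int (count_list w i))) ` set words3 \<union>
      (\<lambda>w. (fund_coords 4, \<lambda>i. int (count_list w i))) ` set words4 = generator_pair ` set generators"
    by (simp add: generators_def generator_pair_def image_Un image_image Un_assoc)
  have conj: "P = P' \<Longrightarrow> Q = Q' \<Longrightarrow> (P \<and> Q) = (P' \<and> Q')" for P P' Q Q' by simp
  \<comment> \<open>Both sides are now conjunctions in the same order and can be compared one by one.\<close>
  show ?thesis
    unfolding ess gens rational_cone_generators in_hcone_append in_hcone_coordinate_rows
    unfolding inequality_rows_def in_hcone_Cons form_coord
    by (intro arg_cong[of _ _ Collect] arg_cong[of _ _ case_prod] ext conj refl;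
        simp only: of_int_0 of_int_1 of_int_minus of_int_neg_numeral of_int_numeral;
        intro iffI; linarith)
qed

end
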